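(* Let $d\ge1$ and $1<p<q<\infty$ with $q\ge\tfrac{d+2}{d}p'$ and $q>\tfrac{2(d+1)}{d}$, and assume that the restriction conjecture for $\mathcal{E}$ holds on a neighborhood of $(p,q)$. Let $\{f_n\}$ be a bounded sequence in $L^p(\mathbb{S}^d)$ satisfying $$\lim_{M\to\infty}\limsup_{n\to\infty}\|\mathcal{E}(f_n\chi_{\{|f_n|>M\}})\|_{L^q(\mathbb{R}^{d+1})}=0.$$ After passing to a subsequence, there exist $\{x_n^j\}_{j,n\in\mathbb{N}}\subseteq\mathbb{R}^{d+1}$ obeying $\lim_{n\to\infty}|x_n^j-x_n^{j'}|=\infty$ for $j\ne j'$, and weak limits $\phi^j=\operatorname{wk-lim}_{n\to\infty}e^{-ix_n^j\cdot\omega}f_n$ in $L^p(\mathbb{S}^d)$, such that $$\Bigl(\sum_j\|\phi^j\|_{L^p(\mathbb{S}^d)}^{\tilde p}\Bigr)^{\frac1{\tilde p}}\le\liminf_{n\to\infty}\|f_n\|_{L^p(\mathbb{S}^d)},$$ and for every $J\in\mathbb{N}$, $$\limsup_{n\to\infty}\Bigl\|\sum_{j=1}^Je^{ix_n^j\cdot\omega}\phi^j\Bigr\|_{L^p(\mathbb{S}^d)}\le\Bigl(\sum_{j=1}^J\|\phi^j\|_{L^p(\mathbb{S}^d)}^{\tilde p'}\Bigr)^{\frac1{\tilde p'}},$$ and the remainders $r_n^J:=f_n-\sum_{j=1}^Je^{ix_n^j\cdot\omega}\phi^j$ satisfy $$\lim_{n\to\infty}\Bigl(\|\mathcal{E}f_n\|_{L^q(\mathbb{R}^{d+1})}^q-\sum_{j=1}^J\|\mathcal{E}\phi^j\|_{L^q(\mathbb{R}^{d+1})}^q-\|\mathcal{E}r_n^J\|_{L^q(\mathbb{R}^{d+1})}^q\Bigr)=0,\qquad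 J\in\mathbb{N},$$ $$\lim_{J\to\infty}\limsup_{n\to\infty}\|\mathcal{E}r_n^J\|_{L^q(\mathbb{R}^{d+1})}=0.$$
   Context: $\mathbb{S}^d\subseteq\mathbb{R}^{d+1}$ is the unit sphere, $\sigma$ is $d$-dimensional Hausdorff measure on it, $L^p(\mathbb{S}^d)=L^p(\mathbb{S}^d;d\sigma)$. The extension operator is $\mathcal{E}f(x)=\int_{\mathbb{S}^d}e^{ix\cdot\omega}f(\omega)\,d\sigma(\omega)$, $x\in\mathbb{R}^{d+1}$, with operator norm $S_{p\to q}=\sup\{\|\mathcal{E}f\|_{L^q(\mathbb{R}^{d+1})}: f\in C^\infty(\mathbb{S}^d),\ \|f\|_{L^p(\mathbb{S}^d)}=1\}$. A prime on an exponent denotes the conjugate exponent, and $\tilde p:=\max\{p,p'\}$, so $\tilde p'=(\tilde p)'$. The restriction (equivalently, extension) conjecture for $\mathcal{E}$ is said to hold at $(p,q)\in[1,\infty]^2$ if $S_{p\to q}<\infty$, or if $q\le\tfrac{2(d+1)}{d}$, or if $q<\tfrac{d+2}{d}p'$. It holds on a neighborhood of $(p,q)$ if it holds at every pair in some neighborhood of $(p,q)$ in $[1,\infty]^2$. *)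

theory Defs
  imports "HOL-Analysis.Analysis" "HOL-Probability.Essential_Supremum"
begin

section \<open>Hausdorff measure and the surface measure of the sphere\<close>

text \<open>
  \<open>hausdorff_content d \<delta>\<close> is the infimum of \<open>\<Sum>i. \<omega>\<^sub>d (diam (C i) / 2) ^ d\<close> over the countable covers
  by sets of diameter at most \<open>\<delta>\<close>, where \<open>\<omega>\<^sub>d\<close> is the volume of the unit ball of \<open>\<real>\<^sup>d\<close>; with this
  constant \<open>d\<close>-dimensional Hausdorff measure on \<open>\<real>\<^sup>d\<close> is Lebesgue measure.
  Boundedness is required separately because \<open>diameter\<close> is unspecified on unbounded sets, and empty
  sets are made to contribute \<open>0\<close> because \<open>0 ^ 0 = 1\<close>.
\<close>

definition hausdorff_content :: "nat \<Rightarrow> real \<Rightarrow> 'a::metric_space set \<Rightarrow> ennreal" where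
  "hausdorff_content d \<delta> A =
    (INF C \<in> {C :: nat \<Rightarrow> 'a set. A \<subseteq> (\<Union>i. C i) \<and> (\<forall>i. bounded (C i) \<and> diameter (C i) \<le> \<delta>)}.
      \<Sum>i. if C i = {} then 0 else ennreal (unit_ball_vol (real d) * (diameter (C i) / 2) ^ d))"

definition hausdorff_outer_measure :: "nat \<Rightarrow> 'a::metric_space set \<Rightarrow> ennreal" where
  "hausdorff_outer_measure d A = (SUP \<delta> \<in> {0<..}. hausdorff_content d \<delta> A)"

text \<open>
  The restriction of a metric outer measure to the Borel sets is countably additive, so
  \<open>measure_of\<close> does not degenerate here.
\<close>

definition hausdorff_measure :: "nat \<Rightarrow> 'a::metric_space measure" where
  "hausdorff_measure d = measure_of UNIV (sets borel) (hausdorff_outer_measure d)"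

definition sphere_measure :: "'a::euclidean_space measure" where
  "sphere_measure = restrict_space (hausdorff_measure (DIM('a) - 1)) (sphere 0 1)"

section \<open>Lebesgue spaces\<close>

text \<open>
  Conjugate exponent \<open>1/p + 1/p' = 1\<close>. The overloading covers real \<open>p > 1\<close> as well as
  \<open>p \<in> [1,\<infinity>]\<close> in \<^typ>\<open>ennreal\<close>, where \<open>inverse 0 = \<infinity>\<close> and \<open>inverse \<infinity> = 0\<close> give \<open>1' = \<infinity>\<close>
  and \<open>\<infinity>' = 1\<close>.
\<close>

definition conj_exponent :: "'a::{one,minus,inverse} \<Rightarrow> 'a" where
  "conj_exponent p = inverse (1 - inverse p)"

text \<open>Used for exponents \<open>a > 0\<close> only.\<close>

definition ennreal_powr :: "ennreal \<Rightarrow> real \<Rightarrow> ennreal" where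
  "ennreal_powr x a = (if x = \<infinity> then \<infinity> else ennreal (enn2real x powr a))"

definition Lnorm :: "ennreal \<Rightarrow> 'b measure \<Rightarrow> ('b \<Rightarrow> complex) \<Rightarrow> ennreal" where
  "Lnorm p M f =
    (if p = \<infinity> then esssup M (\<lambda>x. ennreal (norm (f x)))
     else ennreal_powr (\<integral>\<^sup>+x. ennreal (norm (f x) powr enn2real p) \<partial>M) (1 / enn2real p))"

definition Lspace :: "ennreal \<Rightarrow> 'b measure \<Rightarrow> ('b \<Rightarrow> complex) set" where
  "Lspace p M = {f \<in> borel_measurable M. Lnorm p M f < \<infinity>}"

text \<open>
  Elements of \<open>Lspace\<close> are functions, not classes; a functional bounded by \<open>Lnorm\<close> automatically
  takes equal values at functions that agree almost everywhere, so these are the elements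
  of the dual of the Banach space \<open>L\<^sup>p\<close>.
\<close>

definition bounded_Lfunctional ::
    "ennreal \<Rightarrow> 'b measure \<Rightarrow> (('b \<Rightarrow> complex) \<Rightarrow> complex) \<Rightarrow> bool" where
  "bounded_Lfunctional p M \<Lambda> \<longleftrightarrow>
    (\<forall>f\<in>Lspace p M. \<forall>g\<in>Lspace p M. \<forall>a b.
        \<Lambda> (\<lambda>x. a * f x + b * g x) = a * \<Lambda> f + b * \<Lambda> g) \<and>
    (\<exists>C::real. \<forall>f\<in>Lspace p M. ennreal (norm (\<Lambda> f)) \<le> ennreal C * Lnorm p M f)"

definition weak_Llimit ::
    "ennreal \<Rightarrow> 'b measure \<Rightarrow> (nat \<Rightarrow> 'b \<Rightarrow> complex) \<Rightarrow> ('b \<Rightarrow> complex) \<Rightarrow> bool" where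
  "weak_Llimit p M g \<phi> \<longleftrightarrow>
    (\<forall>n. g n \<in> Lspace p M) \<and> \<phi> \<in> Lspace p M \<and>
    (\<forall>\<Lambda>. bounded_Lfunctional p M \<Lambda> \<longrightarrow> (\<lambda>n. \<Lambda> (g n)) \<longlonglongrightarrow> \<Lambda> \<phi>)"

section \<open>The extension operator and the restriction conjecture\<close>

definition modulate :: "'a::euclidean_space \<Rightarrow> ('a \<Rightarrow> complex) \<Rightarrow> 'a \<Rightarrow> complex" where
  "modulate x f = (\<lambda>\<omega>. exp (\<i> * complex_of_real (x \<bullet> \<omega>)) * f \<omega>)"

definition extension_op :: "('a::euclidean_space \<Rightarrow> complex) \<Rightarrow> 'a \<Rightarrow> complex" where
  "extension_op f x = (\<integral>\<omega>. exp (\<i> * complex_of_real (x \<bullet> \<omega>)) * f \<omega> \<partial>sphere_measure)"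

text \<open>For open \<open>U\<close>, membership in \<open>C\<^sup>k(U)\<close>, by iterated directional derivatives.\<close>

primrec Ck_on :: "nat \<Rightarrow> ('a::euclidean_space \<Rightarrow> complex) \<Rightarrow> 'a set \<Rightarrow> bool" where
  "Ck_on 0 f U \<longleftrightarrow> continuous_on U f"
| "Ck_on (Suc k) f U \<longleftrightarrow>
    (\<forall>x\<in>U. f differentiable (at x)) \<and> (\<forall>v. Ck_on k (\<lambda>x. frechet_derivative f (at x) v) U)"

text \<open>Smooth functions on the (embedded, closed) unit sphere: those with a smooth extension to a
  neighborhood of it.\<close>

definition smooth_on_sphere :: "('a::euclidean_space \<Rightarrow> complex) \<Rightarrow> bool" where
  "smooth_on_sphere f \<longleftrightarrow>
    (\<exists>U F. open U \<and> sphere 0 1 \<subseteq> U \<and> (\<forall>k. Ck_on k F U) \<and> (\<forall>\<omega>\<in>sphere 0 1. F \<omega> = f \<omega>))"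

definition extension_norm :: "'a::euclidean_space itself \<Rightarrow> ennreal \<Rightarrow> ennreal \<Rightarrow> ennreal" where
  "extension_norm _ p q =
    (SUP f \<in> {f :: 'a \<Rightarrow> complex. smooth_on_sphere f \<and> Lnorm p sphere_measure f = 1}.
      Lnorm q lborel (extension_op f))"

text \<open>Here \<open>d\<close> is the dimension of the sphere, so that \<open>DIM('a) = d + 1\<close>.\<close>

definition restriction_conjecture_at :: "'a::euclidean_space itself \<Rightarrow> ennreal \<Rightarrow> ennreal \<Rightarrow> bool" where
  "restriction_conjecture_at T p q \<longleftrightarrow>
    (let d = real (DIM('a) - 1) in
      extension_norm T p q < \<infinity> \<or>
      q \<le> ennreal (2 * (d + 1) / d) \<or>
      q < ennreal ((d + 2) / d) * conj_exponent p)"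

definition restriction_conjecture_near :: "'a::euclidean_space itself \<Rightarrow> ennreal \<Rightarrow> ennreal \<Rightarrow> bool" where
  "restriction_conjecture_near T p q \<longleftrightarrow>
    (\<exists>U. openin (top_of_set ({1..} \<times> {1..})) U \<and> (p, q) \<in> U \<and>
      (\<forall>(a, b)\<in>U. restriction_conjecture_at T a b))"

end

theory Submission
  imports Defs "HOL-Complex_Analysis.Complex_Analysis"
begin

text \<open>
  A bounded function has an extension in \<open>L\<^sup>r\<close> for some \<open>r < q\<close>, with \<open>r\<close> an exponent in the
  neighborhood where the conjecture holds, so that its extension is small in \<open>L\<^sup>q\<close> as soon as it is
  uniformly small. Hence one repeatedly extracts peaks: \<open>x\<^sub>n\<^sup>j\<close> is (up to sign) a near-maximum of the
  extension of the current remainder of one of the truncations \<open>f\<^sub>n \<chi>{|f\<^sub>n| \<le> M}\<close>, far away from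
  the previous peaks, every \<open>M\<close> being treated infinitely often. All extensions are equi-Lipschitz, so
  translates of them converge pointwise along subsequences, and an extension in \<open>L\<^sup>q\<close> vanishes at
  infinity. With the Brezis-Lieb lemma this gives the decoupling of the \<open>L\<^sup>q\<close> norms. As trigonometric
  polynomials are dense in \<open>L\<^sup>p\<close>, pointwise convergence of the extensions of a bounded sequence is
  weak convergence of the sequence, by the Riesz representation theorem.

  The Riemann-Lebesgue lemma for \<open>\<sigma>\<close> is the vanishing at infinity of the extensions of indicators, so
  the modulations \<open>e\<^sup>i\<^sup>x\<^sup>\<cdot>\<^sup>\<omega>\<close> are asymptotically orthonormal on every set. The upper bound for sums of
  modulated profiles is then a Hausdorff-Young inequality, obtained from the three lines theorem, and
  the lower bound for \<open>f\<^sub>n\<close> is dual to it.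
\<close>

section \<open>The spaces \<open>L\<^sup>p\<close>\<close>

text \<open>The pair (p, q) may lie on the scaling line q = (d+2)/d p', where the conjecture asserts
  no bound for a smaller q with the same p. Raising p to some p1 > p makes room for q1 < q, and
  bounded functions lie in L^p1: this is why a neighborhood is assumed and why truncations enter.
  The profiles, however, must belong to f_n itself. So one family of centres is extracted for f_n
  and all its truncations together; the difference of f_n and a truncation is small by hypothesis,
  and by decoupling so is its remainder at the shared centres. Weak limits are tested on abstract
  functionals, while the selection yields pointwise limits of extensions; the Riesz theorem links
  the two in both directions. The exponents min(p,p') and max(p,p') come from interpolating the
  trivial bound l^1 to L^infinity with an asymptotic Bessel inequality l^2 to L^2 if p >= 2, and
  from Hoelder's inequality based on L^2 if p < 2. This is done on level sets where all profiles are
  constant; Minkowski's inequality glues the pieces. The constant must be the measure of the level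
  set, hence the uniform treatment of indicators.\<close>

definition Lp :: "real \<Rightarrow> 'b measure \<Rightarrow> ('b \<Rightarrow> complex) set" where
  "Lp p M = {f \<in> borel_measurable M. integrable M (\<lambda>x. norm (f x) powr p)}"

text \<open>If |f|^p is not integrable, the Bochner integral has the default value 0, so
  \<open>Ip\<close> and \<open>lpn\<close> measure size only together with membership in
  \<open>Lp\<close>. The link to \<open>Lnorm\<close> is \<open>Lnorm_eq_lpn\<close>.\<close>

definition Ip :: "real \<Rightarrow> 'b measure \<Rightarrow> ('b \<Rightarrow> complex) \<Rightarrow> real" where
  "Ip p M f = (\<integral>x. norm (f x) powr p \<partial>M)"

definition lpn :: "real \<Rightarrow> 'b measure \<Rightarrow> ('b \<Rightarrow> complex) \<Rightarrow> real" where
  "lpn p M f = Ip p M f powr (1 / p)"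

lemma LpI: "f \<in> borel_measurable M \<Longrightarrow> integrable M (\<lambda>x. norm (f x) powr p) \<Longrightarrow> f \<in> Lp p M"
  by (simp add: Lp_def)

lemma Lp_measurable [measurable_dest]: "f \<in> Lp p M \<Longrightarrow> f \<in> borel_measurable M"
  by (simp add: Lp_def)

lemma Lp_integrable: "f \<in> Lp p M \<Longrightarrow> integrable M (\<lambda>x. norm (f x) powr p)"
  by (simp add: Lp_def)

lemma Ip_nonneg [simp]: "0 \<le> Ip p M f"
  by (simp add: Ip_def)

lemma lpn_nonneg [simp]: "0 \<le> lpn p M f"
  by (simp add: lpn_def)

lemma lpn_powr: "p > 0 \<Longrightarrow> lpn p M f powr p = Ip p M f"
  by (simp add: lpn_def powr_powr)

lemma lpn_le_iff: "p > 0 \<Longrightarrow> 0 \<le> a \<Longrightarrow> lpn p M f \<le> a \<longleftrightarrow> Ip p M f \<le> a powr p"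
  by (metis Ip_nonneg linorder_not_le lpn_nonneg lpn_powr powr_less_mono2 powr_mono2 order_less_imp_le)

lemma Lp_mono:
  assumes "g \<in> Lp p M" "f \<in> borel_measurable M" "0 \<le> p"
    and "\<And>x. x \<in> space M \<Longrightarrow> norm (f x) \<le> norm (g x)"
  shows "f \<in> Lp p M"
proof (rule LpI)
  show "integrable M (\<lambda>x. norm (f x) powr p)"
    by (rule Bochner_Integration.integrable_bound[OF Lp_integrable[OF assms(1)]])
       (use assms in \<open>auto intro!: powr_mono2\<close>)
qed fact

lemma Ip_mono:
  assumes "g \<in> Lp p M" "f \<in> borel_measurable M" "0 \<le> p"
    and "\<And>x. x \<in> space M \<Longrightarrow> norm (f x) \<le> norm (g x)"
  shows "Ip p M f \<le> Ip p M g"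
  unfolding Ip_def
  by (rule integral_mono[OF Lp_integrable[OF Lp_mono[OF assms]] Lp_integrable[OF assms(1)]])
     (use assms in \<open>auto intro!: powr_mono2\<close>)

lemma lpn_mono:
  assumes "g \<in> Lp p M" "f \<in> borel_measurable M" "0 < p"
    and "\<And>x. x \<in> space M \<Longrightarrow> norm (f x) \<le> norm (g x)"
  shows "lpn p M f \<le> lpn p M g"
  unfolding lpn_def using Ip_mono[of g p M f] assms by (auto intro!: powr_mono2)

lemma Ip_cong: "(\<And>x. x \<in> space M \<Longrightarrow> norm (f x) = norm (g x)) \<Longrightarrow> Ip p M f = Ip p M g"
  unfolding Ip_def by (rule Bochner_Integration.integral_cong) auto

lemma lpn_cong: "(\<And>x. x \<in> space M \<Longrightarrow> norm (f x) = norm (g x)) \<Longrightarrow> lpn p M f = lpn p M g"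
  unfolding lpn_def by (metis Ip_cong)

lemma Lp_zero [simp]: "(\<lambda>x. 0) \<in> Lp p M"
  by (simp add: Lp_def)

lemma lpn_zero [simp]: "lpn p M (\<lambda>x. 0) = 0"
  by (simp add: lpn_def Ip_def)

lemma Lp_scale:
  assumes "f \<in> Lp p M" shows "(\<lambda>x. c * f x) \<in> Lp p M"
  using assms by (auto simp: Lp_def norm_mult powr_mult)

lemma Ip_scale: "Ip p M (\<lambda>x. c * f x) = norm c powr p * Ip p M f"
  by (simp add: Ip_def norm_mult powr_mult)

lemma lpn_scale: "0 < p \<Longrightarrow> lpn p M (\<lambda>x. c * f x) = norm c * lpn p M f"
  by (simp add: lpn_def Ip_scale powr_mult powr_powr)

text \<open>The bound |a + b| <= 2 max(|a|, |b|) costs a factor 2^p but covers every p >= 0; this is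
  enough for membership in \<open>Lp\<close>.\<close>

lemma norm_add_powr_le:
  fixes a b :: complex
  assumes "0 \<le> p"
  shows "norm (a + b) powr p \<le> 2 powr p * (norm a powr p + norm b powr p)"
proof -
  have "norm (a + b) \<le> 2 * max (norm a) (norm b)"
    using norm_triangle_ineq[of a b] by linarith
  then have "norm (a + b) powr p \<le> (2 * max (norm a) (norm b)) powr p"
    using assms by (intro powr_mono2) auto
  also have "\<dots> = 2 powr p * (max (norm a) (norm b)) powr p"
    by (simp add: powr_mult)
  also have "\<dots> \<le> 2 powr p * (norm a powr p + norm b powr p)"
    by (intro mult_left_mono) (auto simp: max_def)
  finally show ?thesis .
qed

lemma Lp_add:
  assumes "f \<in> Lp p M" "g \<in> Lp p M" "0 \<le> p"
  shows "(\<lambda>x. f x + g x) \<in> Lp p M"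
proof (rule LpI)
  have [measurable]: "f \<in> borel_measurable M" "g \<in> borel_measurable M"
    using assms by (auto dest: Lp_measurable)
  show "(\<lambda>x. f x + g x) \<in> borel_measurable M" by measurable
  show "integrable M (\<lambda>x. norm (f x + g x) powr p)"
  proof (rule Bochner_Integration.integrable_bound)
    show "integrable M (\<lambda>x. 2 powr p * (norm (f x) powr p + norm (g x) powr p))"
      using assms by (auto dest: Lp_integrable)
  qed (use norm_add_powr_le[OF assms(3)] in auto)
qed

lemma Lp_diff:
  assumes "f \<in> Lp p M" "g \<in> Lp p M" "0 \<le> p"
  shows "(\<lambda>x. f x - g x) \<in> Lp p M"
  using Lp_add[OF assms(1) Lp_scale[OF assms(2), of "-1"] assms(3)] by simp

lemma Lp_sum:
  assumes "\<And>i. i \<in> A \<Longrightarrow> f i \<in> Lp p M" "0 \<le> p"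
  shows "(\<lambda>x. \<Sum>i\<in>A. f i x) \<in> Lp p M"
proof (cases "finite A")
  case True
  then show ?thesis using assms(1)
    by (induction A) (auto intro!: Lp_add simp: assms)
qed simp

text \<open>Rearranged, t^p lies above its tangent line at c. It is Young's inequality for a and
  c^(p-1).\<close>

lemma Young_tangent:
  fixes a c p :: real
  assumes "1 < p" "0 \<le> a" "0 \<le> c"
  shows "p * c powr (p - 1) * a \<le> a powr p + (p - 1) * c powr p"
proof -
  define q where "q = p / (p - 1)"
  have q: "q > 1" "1/p + 1/q = 1" using assms by (auto simp: q_def field_simps)
  have "a * c powr (p - 1) \<le> a powr p / p + (c powr (p - 1)) powr q / q"
    by (rule Youngs_inequality) (use assms q in auto)
  also have "(c powr (p - 1)) powr q = c powr p"
    using assms by (simp add: powr_powr q_def)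
  finally have "p * (a * c powr (p - 1)) \<le> p * (a powr p / p + c powr p / q)"
    using assms by (intro mult_left_mono) auto
  also have "\<dots> = a powr p + (p - 1) * c powr p"
    using assms by (simp add: q_def field_simps)
  finally show ?thesis by (simp add: mult_ac)
qed

text \<open>Averaging the tangent inequalities at the point s a + t b makes the linear terms combine
  to p c^p.\<close>

lemma powr_convex_comb:
  fixes a b s t p :: real
  assumes "1 \<le> p" "0 \<le> a" "0 \<le> b" "0 \<le> s" "0 \<le> t" "s + t = 1"
  shows "(s * a + t * b) powr p \<le> s * a powr p + t * b powr p"
proof (cases "p = 1")
  case True
  then show ?thesis using assms by simp
next
  case False
  then have p: "1 < p" using assms by simp
  define c where "c = s * a + t * b"
  have c: "0 \<le> c" using assms by (simp add: c_def)
  have "s * (p * c powr (p - 1) * a) + t * (p * c powr (p - 1) * b)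
     \<le> s * (a powr p + (p - 1) * c powr p) + t * (b powr p + (p - 1) * c powr p)"
    using assms p c by (intro add_mono mult_left_mono Young_tangent) auto
  also have "s * (p * c powr (p - 1) * a) + t * (p * c powr (p - 1) * b) = p * (c powr (p - 1) * c)"
    by (simp add: c_def algebra_simps)
  also have "c powr (p - 1) * c = c powr p"
    using c p by (cases "c = 0") (auto simp: powr_diff)
  also have "s * (a powr p + (p - 1) * c powr p) + t * (b powr p + (p - 1) * c powr p)
     = s * a powr p + t * b powr p + (s + t) * ((p - 1) * c powr p)"
    by (simp add: algebra_simps)
  finally have "p * c powr p \<le> s * a powr p + t * b powr p + (p - 1) * c powr p"
    using assms by simp
  then have "c powr p \<le> s * a powr p + t * b powr p" by (simp add: algebra_simps)
  then show ?thesis by (simp add: c_def)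
qed

text \<open>Removes the slack e from estimates in which norms were replaced by norms plus e, a
  device that makes them safe to divide by.\<close>

lemma le_limit_right:
  fixes A X :: real and F :: "real \<Rightarrow> real"
  assumes "\<And>e. 0 < e \<Longrightarrow> X \<le> F e" "isCont F 0"
  shows "X \<le> F 0"
proof (rule tendsto_lowerbound)
  show "(F \<longlongrightarrow> F 0) (at_right 0)"
    using assms(2) unfolding isCont_def by (rule tendsto_within_subset) simp
  show "eventually (\<lambda>e. X \<le> F e) (at_right 0)"
    using assms(1) by (auto simp: eventually_at_right_field intro: exI[of _ 1])
qed auto

text \<open>Young's inequality for f / a and g / b, where a and b exceed the norms by e and are
  therefore positive.\<close>

lemma Holder:
  fixes f g :: "'b \<Rightarrow> complex"
  assumes pq: "1 < p" "1 < q" "1/p + 1/q = 1" and f: "f \<in> Lp p M" and g: "g \<in> Lp q M"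
  shows "integrable M (\<lambda>x. f x * g x)"
    and "(\<integral>x. norm (f x) * norm (g x) \<partial>M) \<le> lpn p M f * lpn q M g"
    and "norm (\<integral>x. f x * g x \<partial>M) \<le> lpn p M f * lpn q M g"
proof -
  have [measurable]: "f \<in> borel_measurable M" "g \<in> borel_measurable M"
    using f g by (auto dest: Lp_measurable)
  have Y: "norm (f x) * norm (g x) \<le> a * b * ((norm (f x) powr p / a powr p) / p + (norm (g x) powr q / b powr q) / q)"
    if "0 < a" "0 < b" for a b x
  proof -
    have "(norm (f x) / a) * (norm (g x) / b) \<le> (norm (f x) / a) powr p / p + (norm (g x) / b) powr q / q"
      by (rule Youngs_inequality) (use pq that in auto)
    then have "a * b * ((norm (f x) / a) * (norm (g x) / b)) \<le> a * b * ((norm (f x) / a) powr p / p + (norm (g x) / b) powr q / q)"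
      using that by (intro mult_left_mono) auto
    then show ?thesis using that by (simp add: powr_divide)
  qed
  have int: "integrable M (\<lambda>x. a * b * ((norm (f x) powr p / a powr p) / p + (norm (g x) powr q / b powr q) / q))" for a b
    using Lp_integrable[OF f] Lp_integrable[OF g]
    by (intro integrable_mult_right Bochner_Integration.integrable_add integrable_divide)
  show I: "integrable M (\<lambda>x. f x * g x)"
    by (rule Bochner_Integration.integrable_bound[OF int[of 1 1]])
       (use Y[of 1 1] in \<open>auto simp: norm_mult intro!: order_trans[OF _ abs_ge_self]\<close>)
  then have I': "integrable M (\<lambda>x. norm (f x) * norm (g x))"
    using integrable_norm[OF I] by (simp add: norm_mult)
  have K: "(\<integral>x. norm (f x) * norm (g x) \<partial>M) \<le> (lpn p M f + e) * (lpn q M g + e)" if e: "0 < e" for e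
  proof -
    define a where "a = lpn p M f + e"
    define b where "b = lpn q M g + e"
    have ab: "0 < a" "0 < b" "lpn p M f \<le> a" "lpn q M g \<le> b" using e by (auto simp: a_def b_def add_nonneg_pos)
    have F: "Ip p M f \<le> a powr p" "Ip q M g \<le> b powr q" 
      using ab pq lpn_le_iff[of p a M f] lpn_le_iff[of q b M g] by auto
    have "(\<integral>x. norm (f x) * norm (g x) \<partial>M) \<le>
       (\<integral>x. a * b * ((norm (f x) powr p / a powr p) / p + (norm (g x) powr q / b powr q) / q) \<partial>M)"
      by (rule integral_mono[OF I' int]) (rule Y[OF ab(1,2)])
    also have "\<dots> = a * b * ((Ip p M f / a powr p) / p + (Ip q M g / b powr q) / q)"
      using f g by (auto simp: Ip_def dest!: Lp_integrable)
    also have "\<dots> \<le> a * b * (1 / p + 1 / q)"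
      using ab pq F by (intro mult_left_mono add_mono divide_right_mono) auto
    finally show ?thesis using pq by (simp add: a_def b_def)
  qed
  show H: "(\<integral>x. norm (f x) * norm (g x) \<partial>M) \<le> lpn p M f * lpn q M g"
    using le_limit_right[of _ "\<lambda>e. (lpn p M f + e) * (lpn q M g + e)", OF K] by simp
  show "norm (\<integral>x. f x * g x \<partial>M) \<le> lpn p M f * lpn q M g"
    using integral_norm_bound[of M "\<lambda>x. f x * g x"] H by (simp add: norm_mult)
qed

text \<open>With a, b slightly above the two norms, |f| + |g| is a + b times a convex combination of
  |f| / a and |g| / b, to which convexity of t^p applies.\<close>

lemma lpn_triangle:
  fixes f g :: "'b \<Rightarrow> complex"
  assumes p: "1 \<le> p" and f: "f \<in> Lp p M" and g: "g \<in> Lp p M"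
  shows "lpn p M (\<lambda>x. f x + g x) \<le> lpn p M f + lpn p M g"
proof -
  have fg: "(\<lambda>x. f x + g x) \<in> Lp p M" using Lp_add[OF f g] p by simp
  have K: "lpn p M (\<lambda>x. f x + g x) \<le> (lpn p M f + e) + (lpn p M g + e)" if e: "0 < e" for e
  proof -
    define a where "a = lpn p M f + e"
    define b where "b = lpn p M g + e"
    have ab: "0 < a" "0 < b" "lpn p M f \<le> a" "lpn p M g \<le> b" using e by (auto simp: a_def b_def add_nonneg_pos)
    have F: "Ip p M f \<le> a powr p" "Ip p M g \<le> b powr p" 
      using ab p lpn_le_iff[of p a M f] lpn_le_iff[of p b M g] by auto
    have Y: "norm (f x + g x) powr p \<le> (a + b) powr p * (a / (a + b) * (norm (f x) powr p / a powr p) + b / (a + b) * (norm (g x) powr p / b powr p))" for x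
    proof -
      have "norm (f x + g x) \<le> norm (f x) + norm (g x)" by (rule norm_triangle_ineq)
      also have "\<dots> = (a + b) * (a / (a + b) * (norm (f x) / a) + b / (a + b) * (norm (g x) / b))"
        using ab by (simp add: distrib_left)
      finally have "norm (f x + g x) powr p \<le> ((a + b) * (a / (a + b) * (norm (f x) / a) + b / (a + b) * (norm (g x) / b))) powr p"
        using p by (intro powr_mono2) auto
      also have "\<dots> = (a + b) powr p * (a / (a + b) * (norm (f x) / a) + b / (a + b) * (norm (g x) / b)) powr p"
        by (rule powr_mult)
      also have "\<dots> \<le> (a + b) powr p * (a / (a + b) * (norm (f x) / a) powr p + b / (a + b) * (norm (g x) / b) powr p)"
        using ab p by (intro mult_left_mono powr_convex_comb) (auto simp: add_divide_distrib[symmetric])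
      finally show ?thesis using ab by (simp add: powr_divide)
    qed
    have "Ip p M (\<lambda>x. f x + g x) \<le> (\<integral>x. (a + b) powr p * (a / (a + b) * (norm (f x) powr p / a powr p) + b / (a + b) * (norm (g x) powr p / b powr p)) \<partial>M)"
      unfolding Ip_def
      by (rule integral_mono[OF Lp_integrable[OF fg] _ Y])
         (intro integrable_mult_right Bochner_Integration.integrable_add integrable_divide
           Lp_integrable[OF f] Lp_integrable[OF g])
    also have "\<dots> = (a + b) powr p * (a / (a + b) * (Ip p M f / a powr p) + b / (a + b) * (Ip p M g / b powr p))"
      using f g by (auto simp: Ip_def dest!: Lp_integrable)
    also have "\<dots> \<le> (a + b) powr p * (a / (a + b) * 1 + b / (a + b) * 1)"
      using ab F by (intro mult_left_mono add_mono) auto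
    also have "\<dots> = (a + b) powr p" using ab by (simp add: add_divide_distrib[symmetric])
    finally have "Ip p M (\<lambda>x. f x + g x) \<le> (a + b) powr p" .
    then show ?thesis using ab p by (subst lpn_le_iff) (auto simp: a_def b_def)
  qed
  show ?thesis
    using le_limit_right[of _ "\<lambda>e. (lpn p M f + e) + (lpn p M g + e)", OF K] by simp
qed

lemma lpn_minus_commute: "lpn p M (\<lambda>x. f x - g x) = lpn p M (\<lambda>x. g x - f x)"
  by (rule lpn_cong) (simp add: norm_minus_commute)

lemma lpn_diff_abs:
  assumes p: "1 \<le> p" and f: "f \<in> Lp p M" and g: "g \<in> Lp p M"
  shows "\<bar>lpn p M f - lpn p M g\<bar> \<le> lpn p M (\<lambda>x. f x - g x)"
  using lpn_triangle[OF p Lp_diff[OF f g] g] lpn_triangle[OF p Lp_diff[OF g f] f] p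
    lpn_minus_commute[of p M f g] by simp

lemma lpn_sum:
  assumes p: "1 \<le> p" and "\<And>i. i \<in> A \<Longrightarrow> f i \<in> Lp p M"
  shows "lpn p M (\<lambda>x. \<Sum>i\<in>A. f i x) \<le> (\<Sum>i\<in>A. lpn p M (f i))"
proof (cases "finite A")
  case True
  then show ?thesis using assms(2)
  proof (induction A)
    case (insert a A)
    have "(\<lambda>x. \<Sum>i\<in>A. f i x) \<in> Lp p M" using insert p by (intro Lp_sum) auto
    then have "lpn p M (\<lambda>x. f a x + (\<Sum>i\<in>A. f i x)) \<le> lpn p M (f a) + lpn p M (\<lambda>x. \<Sum>i\<in>A. f i x)"
      using insert p by (intro lpn_triangle) auto
    then show ?case using insert by fastforce
  qed simp
qed simp

lemma lpn_tendsto_dominated: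
  assumes p: "0 < p" and [measurable]: "\<And>n. f n \<in> borel_measurable M" and h: "h \<in> Lp p M"
    and bd: "\<And>n x. x \<in> space M \<Longrightarrow> norm (f n x) \<le> norm (h x)"
    and lim: "\<And>x. x \<in> space M \<Longrightarrow> (\<lambda>n. f n x) \<longlonglongrightarrow> 0"
  shows "(\<lambda>n. lpn p M (f n)) \<longlonglongrightarrow> 0"
proof -
  have "(\<lambda>n. Ip p M (f n)) \<longlonglongrightarrow> (\<integral>x. 0 \<partial>M)"
    unfolding Ip_def
  proof (rule integral_dominated_convergence)
    show "integrable M (\<lambda>x. norm (h x) powr p)" using h by (rule Lp_integrable)
    show "AE x in M. (\<lambda>n. norm (f n x) powr p) \<longlonglongrightarrow> 0"
    proof (rule AE_I2)
      fix x assume "x \<in> space M"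
      from tendsto_norm[OF lim[OF this]] have "(\<lambda>n. norm (f n x)) \<longlonglongrightarrow> 0" by simp
      then show "(\<lambda>n. norm (f n x) powr p) \<longlonglongrightarrow> 0"
        using p by (intro tendsto_zero_powrI[of _ _ _ p]) auto
    qed
    show "AE x in M. norm (norm (f n x) powr p) \<le> norm (h x) powr p" for n
      using bd p by (auto intro!: AE_I2 powr_mono2)
  qed auto
  then have "(\<lambda>n. Ip p M (f n)) \<longlonglongrightarrow> 0" by simp
  then show ?thesis unfolding lpn_def using p
    by (intro tendsto_zero_powrI[of _ _ _ "1/p"]) auto
qed

section \<open>Inclusions and completeness on finite measure spaces\<close>

context finite_measure begin

lemma Lp_bounded:
  assumes [measurable]: "f \<in> borel_measurable M" and "\<And>x. x \<in> space M \<Longrightarrow> norm (f x) \<le> B" "0 \<le> p"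
  shows "f \<in> Lp p M"
proof (rule LpI)
  show "integrable M (\<lambda>x. norm (f x) powr p)"
    by (rule integrable_const_bound[of _ "B powr p"]) (use assms in \<open>auto intro!: powr_mono2\<close>)
qed fact

lemma lpn_bounded:
  assumes [measurable]: "f \<in> borel_measurable M" and bd: "\<And>x. x \<in> space M \<Longrightarrow> norm (f x) \<le> B" "0 \<le> B" "0 < p"
  shows "lpn p M f \<le> B * measure M (space M) powr (1/p)"
proof -
  have f: "f \<in> Lp p M" using assms by (intro Lp_bounded) auto
  have "Ip p M f \<le> (\<integral>x. B powr p \<partial>M)" unfolding Ip_def
    by (rule integral_mono[OF Lp_integrable[OF f]]) (use assms in \<open>auto intro!: powr_mono2\<close>)
  also have "\<dots> = B powr p * measure M (space M)" by simp
  finally have "lpn p M f \<le> (B powr p * measure M (space M)) powr (1/p)"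
    unfolding lpn_def using bd by (intro powr_mono2) auto
  then show ?thesis using bd by (simp add: powr_mult powr_powr)
qed

lemma Lp_imp_integrable:
  assumes "f \<in> Lp p M" "1 \<le> p" shows "integrable M f"
proof (rule Bochner_Integration.integrable_bound)
  show "integrable M (\<lambda>x. 1 + norm (f x) powr p)" using assms by (auto dest: Lp_integrable)
  have "norm (f x) \<le> 1 + norm (f x) powr p" for x
  proof (cases "norm (f x) \<le> 1")
    case False
    then have "norm (f x) powr 1 \<le> norm (f x) powr p" using assms by (intro powr_mono) auto
    then show ?thesis by simp
  qed (smt (verit) powr_ge_zero)
  then show "AE x in M. norm (f x) \<le> norm (1 + norm (f x) powr p)" by auto
qed (use assms in \<open>auto dest: Lp_measurable\<close>)

lemma Lp_antimono:
  assumes "f \<in> Lp q M" "0 \<le> p" "p \<le> q" shows "f \<in> Lp p M"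
proof (rule LpI)
  have [measurable]: "f \<in> borel_measurable M" using assms by (auto dest: Lp_measurable)
  show "f \<in> borel_measurable M" by fact
  show "integrable M (\<lambda>x. norm (f x) powr p)"
  proof (rule Bochner_Integration.integrable_bound)
    show "integrable M (\<lambda>x. 1 + norm (f x) powr q)" using assms by (auto dest: Lp_integrable)
    have "norm (f x) powr p \<le> 1 + norm (f x) powr q" for x
    proof (cases "norm (f x) \<le> 1")
      case True
      then have "norm (f x) powr p \<le> 1" using assms by (simp add: powr_le1)
      then show ?thesis by (smt (verit) powr_ge_zero)
    next
      case False
      then have "norm (f x) powr p \<le> norm (f x) powr q" using assms by (intro powr_mono) auto
      then show ?thesis by simp
    qed
    then show "AE x in M. norm (norm (f x) powr p) \<le> norm (1 + norm (f x) powr q)" by auto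
  qed measurable
qed

text \<open>Hoelder against the constant 1. It turns a bound in L^p into supremum and Lipschitz
  bounds for extensions.\<close>

lemma L1_le_lpn:
  assumes p: "1 < p" and f: "f \<in> Lp p M"
  shows "(\<integral>x. norm (f x) \<partial>M) \<le> lpn p M f * measure M (space M) powr (1 - 1/p)"
proof -
  define q where "q = p / (p - 1)"
  have q: "q > 1" "1/p + 1/q = 1" using assms by (auto simp: q_def field_simps)
  have "(\<lambda>x. 1) \<in> Lp q M" using q by (intro Lp_bounded[of _ 1]) auto
  from Holder(2)[OF p q f this]
  have "(\<integral>x. norm (f x) \<partial>M) \<le> lpn p M f * lpn q M (\<lambda>x. 1)" by simp
  also have "\<dots> = lpn p M f * measure M (space M) powr (1/q)" by (simp add: lpn_def Ip_def)
  also have "1/q = 1 - 1/p" using q by simp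
  finally show ?thesis .
qed

end

text \<open>Fatou's lemma in the form that places limits of Cauchy sequences, of translates and of
  approximations in \<open>Lp\<close>.\<close>

lemma Lp_Fatou:
  assumes p: "0 < p" and hn: "\<And>n. h n \<in> Lp p M" and [measurable]: "h' \<in> borel_measurable M"
    and lim: "AE x in M. (\<lambda>n. h n x) \<longlonglongrightarrow> h' x"
    and bd: "eventually (\<lambda>n. Ip p M (h n) \<le> B) sequentially"
  shows "h' \<in> Lp p M" "Ip p M h' \<le> B"
proof -
  have [measurable]: "h n \<in> borel_measurable M" for n using hn by (auto dest: Lp_measurable)
  have B: "0 \<le> B" using eventually_happens'[OF _ bd] by (auto intro: order_trans[OF Ip_nonneg])
  have eq: "(\<integral>\<^sup>+x. ennreal (norm (h n x) powr p) \<partial>M) = ennreal (Ip p M (h n))" for n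
    unfolding Ip_def by (rule nn_integral_eq_integral[OF Lp_integrable[OF hn]]) auto
  have "(\<integral>\<^sup>+x. ennreal (norm (h' x) powr p) \<partial>M) = (\<integral>\<^sup>+x. liminf (\<lambda>n. ennreal (norm (h n x) powr p)) \<partial>M)"
  proof (rule nn_integral_cong_AE, use lim in eventually_elim)
    fix x assume "(\<lambda>n. h n x) \<longlonglongrightarrow> h' x"
    then have "(\<lambda>n. norm (h n x) powr p) \<longlonglongrightarrow> norm (h' x) powr p"
      using p by (intro tendsto_powr2 tendsto_norm) auto
    then have "(\<lambda>n. ennreal (norm (h n x) powr p)) \<longlonglongrightarrow> ennreal (norm (h' x) powr p)"
      by (rule tendsto_ennrealI)
    from lim_imp_Liminf[OF _ this]
    show "ennreal (norm (h' x) powr p) = liminf (\<lambda>n. ennreal (norm (h n x) powr p))" by simp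
  qed
  also have "\<dots> \<le> liminf (\<lambda>n. \<integral>\<^sup>+x. ennreal (norm (h n x) powr p) \<partial>M)"
    by (rule nn_integral_liminf) measurable
  also have "\<dots> \<le> limsup (\<lambda>n. \<integral>\<^sup>+x. ennreal (norm (h n x) powr p) \<partial>M)"
    by (rule Liminf_le_Limsup) simp
  also have "\<dots> \<le> ennreal B"
    by (rule Limsup_bounded) (use bd in \<open>auto simp: eq elim!: eventually_mono intro: ennreal_leI\<close>)
  finally have le: "(\<integral>\<^sup>+x. ennreal (norm (h' x) powr p) \<partial>M) \<le> ennreal B" .
  then have int: "integrable M (\<lambda>x. norm (h' x) powr p)"
    by (intro integrableI_bounded) (auto simp: top_unique less_top[symmetric])
  then show "h' \<in> Lp p M" by (intro LpI) auto
  have "ennreal (Ip p M h') = (\<integral>\<^sup>+x. ennreal (norm (h' x) powr p) \<partial>M)"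
    unfolding Ip_def by (rule nn_integral_eq_integral[OF int, symmetric]) auto
  then show "Ip p M h' \<le> B" using le B by (metis ennreal_le_iff)
qed

context finite_measure begin

text \<open>Along a subsequence with increments below 2^-n in L^p, hence summable in L^1 as the
  measure is finite, convergence holds almost everywhere; Fatou turns the Cauchy property into
  convergence in norm.\<close>

lemma Lp_complete:
  assumes p: "1 < p" and f: "\<And>n. f n \<in> Lp p M"
    and C: "\<And>e. 0 < e \<Longrightarrow> \<exists>N. \<forall>m\<ge>N. \<forall>n\<ge>N. lpn p M (\<lambda>x. f m x - f n x) < e"
  shows "\<exists>g\<in>Lp p M. (\<lambda>n. lpn p M (\<lambda>x. f n x - g x)) \<longlonglongrightarrow> 0"
proof -
  have [measurable]: "f n \<in> borel_measurable M" for n using f by (auto dest: Lp_measurable)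
  have "\<exists>N. \<forall>k. \<forall>m\<ge>N k. \<forall>n\<ge>N k. lpn p M (\<lambda>x. f m x - f n x) < (1/2)^k"
    by (rule choice) (use C in simp)
  then obtain N where N: "\<And>k m n. m \<ge> N k \<Longrightarrow> n \<ge> N k \<Longrightarrow> lpn p M (\<lambda>x. f m x - f n x) < (1/2)^k" by blast
  \<comment> \<open>The partial sums make r monotone with r n >= N n, so consecutive terms differ by
    less than 2^-n; the summand n gives n <= r n.\<close>
  define r where "r n = (\<Sum>i\<le>n. N i) + n" for n
  have rN: "N n \<le> r n" for n unfolding r_def by (rule trans_le_add1, rule member_le_sum) auto
  have r1: "r n \<le> r (Suc n)" and rn: "n \<le> r n" for n by (auto simp: r_def)
  have d: "lpn p M (\<lambda>x. f (r (Suc n)) x - f (r n) x) < (1/2)^n" for n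
    using rN[of n] r1[of n] by (intro N) auto
  define c where "c = measure M (space M) powr (1 - 1/p)"
  have dL: "(\<lambda>x. f (r (Suc n)) x - f (r n) x) \<in> Lp p M" for n
    using f p by (intro Lp_diff) auto
  have i1: "(\<integral>x. norm (f (r (Suc n)) x - f (r n) x) \<partial>M) \<le> (1/2)^n * c" for n
    using L1_le_lpn[OF p dL[of n]] d[of n] unfolding c_def
    by (elim order_trans) (intro mult_right_mono, auto)
  have int: "integrable M (\<lambda>x. f (r (Suc n)) x - f (r n) x)" for n
    using Lp_imp_integrable[OF dL[of n]] p by simp
  have "(\<integral>\<^sup>+x. (\<Sum>n. ennreal (norm (f (r (Suc n)) x - f (r n) x))) \<partial>M)
       = (\<Sum>n. \<integral>\<^sup>+x. ennreal (norm (f (r (Suc n)) x - f (r n) x)) \<partial>M)"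
    by (rule nn_integral_suminf) measurable
  also have "\<dots> = (\<Sum>n. ennreal (\<integral>x. norm (f (r (Suc n)) x - f (r n) x) \<partial>M))"
    by (intro suminf_cong nn_integral_eq_integral integrable_norm int) auto
  also have "\<dots> \<le> (\<Sum>n. ennreal ((1/2)^n * c))"
    by (intro suminf_le ennreal_leI i1) auto
  also have "\<dots> = ennreal (\<Sum>n. (1/2)^n * c)"
    by (intro suminf_ennreal2) (auto simp: c_def intro!: summable_mult2)
  also have "\<dots> < \<infinity>" by simp
  finally have "(\<integral>\<^sup>+x. (\<Sum>n. ennreal (norm (f (r (Suc n)) x - f (r n) x))) \<partial>M) \<noteq> \<infinity>" by simp
  then have "AE x in M. (\<Sum>n. ennreal (norm (f (r (Suc n)) x - f (r n) x))) \<noteq> \<infinity>"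
    by (intro nn_integral_PInf_AE) measurable
  then have conv: "AE x in M. (\<lambda>n. f (r n) x) \<longlonglongrightarrow> lim (\<lambda>n. f (r n) x)"
  proof eventually_elim
    fix x assume "(\<Sum>n. ennreal (norm (f (r (Suc n)) x - f (r n) x))) \<noteq> \<infinity>"
    then have "summable (\<lambda>n. norm (f (r (Suc n)) x - f (r n) x))"
      by (intro summable_suminf_not_top) auto
    then have "summable (\<lambda>n. f (r (Suc n)) x - f (r n) x)" by (rule summable_norm_cancel)
    then obtain S where "(\<lambda>n. \<Sum>i<n. f (r (Suc i)) x - f (r i) x) \<longlonglongrightarrow> S"
      using summable_LIMSEQ by blast
    then have "(\<lambda>n. f (r n) x - f (r 0) x + f (r 0) x) \<longlonglongrightarrow> S + f (r 0) x"
      by (intro tendsto_add) (auto simp: sum_lessThan_telescope[of "\<lambda>i. f (r i) x"])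
    then have "convergent (\<lambda>n. f (r n) x)" by (auto simp: convergent_def)
    then show "(\<lambda>n. f (r n) x) \<longlonglongrightarrow> lim (\<lambda>n. f (r n) x)" by (simp add: convergent_LIMSEQ_iff)
  qed
  \<comment> \<open>On the null set of divergence \<open>lim\<close> has some default value; g
    remains measurable.\<close>
  define g where "g x = lim (\<lambda>n. f (r n) x)" for x
  have [measurable]: "g \<in> borel_measurable M" unfolding g_def by (rule borel_measurable_lim_metric) measurable
  have key: "(\<lambda>x. f m x - g x) \<in> Lp p M \<and> Ip p M (\<lambda>x. f m x - g x) \<le> e powr p"
    if "0 < e" "\<forall>n\<ge>K. lpn p M (\<lambda>x. f m x - f n x) < e" for e m K
  proof -
    have a: "AE x in M. (\<lambda>n. f m x - f (r n) x) \<longlonglongrightarrow> f m x - g x"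
      using conv by eventually_elim (auto simp: g_def intro!: tendsto_diff)
    have "lpn p M (\<lambda>x. f m x - f (r n) x) < e" if "n \<ge> K" for n
      using \<open>\<forall>n\<ge>K. _ n\<close> that rn[of n] by auto
    then have b: "eventually (\<lambda>n. Ip p M (\<lambda>x. f m x - f (r n) x) \<le> e powr p) sequentially"
      using p \<open>0 < e\<close> unfolding eventually_sequentially
      by (intro exI[of _ K]) (auto simp flip: lpn_le_iff intro: order.strict_implies_order)
    have dl: "(\<lambda>x. f m x - f (r n) x) \<in> Lp p M" for n using f p by (intro Lp_diff) auto
    show ?thesis
      using Lp_Fatou(1)[OF _ dl _ a b] Lp_Fatou(2)[OF _ dl _ a b] p by auto
  qed
  obtain N1 where "\<forall>m\<ge>N1. \<forall>n\<ge>N1. lpn p M (\<lambda>x. f m x - f n x) < 1" using C[of 1] by auto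
  then have "(\<lambda>x. f N1 x - g x) \<in> Lp p M" using key[of 1 N1 N1] by auto
  from Lp_diff[OF f[of N1] this] have "(\<lambda>x. f N1 x - (f N1 x - g x)) \<in> Lp p M" using p by simp
  then have g: "g \<in> Lp p M" by simp
  have "(\<lambda>n. lpn p M (\<lambda>x. f n x - g x)) \<longlonglongrightarrow> 0"
  proof (rule LIMSEQ_I)
    fix e :: real assume e: "0 < e"
    obtain K where K: "\<forall>m\<ge>K. \<forall>n\<ge>K. lpn p M (\<lambda>x. f m x - f n x) < e/2" using C[of "e/2"] e by auto
    have "lpn p M (\<lambda>x. f m x - g x) \<le> e/2" if "m \<ge> K" for m
      by (subst lpn_le_iff) (use key[of "e/2" K m] K e p that in auto)
    then show "\<exists>no. \<forall>n\<ge>no. norm (lpn p M (\<lambda>x. f n x - g x) - 0) < e"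
      using e by (intro exI[of _ K]) (auto intro: le_less_trans[of _ "e/2"])
  qed
  with g show ?thesis by blast
qed

end

section \<open>The Riesz representation theorem\<close>

text \<open>With u, v the squared moduli of the half sum and half difference, the parallelogram law
  computes u + v; superadditivity and then convexity of t^(p/2) give the two inequalities.\<close>

lemma complex_Clarkson:
  fixes a b :: complex
  assumes p: "2 \<le> p"
  shows "norm ((a + b) / 2) powr p + norm ((a - b) / 2) powr p \<le> (norm a powr p + norm b powr p) / 2"
proof -
  define u where "u = (norm ((a + b) / 2))\<^sup>2"
  define v where "v = (norm ((a - b) / 2))\<^sup>2"
  have uv: "0 \<le> u" "0 \<le> v" by (auto simp: u_def v_def)
  have par: "u + v = ((norm a)\<^sup>2 + (norm b)\<^sup>2) / 2"
    unfolding u_def v_def cmod_power2 by (simp add: power2_eq_square field_simps)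
  have sq: "norm z powr p = ((norm z)\<^sup>2) powr (p/2)" for z :: complex
  proof (cases "z = 0")
    case False
    then have sq2: "(norm z)\<^sup>2 = norm z powr 2" by (simp add: powr_numeral)
    show ?thesis unfolding sq2 powr_powr by simp
  qed simp
  \<comment> \<open>From t^(p/2) <= t on [0, 1], applied to u/(u+v) and v/(u+v).\<close>
  have super: "u powr (p/2) + v powr (p/2) \<le> (u + v) powr (p/2)"
  proof (cases "u + v = 0")
    case False
    then have s: "0 < u + v" using uv by simp
    have "u powr (p/2) = (u / (u+v)) powr (p/2) * (u+v) powr (p/2)"
      using s by (simp add: powr_divide)
    also have "\<dots> \<le> (u / (u+v)) powr 1 * (u+v) powr (p/2)"
      using s uv p by (intro mult_right_mono powr_mono') auto
    finally have 1: "u powr (p/2) \<le> u / (u+v) * (u+v) powr (p/2)" using uv s by simp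
    have "v powr (p/2) = (v / (u+v)) powr (p/2) * (u+v) powr (p/2)"
      using s by (simp add: powr_divide)
    also have "\<dots> \<le> (v / (u+v)) powr 1 * (u+v) powr (p/2)"
      using s uv p by (intro mult_right_mono powr_mono') auto
    finally have 2: "v powr (p/2) \<le> v / (u+v) * (u+v) powr (p/2)" using uv s by simp
    have "u / (u+v) * (u+v) powr (p/2) + v / (u+v) * (u+v) powr (p/2) = (u/(u+v) + v/(u+v)) * (u+v) powr (p/2)"
      by (simp add: distrib_right)
    also have "u/(u+v) + v/(u+v) = 1" using s by (simp add: add_divide_distrib[symmetric])
    finally show ?thesis using 1 2 by simp
  next
    case True
    then have "u = 0" "v = 0" using uv by auto
    then show ?thesis by simp
  qed
  have "norm ((a + b) / 2) powr p + norm ((a - b) / 2) powr p = u powr (p/2) + v powr (p/2)"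
    by (simp only: sq u_def v_def)
  also have "\<dots> \<le> (u + v) powr (p/2)" by (rule super)
  also have "\<dots> = (1/2 * (norm a)\<^sup>2 + 1/2 * (norm b)\<^sup>2) powr (p/2)" by (simp add: par add_divide_distrib)
  also have "\<dots> \<le> 1/2 * ((norm a)\<^sup>2) powr (p/2) + 1/2 * ((norm b)\<^sup>2) powr (p/2)"
    using p by (intro powr_convex_comb) auto
  also have "\<dots> = (norm a powr p + norm b powr p) / 2" by (simp only: sq) simp
  finally show ?thesis .
qed

lemma Ip_Clarkson:
  assumes p: "2 \<le> p" and f: "f \<in> Lp p M" and g: "g \<in> Lp p M"
  shows "Ip p M (\<lambda>x. (f x + g x) / 2) + Ip p M (\<lambda>x. (f x - g x) / 2) \<le> (Ip p M f + Ip p M g) / 2"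
proof -
  have 1: "(\<lambda>x. (f x + g x) / 2) \<in> Lp p M" "(\<lambda>x. (f x - g x) / 2) \<in> Lp p M"
    using Lp_scale[OF Lp_add[OF f g], of "1/2"] Lp_scale[OF Lp_diff[OF f g], of "1/2"] p by auto
  have "Ip p M (\<lambda>x. (f x + g x) / 2) + Ip p M (\<lambda>x. (f x - g x) / 2) =
    (\<integral>x. norm ((f x + g x) / 2) powr p + norm ((f x - g x) / 2) powr p \<partial>M)"
    unfolding Ip_def using 1 by (intro Bochner_Integration.integral_add[symmetric] Lp_integrable)
  also have "\<dots> \<le> (\<integral>x. (norm (f x) powr p + norm (g x) powr p) / 2 \<partial>M)"
    using 1 f g by (intro integral_mono complex_Clarkson[OF p] integrable_divide Bochner_Integration.integrable_add Lp_integrable)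
  also have "\<dots> = (Ip p M f + Ip p M g) / 2"
    unfolding Ip_def using f g by (auto simp: Lp_integrable)
  finally show ?thesis .
qed

text \<open>Convexity of |.|^p on the plane: Re (cnj c * a) <= |c| |a| reduces it to
  \<open>Young_tangent\<close>.\<close>

lemma norm_powr_tangent:
  fixes a c :: complex
  assumes p: "1 < p"
  shows "norm c powr p + p * norm c powr (p - 2) * Re (cnj c * (a - c)) \<le> norm a powr p"
proof (cases "c = 0")
  case False
  have c2: "norm c powr (p - 2) * (norm c)\<^sup>2 = norm c powr p" "norm c powr (p - 2) * norm c = norm c powr (p - 1)"
    using False by (simp_all add: powr_diff powr_numeral power2_eq_square)
  have "Re (cnj c * (a - c)) = Re (cnj c * a) - (norm c)\<^sup>2"
    by (simp only: cmod_power2) (simp add: power2_eq_square algebra_simps)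
  moreover have "Re (cnj c * a) \<le> norm c * norm a"
    using complex_Re_le_cmod[of "cnj c * a"] by (simp add: norm_mult)
  ultimately have "norm c powr (p - 2) * Re (cnj c * (a - c)) \<le> norm c powr (p - 2) * (norm c * norm a - (norm c)\<^sup>2)"
    by (intro mult_left_mono) auto
  also have "\<dots> = norm c powr (p - 1) * norm a - norm c powr p"
    by (simp add: right_diff_distrib c2 flip: mult.assoc)
  finally have "p * (norm c powr (p - 2) * Re (cnj c * (a - c))) \<le> p * (norm c powr (p - 1) * norm a - norm c powr p)"
    using p by (intro mult_left_mono) auto
  moreover have "p * norm c powr (p - 1) * norm a \<le> norm a powr p + (p - 1) * norm c powr p"
    using p by (intro Young_tangent) auto
  ultimately show ?thesis by (simp add: algebra_simps)
qed (use p in auto)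

lemma conjugate_exponent:
  fixes p q :: real
  assumes "1 < p" "1/p + 1/q = 1"
  shows "1 < q" "q = p / (p - 1)"
proof -
  have "1/q = (p - 1) / p" using assms by (simp add: diff_divide_distrib)
  then have "inverse (1/q) = inverse ((p - 1) / p)" by simp
  then show q: "q = p / (p - 1)" by simp
  show "1 < q" unfolding q using assms by simp
qed

lemma borel_measurable_cnj [measurable]: "cnj \<in> borel_measurable borel"
  by (intro borel_measurable_continuous_onI continuous_intros)

text \<open>The argument of the norm is the Hoelder dual of z: times z it gives |z|^r. It recurs as
  the extremal test function in the Riesz theorem, in Hausdorff-Young and in the lower bound for the
  sequence.\<close>

lemma norm_powr_cnj:
  fixes z :: complex
  shows "norm (complex_of_real (norm z powr (r - 2)) * cnj z) = norm z powr (r - 1)"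
proof (cases "z = 0")
  case False
  have "norm (complex_of_real (norm z powr (r - 2)) * cnj z) = norm z powr (r - 2) * norm z"
    by (simp only: norm_mult norm_of_real complex_mod_cnj abs_of_nonneg powr_ge_zero)
  also have "\<dots> = norm z powr (r - 1)"
    using False by (simp add: powr_diff powr_numeral power2_eq_square)
  finally show ?thesis .
qed simp

text \<open>At the threshold C^(1/(p-1)) the power t^(p-1) reaches C and takes over. This bounds the
  functional minimised below from below.\<close>

lemma powr_minus_linear_lower:
  fixes C t p :: real
  assumes "1 < p" "0 \<le> C" "0 \<le> t"
  shows "- (C * C powr (1 / (p - 1))) \<le> t powr p - C * t"
proof (cases "t \<le> C powr (1 / (p - 1))")
  case True
  then have "C * t \<le> C * C powr (1 / (p - 1))" using assms by (intro mult_left_mono) auto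
  then show ?thesis by (smt (verit) powr_ge_zero)
next
  case False
  then have t: "0 < t" using assms by (smt (verit) powr_ge_zero)
  have "(C powr (1 / (p - 1))) powr (p - 1) \<le> t powr (p - 1)"
    using False assms by (intro powr_mono2) auto
  then have "C \<le> t powr (p - 1)" using assms by (simp add: powr_powr split: if_splits)
  then have "C * t \<le> t powr (p - 1) * t" using assms by (intro mult_right_mono) auto
  also have "\<dots> = t powr p" using t by (simp add: powr_diff)
  finally have "0 \<le> t powr p - C * t" by simp
  moreover have "0 \<le> C * C powr (1 / (p - 1))" using assms by simp
  ultimately show ?thesis by linarith
qed

context finite_measure begin

text \<open>The representing function is read off from the minimizer of \<open>\<integral>|g|\<^sup>p - Re (\<Lambda> g)\<close>, which exists
  because minimizing sequences are Cauchy by Clarkson's inequality.\<close>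

lemma Riesz_minimizer:
  assumes p: "2 \<le> p"
    and lin: "\<And>f g a b. f \<in> Lp p M \<Longrightarrow> g \<in> Lp p M \<Longrightarrow> \<Lambda> (\<lambda>x. a * f x + b * g x) = a * \<Lambda> f + b * \<Lambda> g"
    and bd: "\<And>f. f \<in> Lp p M \<Longrightarrow> norm (\<Lambda> f) \<le> C * lpn p M f" and C: "0 \<le> C"
  shows "\<exists>f\<in>Lp p M. \<forall>g\<in>Lp p M. Ip p M f - Re (\<Lambda> f) \<le> Ip p M g - Re (\<Lambda> g)"
proof -
  define \<Phi> where "\<Phi> g = Ip p M g - Re (\<Lambda> g)" for g
  define m where "m = Inf (\<Phi> ` Lp p M)"
  have "- (C * C powr (1 / (p - 1))) \<le> \<Phi> g" if "g \<in> Lp p M" for g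
  proof -
    have "Re (\<Lambda> g) \<le> C * lpn p M g" using bd[OF that] complex_Re_le_cmod[of "\<Lambda> g"] by simp
    then have "lpn p M g powr p - C * lpn p M g \<le> \<Phi> g" using p by (simp add: \<Phi>_def lpn_powr)
    then show ?thesis using powr_minus_linear_lower[of p C "lpn p M g"] p C by simp
  qed
  then have bb: "bdd_below (\<Phi> ` Lp p M)" by (auto intro!: bdd_belowI2)
  then have m: "m \<le> \<Phi> g" if "g \<in> Lp p M" for g unfolding m_def using that by (intro cInf_lower) auto
  have "\<exists>g. g \<in> Lp p M \<and> \<Phi> g < m + 1 / real (Suc n)" for n
    using cInf_lessD[of "\<Phi> ` Lp p M" "m + 1 / real (Suc n)"] Lp_zero[of p M] unfolding m_def[symmetric]
    by fastforce
  then obtain f where f: "\<And>n. f n \<in> Lp p M" and fm: "\<And>n. \<Phi> (f n) < m + 1 / real (Suc n)" by metis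
  \<comment> \<open>The functional at the midpoint of u and v is at least m, so Clarkson's
    inequality bounds the half difference by the excess of u and v over m.\<close>
  have half: "Ip p M (\<lambda>x. (u x - v x) / 2) \<le> (\<Phi> u + \<Phi> v) / 2 - m"
    if u: "u \<in> Lp p M" and v: "v \<in> Lp p M" for u v
  proof -
    have h: "(\<lambda>x. (u x + v x) / 2) \<in> Lp p M"
      using Lp_scale[OF Lp_add[OF u v], of "1/2"] p by auto
    have "\<Lambda> (\<lambda>x. (u x + v x) / 2) = (\<Lambda> u + \<Lambda> v) / 2"
      using lin[OF u v, of "1/2" "1/2"] by (simp add: add_divide_distrib)
    then have "Re (\<Lambda> (\<lambda>x. (u x + v x) / 2)) = (Re (\<Lambda> u) + Re (\<Lambda> v)) / 2"
      by (simp only: Re_divide_numeral plus_complex.sel)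
    then show ?thesis using Ip_Clarkson[OF p u v] m[OF h] by (simp add: \<Phi>_def field_simps)
  qed
  have aux: "I < w" if "x \<le> z" "y \<le> z" "I \<le> (a + b) / 2 - m" "a < m + x" "b < m + y" "z < w"
    for I a b x y z w :: real
    using that by argo
  have cauchy: "\<exists>N. \<forall>i\<ge>N. \<forall>j\<ge>N. lpn p M (\<lambda>x. f i x - f j x) < e" if e: "0 < e" for e
  proof -
    obtain N where N: "1 / real (Suc N) < (e/2) powr p"
      using reals_Archimedean[of "(e/2) powr p"] e by (auto simp: inverse_eq_divide)
    have "lpn p M (\<lambda>x. f i x - f j x) < e" if ij: "i \<ge> N" "j \<ge> N" for i j
    proof -
      have "1 / real (Suc i) \<le> 1 / real (Suc N)" "1 / real (Suc j) \<le> 1 / real (Suc N)"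
        using ij by (auto intro!: divide_left_mono)
      then have "Ip p M (\<lambda>x. (f i x - f j x) / 2) < (e/2) powr p"
        using half[OF f[of i] f[of j]] fm[of i] fm[of j] N by (rule aux)
      then have "\<not> lpn p M (\<lambda>x. (f i x - f j x) / 2) \<ge> e / 2"
        using e p powr_mono2[of p "e/2" "lpn p M (\<lambda>x. (f i x - f j x) / 2)"] by (auto simp: lpn_powr)
      then show ?thesis using lpn_scale[of p M "1/2" "\<lambda>x. f i x - f j x"] p by simp
    qed
    then show ?thesis by blast
  qed
  obtain g where g: "g \<in> Lp p M" and gl: "(\<lambda>n. lpn p M (\<lambda>x. f n x - g x)) \<longlonglongrightarrow> 0"
    using Lp_complete[of p f] f cauchy p by auto
  have "(\<lambda>n. lpn p M (f n)) \<longlonglongrightarrow> lpn p M g"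
  proof (rule Lim_transform[OF tendsto_const])
    show "(\<lambda>n. lpn p M (f n) - lpn p M g) \<longlonglongrightarrow> 0"
      by (rule tendsto_rabs_zero_cancel, rule tendsto_sandwich[OF _ _ tendsto_const gl])
         (use lpn_diff_abs[OF _ f g] p in auto)
  qed
  then have "(\<lambda>n. lpn p M (f n) powr p) \<longlonglongrightarrow> lpn p M g powr p"
    using p by (intro tendsto_powr2) auto
  then have 1: "(\<lambda>n. Ip p M (f n)) \<longlonglongrightarrow> Ip p M g" using p by (simp add: lpn_powr)
  have "(\<lambda>n. \<Lambda> (f n)) \<longlonglongrightarrow> \<Lambda> g"
  proof (rule Lim_null[THEN iffD2], rule Lim_null_comparison)
    show "(\<lambda>n. C * lpn p M (\<lambda>x. f n x - g x)) \<longlonglongrightarrow> 0" using tendsto_mult_left[OF gl, of C] by simp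
    show "eventually (\<lambda>n. norm (\<Lambda> (f n) - \<Lambda> g) \<le> C * lpn p M (\<lambda>x. f n x - g x)) sequentially"
    proof (intro always_eventually allI)
      fix n
      have "\<Lambda> (f n) - \<Lambda> g = \<Lambda> (\<lambda>x. f n x - g x)" using lin[OF f[of n] g, of 1 "-1"] by simp
      then show "norm (\<Lambda> (f n) - \<Lambda> g) \<le> C * lpn p M (\<lambda>x. f n x - g x)"
        using bd[OF Lp_diff[OF f g]] p by simp
    qed
  qed
  then have "(\<lambda>n. \<Phi> (f n)) \<longlonglongrightarrow> \<Phi> g" unfolding \<Phi>_def by (intro tendsto_diff 1 tendsto_Re)
  moreover have "(\<lambda>n. m + 1 / real (Suc n)) \<longlonglongrightarrow> m + 0"
    by (intro tendsto_add tendsto_const LIMSEQ_Suc[OF lim_1_over_n])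
  ultimately have "\<Phi> g \<le> m + 0"
    using fm by (intro LIMSEQ_le[of "\<lambda>n. \<Phi> (f n)" _ "\<lambda>n. m + 1 / real (Suc n)"]) (auto intro: less_imp_le)
  then have "\<Phi> g \<le> \<Phi> u" if "u \<in> Lp p M" for u using m[OF that] by linarith
  then show ?thesis using g unfolding \<Phi>_def by blast
qed

text \<open>Euler-Lagrange equation of the minimiser f: comparing f with f + t h for t = 1/(n+1) and
  letting n grow gives Re (\<Lambda> h) <= Re of the integral of h G, with G = p |f|^(p-2) cnj f.
  The directions -h and i h turn this inequality into the complex identity.\<close>

lemma Riesz_ge2:
  assumes p: "2 \<le> p" and pq: "1/p + 1/q = 1"
    and lin: "\<And>f g a b. f \<in> Lp p M \<Longrightarrow> g \<in> Lp p M \<Longrightarrow> \<Lambda> (\<lambda>x. a * f x + b * g x) = a * \<Lambda> f + b * \<Lambda> g"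
    and bd: "\<And>f. f \<in> Lp p M \<Longrightarrow> norm (\<Lambda> f) \<le> C * lpn p M f" and C: "0 \<le> C"
  shows "\<exists>G\<in>Lp q M. \<forall>h\<in>Lp p M. \<Lambda> h = (\<integral>x. h x * G x \<partial>M)"
proof -
  obtain f where f: "f \<in> Lp p M" and min: "\<And>g. g \<in> Lp p M \<Longrightarrow> Ip p M f - Re (\<Lambda> f) \<le> Ip p M g - Re (\<Lambda> g)"
    using Riesz_minimizer[OF p lin bd C] by blast
  have q: "1 < q" "q = p / (p - 1)"
    using conjugate_exponent[OF _ pq] p by auto
  \<comment> \<open>Up to conjugation the gradient of |.|^p at v; the q-th power of its modulus is a
    multiple of |v|^p.\<close>
  define W where "W v x = complex_of_real (p * norm (v x) powr (p - 2)) * cnj (v x)" for v :: "'a \<Rightarrow> complex" and x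
  define G where "G = W f"
  have [measurable]: "f \<in> borel_measurable M" using f by (rule Lp_measurable)
  have Wn: "norm (W v x) = p * norm (v x) powr (p - 1)" for v x
    unfolding W_def of_real_mult mult.assoc norm_mult[of "complex_of_real p"] norm_powr_cnj
    using p by simp
  have WL: "W v \<in> Lp q M" if v: "v \<in> Lp p M" for v
  proof (rule LpI)
    have [measurable]: "v \<in> borel_measurable M" using v by (rule Lp_measurable)
    show "W v \<in> borel_measurable M" unfolding W_def by measurable
    have "norm (W v x) powr q = p powr q * norm (v x) powr p" for x
      using p by (simp add: Wn powr_mult powr_powr q(2))
    then show "integrable M (\<lambda>x. norm (W v x) powr q)" using v by (simp add: Lp_integrable)
  qed
  have GL: "G \<in> Lp q M" unfolding G_def using f by (rule WL)
  have p1: "1 < p" using p by simp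
  have one: "Re (\<Lambda> h) \<le> (\<integral>x. Re (h x * G x) \<partial>M)" if h: "h \<in> Lp p M" for h
  proof -
    have [measurable]: "h \<in> borel_measurable M" using h by (rule Lp_measurable)
    define v where "v n x = f x + complex_of_real (1 / real (Suc n)) * h x" for n x
    have vL: "v n \<in> Lp p M" for n unfolding v_def using f h p by (intro Lp_add Lp_scale) auto
    have le: "Re (\<Lambda> h) \<le> (\<integral>x. Re (h x * W (v n) x) \<partial>M)" for n
    proof -
      define t where "t = 1 / real (Suc n)"
      have t: "0 < t" by (simp add: t_def)
      have "\<Lambda> (v n) = \<Lambda> f + complex_of_real t * \<Lambda> h"
      proof -
        have "v n = (\<lambda>x. 1 * f x + complex_of_real t * h x)" by (simp add: v_def t_def fun_eq_iff)
        then show ?thesis using lin[OF f h, of 1 "complex_of_real t"] by simp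
      qed
      then have "Re (\<Lambda> (v n)) = Re (\<Lambda> f) + t * Re (\<Lambda> h)" by simp
      with min[OF vL[of n]] have A: "t * Re (\<Lambda> h) \<le> Ip p M (v n) - Ip p M f" by simp
      have i: "integrable M (\<lambda>x. h x * W (v n) x)" by (rule Holder(1)[OF p1 q(1) pq h WL[OF vL]])
      \<comment> \<open>The tangent is taken at the perturbed value \<open>v n x\<close>, not at
        \<open>f x\<close>, so that the increment of |.|^p is bounded from above.\<close>
      have B: "norm (v n x) powr p - norm (f x) powr p \<le> t * Re (h x * W (v n) x)" for x
      proof -
        have fv: "f x - v n x = - (complex_of_real t * h x)" by (simp add: v_def t_def)
        have "cnj (v n x) * (f x - v n x) = complex_of_real t * (- (cnj (v n x) * h x))"
          unfolding fv by (simp add: algebra_simps)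
        then have "Re (cnj (v n x) * (f x - v n x)) = - (t * Re (cnj (v n x) * h x))"
          by (simp only: Re_complex_of_real) (simp add: algebra_simps)
        moreover have "Re (h x * W (v n) x) = p * norm (v n x) powr (p - 2) * Re (cnj (v n x) * h x)"
          by (simp add: W_def algebra_simps)
        ultimately have "p * norm (v n x) powr (p - 2) * Re (cnj (v n x) * (f x - v n x)) = - (t * Re (h x * W (v n) x))"
          by (simp only: mult_ac minus_mult_right)
        then show ?thesis using norm_powr_tangent[OF p1, of "v n x" "f x"] by linarith
      qed
      have "Ip p M (v n) - Ip p M f = (\<integral>x. norm (v n x) powr p - norm (f x) powr p \<partial>M)"
        unfolding Ip_def using f vL by (intro Bochner_Integration.integral_diff[symmetric] Lp_integrable)
      also have "\<dots> \<le> (\<integral>x. t * Re (h x * W (v n) x) \<partial>M)"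
        using i f vL B by (intro integral_mono Bochner_Integration.integrable_diff Lp_integrable integrable_mult_right integrable_Re) auto
      also have "\<dots> = t * (\<integral>x. Re (h x * W (v n) x) \<partial>M)" by simp
      finally have "t * Re (\<Lambda> h) \<le> t * (\<integral>x. Re (h x * W (v n) x) \<partial>M)" using A by (rule order_trans[rotated])
      then show ?thesis using t by (simp only: mult_le_cancel_left_pos)
    qed
    have lim: "(\<lambda>n. \<integral>x. Re (h x * W (v n) x) \<partial>M) \<longlonglongrightarrow> (\<integral>x. Re (h x * G x) \<partial>M)"
    proof (rule integral_dominated_convergence)
      define u where "u x = complex_of_real (norm (f x) + norm (h x))" for x
      have u: "u \<in> Lp p M"
      proof -
        have n: "(\<lambda>x. complex_of_real (norm (w x))) \<in> Lp p M" if "w \<in> Lp p M" for w :: "'a \<Rightarrow> complex"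
          using that by (auto simp: Lp_def)
        show ?thesis unfolding u_def using Lp_add[OF n[OF f] n[OF h]] p by simp
      qed
      show "integrable M (\<lambda>x. norm (h x * W u x))"
        by (intro integrable_norm Holder(1)[OF p1 q(1) pq h WL[OF u]])
      show "AE x in M. norm (Re (h x * W (v n) x)) \<le> norm (h x * W u x)" for n
      proof (rule AE_I2)
        fix x
        have "norm (v n x) \<le> norm (f x) + 1 / real (Suc n) * norm (h x)"
          unfolding v_def by (rule order_trans[OF norm_triangle_ineq]) (simp only: norm_mult norm_of_real, simp)
        also have "\<dots> \<le> norm (f x) + 1 * norm (h x)" by (intro add_mono mult_right_mono) auto
        also have "norm (f x) + 1 * norm (h x) = norm (u x)" unfolding u_def norm_of_real by simp
        finally have "norm (v n x) \<le> norm (u x)" .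
        then have "norm (W (v n) x) \<le> norm (W u x)" unfolding Wn using p by (intro mult_left_mono powr_mono2) auto
        then have "norm (h x * W (v n) x) \<le> norm (h x * W u x)" by (simp add: norm_mult mult_left_mono)
        then show "norm (Re (h x * W (v n) x)) \<le> norm (h x * W u x)"
          using abs_Re_le_cmod[of "h x * W (v n) x"] by simp
      qed
      show "AE x in M. (\<lambda>n. Re (h x * W (v n) x)) \<longlonglongrightarrow> Re (h x * G x)"
      proof (rule AE_I2)
        fix x
        have "(\<lambda>n. f x + complex_of_real (1 / real (Suc n)) * h x) \<longlonglongrightarrow> f x + complex_of_real 0 * h x"
          by (intro tendsto_intros LIMSEQ_Suc[OF lim_1_over_n])
        then have vl: "(\<lambda>n. v n x) \<longlonglongrightarrow> f x" by (simp add: v_def)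
        \<comment> \<open>At zeros of f the factor t powr (p - 2) may jump: for p = 2 it is 1 for t
          > 0 but 0 at t = 0. There the formula for |W| is used instead.\<close>
        have "(\<lambda>n. W (v n) x) \<longlonglongrightarrow> W f x"
        proof (cases "f x = 0")
          case True
          have "(\<lambda>n. p * norm (v n x) powr (p - 1)) \<longlonglongrightarrow> p * 0"
            using tendsto_norm[OF vl] True p by (intro tendsto_intros tendsto_zero_powrI[of _ _ _ "p-1"]) auto
          then have "(\<lambda>n. norm (W (v n) x)) \<longlonglongrightarrow> 0" by (simp add: Wn)
          then have "(\<lambda>n. W (v n) x) \<longlonglongrightarrow> 0" by (rule tendsto_norm_zero_cancel)
          then show ?thesis using True by (simp add: W_def)
        next
          case False
          then show ?thesis unfolding W_def using vl by (intro tendsto_intros) auto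
        qed
        then show "(\<lambda>n. Re (h x * W (v n) x)) \<longlonglongrightarrow> Re (h x * G x)"
          unfolding G_def by (intro tendsto_intros)
      qed
    qed (unfold G_def W_def v_def, measurable)
    show ?thesis using le by (intro LIMSEQ_le_const[OF lim]) auto
  qed
  have re: "Re (\<Lambda> h) = Re (\<integral>x. h x * G x \<partial>M)" if h: "h \<in> Lp p M" for h
  proof -
    have i: "integrable M (\<lambda>x. h x * G x)" by (rule Holder(1)[OF p1 q(1) pq h GL])
    have "\<Lambda> (\<lambda>x. - h x) = - \<Lambda> h" using lin[OF h h, of "-1" 0] by simp
    moreover have "Re (\<Lambda> (\<lambda>x. - h x)) \<le> (\<integral>x. Re (- h x * G x) \<partial>M)" using one[OF Lp_scale[OF h, of "-1"]] by simp
    moreover have "(\<integral>x. Re (- h x * G x) \<partial>M) = - (\<integral>x. Re (h x * G x) \<partial>M)"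
      by (simp flip: Bochner_Integration.integral_minus)
    ultimately show ?thesis using one[OF h] integral_Re[OF i] by simp
  qed
  have "\<Lambda> h = (\<integral>x. h x * G x \<partial>M)" if h: "h \<in> Lp p M" for h
  proof (rule complex_eqI[OF re[OF h]])
    have i: "integrable M (\<lambda>x. h x * G x)" by (rule Holder(1)[OF p1 q(1) pq h GL])
    have "\<Lambda> (\<lambda>x. \<i> * h x) = \<i> * \<Lambda> h" using lin[OF h h, of \<i> 0] by simp
    moreover have "(\<integral>x. \<i> * h x * G x \<partial>M) = \<i> * (\<integral>x. h x * G x \<partial>M)"
      by (simp add: mult.assoc)
    ultimately show "Im (\<Lambda> h) = Im (\<integral>x. h x * G x \<partial>M)" using re[OF Lp_scale[OF h, of \<i>]] by simp
  qed
  with GL show ?thesis by blast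
qed

lemma lpn_truncate_tendsto:
  assumes p: "0 < p" and h: "h \<in> Lp p M"
  shows "(\<lambda>k. lpn p M (\<lambda>x. h x - (if norm (h x) \<le> real k then h x else 0))) \<longlonglongrightarrow> 0"
proof (rule lpn_tendsto_dominated[OF p _ h])
  have [measurable]: "h \<in> borel_measurable M" using h by (rule Lp_measurable)
  show "(\<lambda>x. h x - (if norm (h x) \<le> real k then h x else 0)) \<in> borel_measurable M" for k by measurable
  show "(\<lambda>k. h x - (if norm (h x) \<le> real k then h x else 0)) \<longlonglongrightarrow> 0" for x
  proof -
    have "eventually (\<lambda>k. norm (h x) \<le> real k) sequentially"
      using eventually_ge_at_top[of "nat \<lceil>norm (h x)\<rceil>"] by eventually_elim linarith
    then show ?thesis by (intro tendsto_eventually) (elim eventually_mono, simp)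
  qed
qed auto

lemma Lp_truncate:
  assumes "h \<in> borel_measurable M" "0 \<le> p"
  shows "(\<lambda>x. if norm (h x) \<le> real k then h x else 0) \<in> Lp p M"
proof (rule Lp_bounded[of _ "real k"])
  have [measurable]: "h \<in> borel_measurable M" by fact
  show "(\<lambda>x. if norm (h x) \<le> real k then h x else 0) \<in> borel_measurable M" by measurable
qed (use assms in auto)

text \<open>On a finite measure space L^2 embeds into L^p, so \<Lambda> restricts to L^2 and has a
  representing function G there. It remains to place G in L^q and to pass from bounded functions to
  all of L^p by truncation.\<close>

lemma Riesz_lt2:
  assumes p: "1 < p" "p < 2" and pq: "1/p + 1/q = 1"
    and lin: "\<And>f g a b. f \<in> Lp p M \<Longrightarrow> g \<in> Lp p M \<Longrightarrow> \<Lambda> (\<lambda>x. a * f x + b * g x) = a * \<Lambda> f + b * \<Lambda> g"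
    and bd: "\<And>f. f \<in> Lp p M \<Longrightarrow> norm (\<Lambda> f) \<le> C * lpn p M f" and C: "0 \<le> C"
  shows "\<exists>G\<in>Lp q M. \<forall>h\<in>Lp p M. \<Lambda> h = (\<integral>x. h x * G x \<partial>M)"
proof -
  have q: "1 < q" "q = p / (p - 1)" using conjugate_exponent[OF p(1) pq] .
  define c where "c = measure M (space M) powr (1/p - 1/2)"
  have L2: "f \<in> Lp p M" if "f \<in> Lp 2 M" for f using Lp_antimono[OF that, of p] p by simp
  have le2: "lpn p M f \<le> c * lpn 2 M f" if f: "f \<in> Lp 2 M" for f
  proof -
    define F where "F x = complex_of_real (norm (f x) powr p)" for x
    have [measurable]: "f \<in> borel_measurable M" using f by (rule Lp_measurable)
    have "norm (F x) powr (2/p) = norm (f x) powr 2" for x using p by (simp add: F_def powr_powr)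
    moreover have "F \<in> borel_measurable M" unfolding F_def by measurable
    ultimately have FL: "F \<in> Lp (2/p) M" and FI: "Ip (2/p) M F = Ip 2 M f"
      using f by (auto simp: Lp_def Ip_def)
    have "(\<integral>x. norm (F x) \<partial>M) \<le> lpn (2/p) M F * measure M (space M) powr (1 - 1/(2/p))"
      using p by (intro L1_le_lpn FL) auto
    then have "Ip p M f \<le> Ip 2 M f powr (p/2) * measure M (space M) powr (1 - p/2)"
      by (simp add: FI lpn_def) (simp add: F_def Ip_def)
    then have "Ip p M f powr (1/p) \<le> (Ip 2 M f powr (p/2) * measure M (space M) powr (1 - p/2)) powr (1/p)"
      using p by (intro powr_mono2) auto
    also have "\<dots> = Ip 2 M f powr (1/2) * measure M (space M) powr ((1 - p/2)/p)"
      using p by (simp add: powr_mult powr_powr)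
    also have "(1 - p/2)/p = 1/p - 1/2" using p by (simp add: diff_divide_distrib)
    finally show ?thesis by (simp add: lpn_def c_def mult.commute)
  qed
  have "\<exists>G\<in>Lp 2 M. \<forall>h\<in>Lp 2 M. \<Lambda> h = (\<integral>x. h x * G x \<partial>M)"
  proof (rule Riesz_ge2[of 2 2 \<Lambda> "C * c"])
    show "norm (\<Lambda> f) \<le> C * c * lpn 2 M f" if "f \<in> Lp 2 M" for f
      using bd[OF L2[OF that]] mult_left_mono[OF le2[OF that] C] by (simp add: mult_ac)
    show "\<Lambda> (\<lambda>x. a * f x + b * g x) = a * \<Lambda> f + b * \<Lambda> g" if "f \<in> Lp 2 M" "g \<in> Lp 2 M" for f g a b
      by (rule lin[OF L2[OF that(1)] L2[OF that(2)]])
    show "0 \<le> C * c" using C by (simp add: c_def)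
  qed auto
  then obtain G where G2: "G \<in> Lp 2 M" and G: "\<And>h. h \<in> Lp 2 M \<Longrightarrow> \<Lambda> h = (\<integral>x. h x * G x \<partial>M)" by blast
  have Gm [measurable]: "G \<in> borel_measurable M" using G2 by (rule Lp_measurable)
  define T where "T k x = (if norm (G x) \<le> real k then G x else 0)" for k x
  have TL: "T k \<in> Lp r M" if "0 \<le> r" for k r unfolding T_def by (rule Lp_truncate[OF Gm that])
  have [measurable]: "T k \<in> borel_measurable M" for k unfolding T_def by measurable
  \<comment> \<open>Testing \<Lambda> on the dual function of T k gives I <= C I^(1/p) for I the
    integral of |T k|^q, finite since T k is bounded. Division gives a bound uniform in k, and Fatou
    puts G into L^q.\<close>
  have Tb: "Ip q M (T k) \<le> C powr q" for k
  proof -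
    define h where "h x = complex_of_real (norm (T k x) powr (q - 2)) * cnj (T k x)" for x
    have hn: "norm (h x) = norm (T k x) powr (q - 1)" for x
      unfolding h_def by (rule norm_powr_cnj)
    have [measurable]: "h \<in> borel_measurable M" unfolding h_def by measurable
    have hL: "h \<in> Lp r M" if "0 \<le> r" for r
    proof (rule Lp_bounded[of _ "real k powr (q-1)"])
      show "norm (h x) \<le> real k powr (q - 1)" for x
        unfolding hn using q by (intro powr_mono2) (auto simp: T_def)
    qed (use that in auto)
    have hp: "norm (h x) powr p = norm (T k x) powr q" for x
    proof -
      have "(q - 1) * p = q" unfolding q(2) using p by (simp add: field_simps)
      then show ?thesis by (simp add: hn powr_powr)
    qed
    have hG: "h x * G x = complex_of_real (norm (T k x) powr q)" for x
    proof (cases "T k x = 0")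
      case True
      then show ?thesis using q by (simp add: h_def)
    next
      case False
      then have t: "T k x = G x" by (auto simp: T_def split: if_splits)
      have "cnj (G x) * G x = complex_of_real ((norm (G x))\<^sup>2)"
        using complex_norm_square[of "G x"] by (simp add: mult.commute)
      then have "h x * G x = complex_of_real (norm (G x) powr (q - 2) * (norm (G x))\<^sup>2)"
        by (simp add: h_def t mult.assoc)
      also have "norm (G x) powr (q - 2) * (norm (G x))\<^sup>2 = norm (G x) powr q"
        using False t by (simp add: powr_diff powr_numeral)
      finally show ?thesis by (simp add: t)
    qed
    have "\<Lambda> h = complex_of_real (Ip q M (T k))"
      using G[OF hL[of 2]] by (simp add: hG Ip_def)
    moreover have "lpn p M h = Ip q M (T k) powr (1/p)" by (simp add: lpn_def Ip_def hp)
    ultimately have le: "Ip q M (T k) \<le> C * Ip q M (T k) powr (1/p)"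
      using bd[OF hL[of p]] p by simp
    show ?thesis
    proof (cases "Ip q M (T k) = 0")
      case False
      then have pos: "0 < Ip q M (T k)" using Ip_nonneg[of q M "T k"] by linarith
      have "Ip q M (T k) powr (1/q) = Ip q M (T k) powr (1 - 1/p)"
        using pq by (intro arg_cong2[of _ _ _ _ "(powr)"]) auto
      also have "\<dots> = Ip q M (T k) / Ip q M (T k) powr (1/p)" using pos by (simp add: powr_diff)
      also have "\<dots> \<le> C" using le pos by (simp add: divide_le_eq)
      finally have "(Ip q M (T k) powr (1/q)) powr q \<le> C powr q" using q by (intro powr_mono2) auto
      then show ?thesis using q(1) pos by (simp add: powr_powr)
    qed simp
  qed
  have GL: "G \<in> Lp q M"
  proof (rule Lp_Fatou(1)[of q T M G "C powr q"])
    show "AE x in M. (\<lambda>n. T n x) \<longlonglongrightarrow> G x"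
    proof (rule AE_I2)
      fix x
      have "eventually (\<lambda>k. norm (G x) \<le> real k) sequentially"
        using eventually_ge_at_top[of "nat \<lceil>norm (G x)\<rceil>"] by eventually_elim linarith
      then show "(\<lambda>n. T n x) \<longlonglongrightarrow> G x" by (intro tendsto_eventually) (elim eventually_mono, simp add: T_def)
    qed
  qed (use q TL Tb in auto)
  have "\<Lambda> h = (\<integral>x. h x * G x \<partial>M)" if h: "h \<in> Lp p M" for h
  proof -
    have hm: "h \<in> borel_measurable M" using h by (rule Lp_measurable)
    define t where "t k x = (if norm (h x) \<le> real k then h x else 0)" for k x
    have tL: "t k \<in> Lp r M" if "0 \<le> r" for k r unfolding t_def by (rule Lp_truncate[OF hm that])
    have dL: "(\<lambda>x. h x - t k x) \<in> Lp p M" for k using Lp_diff[OF h tL[of p k]] p by simp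
    have lim: "(\<lambda>k. lpn p M (\<lambda>x. h x - t k x)) \<longlonglongrightarrow> 0"
      unfolding t_def using lpn_truncate_tendsto[OF _ h] p by simp
    have est: "norm (\<Lambda> h - (\<integral>x. h x * G x \<partial>M)) \<le> (C + lpn q M G) * lpn p M (\<lambda>x. h x - t k x)" for k
    proof -
      have "\<Lambda> h - \<Lambda> (t k) = \<Lambda> (\<lambda>x. h x - t k x)" using lin[OF h tL[of p k], of 1 "-1"] p by simp
      moreover have "(\<integral>x. h x * G x \<partial>M) - (\<integral>x. t k x * G x \<partial>M) = (\<integral>x. (h x - t k x) * G x \<partial>M)"
        using Holder(1)[OF p(1) q(1) pq h GL] Holder(1)[OF p(1) q(1) pq tL[of p k] GL] p
        by (simp add: left_diff_distrib)
      moreover have "\<Lambda> (t k) = (\<integral>x. t k x * G x \<partial>M)" by (rule G[OF tL]) simp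
      ultimately have "\<Lambda> h - (\<integral>x. h x * G x \<partial>M) = \<Lambda> (\<lambda>x. h x - t k x) - (\<integral>x. (h x - t k x) * G x \<partial>M)"
        by (simp add: algebra_simps)
      also have "norm \<dots> \<le> norm (\<Lambda> (\<lambda>x. h x - t k x)) + norm (\<integral>x. (h x - t k x) * G x \<partial>M)"
        by (rule norm_triangle_ineq4)
      also have "\<dots> \<le> C * lpn p M (\<lambda>x. h x - t k x) + lpn p M (\<lambda>x. h x - t k x) * lpn q M G"
        by (intro add_mono bd dL Holder(3)[OF p(1) q(1) pq dL GL])
      finally show ?thesis by (simp add: algebra_simps)
    qed
    have "(\<lambda>k. (C + lpn q M G) * lpn p M (\<lambda>x. h x - t k x)) \<longlonglongrightarrow> (C + lpn q M G) * 0"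
      by (intro tendsto_mult_left lim)
    from LIMSEQ_le_const[OF this] est have "norm (\<Lambda> h - (\<integral>x. h x * G x \<partial>M)) \<le> (C + lpn q M G) * 0" by blast
    then show ?thesis by simp
  qed
  with GL show ?thesis by blast
qed

theorem Riesz_Lp:
  assumes p: "1 < p" and pq: "1/p + 1/q = 1"
    and lin: "\<And>f g a b. f \<in> Lp p M \<Longrightarrow> g \<in> Lp p M \<Longrightarrow> \<Lambda> (\<lambda>x. a * f x + b * g x) = a * \<Lambda> f + b * \<Lambda> g"
    and bd: "\<And>f. f \<in> Lp p M \<Longrightarrow> norm (\<Lambda> f) \<le> C * lpn p M f" and C: "0 \<le> C"
  shows "\<exists>G\<in>Lp q M. \<forall>h\<in>Lp p M. \<Lambda> h = (\<integral>x. h x * G x \<partial>M)"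
proof (cases "2 \<le> p")
  case True
  show ?thesis by (rule Riesz_ge2[OF True pq lin bd C])
next
  case False
  then show ?thesis by (intro Riesz_lt2[OF p _ pq lin bd C]) simp
qed

end

section \<open>The Brezis-Lieb lemma and decoupling of translated profiles\<close>

text \<open>Two regimes: for |b| <= \<delta> |a| continuity of t^q at 1 gives the small factor e;
  otherwise |a| and |a + b| are both at most (1 + 1/\<delta>) |b|, which determines C.\<close>

lemma powr_norm_perturb:
  assumes q: "0 < q" and e: "0 < e"
  shows "\<exists>C\<ge>0. \<forall>a b::complex. \<bar>norm (a + b) powr q - norm a powr q\<bar> \<le> e * norm a powr q + C * norm b powr q"
proof -
  have "((\<lambda>t::real. t powr q) \<longlongrightarrow> 1 powr q) (at 1)"
    by (intro tendsto_intros) auto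
  then obtain d where d: "0 < d" "\<And>t. t \<noteq> 1 \<Longrightarrow> dist t 1 < d \<Longrightarrow> dist (t powr q) (1 powr q) < e"
    using e unfolding tendsto_iff eventually_at by (metis UNIV_I)
  define \<delta> where "\<delta> = d / 2"
  have dl: "0 < \<delta>" "\<And>t. \<bar>t - 1\<bar> \<le> \<delta> \<Longrightarrow> \<bar>t powr q - 1\<bar> \<le> e"
  proof -
    show "0 < \<delta>" using d by (simp add: \<delta>_def)
    fix t :: real assume "\<bar>t - 1\<bar> \<le> \<delta>"
    then show "\<bar>t powr q - 1\<bar> \<le> e" using d e by (cases "t = 1") (auto simp: dist_real_def \<delta>_def less_imp_le)
  qed
  have "\<bar>norm (a + b) powr q - norm a powr q\<bar> \<le> e * norm a powr q + (1 + 1/\<delta>) powr q * norm b powr q" for a b :: complex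
  proof (cases "a \<noteq> 0 \<and> norm b \<le> \<delta> * norm a")
    case True
    define t where "t = norm (a + b) / norm a"
    have "\<bar>norm (a + b) - norm a\<bar> \<le> norm b"
      by (metis add_diff_cancel_left' norm_triangle_ineq3)
    then have "\<bar>norm (a + b) - norm a\<bar> / norm a \<le> \<delta>" using True by (simp add: divide_le_eq)
    moreover have "\<bar>t - 1\<bar> = \<bar>norm (a + b) - norm a\<bar> / norm a"
    proof -
      have "t - 1 = (norm (a + b) - norm a) / norm a" using True by (simp add: t_def diff_divide_distrib)
      then show ?thesis by (simp only: abs_divide abs_norm_cancel)
    qed
    ultimately have "\<bar>t powr q - 1\<bar> \<le> e" using dl by simp
    then have "\<bar>t powr q - 1\<bar> * norm a powr q \<le> e * norm a powr q" by (intro mult_right_mono) auto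
    moreover have "norm (a + b) powr q = t powr q * norm a powr q"
      using True by (simp add: t_def powr_divide)
    then have "\<bar>norm (a + b) powr q - norm a powr q\<bar> = \<bar>t powr q - 1\<bar> * norm a powr q"
    proof -
      assume eq: "norm (a + b) powr q = t powr q * norm a powr q"
      have "norm (a + b) powr q - norm a powr q = (t powr q - 1) * norm a powr q"
        unfolding eq by (simp add: left_diff_distrib)
      then show ?thesis by (simp add: abs_mult)
    qed
    moreover have "0 \<le> (1 + 1/\<delta>) powr q * norm b powr q" by simp
    ultimately show ?thesis by linarith
  next
    case False
    then have ab: "norm a \<le> norm b / \<delta>" using dl by (auto simp: field_simps)
    then have "norm (a + b) \<le> (1 + 1/\<delta>) * norm b"
      using norm_triangle_ineq[of a b] by (simp add: algebra_simps)
    then have "norm (a + b) powr q \<le> ((1 + 1/\<delta>) * norm b) powr q" using q by (intro powr_mono2) auto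
    moreover have "norm a \<le> (1 + 1/\<delta>) * norm b" using ab by (simp add: algebra_simps add_increasing)
    then have "norm a powr q \<le> ((1 + 1/\<delta>) * norm b) powr q" using q by (intro powr_mono2) auto
    ultimately have "\<bar>norm (a + b) powr q - norm a powr q\<bar> \<le> ((1 + 1/\<delta>) * norm b) powr q"
      using powr_ge_zero[of "norm (a + b)" q] powr_ge_zero[of "norm a" q] by linarith
    also have "\<dots> = (1 + 1/\<delta>) powr q * norm b powr q" by (rule powr_mult)
    finally show ?thesis using e by (simp add: add_increasing)
  qed
  then show ?thesis by (intro exI[of _ "(1 + 1/\<delta>) powr q"]) auto
qed

text \<open>The defect |g|^q - |g - G|^q - |G|^q exceeds e |g - G|^q in modulus by at most a
  multiple of |G|^q. This excess \<open>V\<close> has an integrable majorant and tends to 0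
  pointwise, and the integral of e |g - G|^q is at most e times a constant.\<close>

lemma Brezis_Lieb:
  assumes q: "0 < q" and g: "\<And>n. g n \<in> Lp q M" and G: "G \<in> Lp q M"
    and lim: "\<And>x. x \<in> space M \<Longrightarrow> (\<lambda>n. g n x) \<longlonglongrightarrow> G x"
    and bd: "eventually (\<lambda>n. Ip q M (g n) \<le> B) sequentially"
  shows "(\<lambda>n. Ip q M (g n) - Ip q M (\<lambda>x. g n x - G x) - Ip q M G) \<longlonglongrightarrow> 0"
proof (rule LIMSEQ_I)
  fix r :: real assume r: "0 < r"
  have [measurable]: "\<And>n. g n \<in> borel_measurable M" "G \<in> borel_measurable M"
    using g G by (auto dest: Lp_measurable)
  have dL: "(\<lambda>x. g n x - G x) \<in> Lp q M" for n using g G q by (intro Lp_diff) auto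
  define B' where "B' = 2 powr q * (\<bar>B\<bar> + Ip q M G)"
  have B': "0 \<le> B'" by (simp add: B'_def)
  have bd': "eventually (\<lambda>n. Ip q M (\<lambda>x. g n x - G x) \<le> B') sequentially"
    using bd
  proof eventually_elim
    fix n assume B: "Ip q M (g n) \<le> B"
    have "Ip q M (\<lambda>x. g n x - G x) \<le> (\<integral>x. 2 powr q * (norm (g n x) powr q + norm (G x) powr q) \<partial>M)"
      unfolding Ip_def
    proof (rule integral_mono[OF Lp_integrable[OF dL]])
      show "norm (g n x - G x) powr q \<le> 2 powr q * (norm (g n x) powr q + norm (G x) powr q)" for x
        using norm_add_powr_le[of q "g n x" "- G x"] q by simp
    qed (intro integrable_mult_right Bochner_Integration.integrable_add Lp_integrable g G)
    also have "\<dots> = 2 powr q * (Ip q M (g n) + Ip q M G)"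
      using g G by (simp add: Ip_def Lp_integrable)
    also have "\<dots> \<le> B'" unfolding B'_def using B by (intro mult_left_mono add_right_mono) auto
    finally show "Ip q M (\<lambda>x. g n x - G x) \<le> B'" .
  qed
  \<comment> \<open>\<open>B'\<close> bounds the integrals of |g n - G|^q, so the error e B' stays
    below r / 2.\<close>
  define e where "e = (r / 2) / (B' + 1)"
  have e: "0 < e" "e * B' < r / 2"
  proof -
    show "0 < e" using r B' by (simp add: e_def)
    have "e * B' < e * (B' + 1)" using \<open>0 < e\<close> by simp
    also have "\<dots> = r / 2" unfolding e_def using B' by (intro nonzero_eq_divide_eq[THEN iffD1]) auto
    finally show "e * B' < r / 2" .
  qed
  obtain C where C: "0 \<le> C" "\<And>a b::complex. \<bar>norm (a + b) powr q - norm a powr q\<bar> \<le> e * norm a powr q + C * norm b powr q"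
    using powr_norm_perturb[OF q e(1)] by blast
  define W where "W n x = \<bar>norm (g n x) powr q - norm (g n x - G x) powr q - norm (G x) powr q\<bar>" for n x
  define V where "V n x = max 0 (W n x - e * norm (g n x - G x) powr q)" for n x
  have We: "W n x \<le> e * norm (g n x - G x) powr q + (C + 1) * norm (G x) powr q" for n x
  proof -
    have "W n x \<le> \<bar>norm (g n x) powr q - norm (g n x - G x) powr q\<bar> + norm (G x) powr q"
      unfolding W_def using powr_ge_zero[of "norm (G x)" q] by linarith
    then show ?thesis using C(2)[of "g n x - G x" "G x"] by (simp add: algebra_simps)
  qed
  have Wi: "integrable M (W n)" for n
    unfolding W_def by (intro integrable_abs Bochner_Integration.integrable_diff Lp_integrable g G dL)
  have Vi: "integrable M (V n)" for n
  proof -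
    have "integrable M (\<lambda>x. W n x - e * norm (g n x - G x) powr q)"
      by (intro Bochner_Integration.integrable_diff Wi integrable_mult_right Lp_integrable dL)
    from Bochner_Integration.integrable_max[OF integrable_zero this] show ?thesis unfolding V_def .
  qed
  have "(\<lambda>n. \<integral>x. V n x \<partial>M) \<longlonglongrightarrow> (\<integral>x. 0 \<partial>M)"
  proof (rule integral_dominated_convergence)
    show "integrable M (\<lambda>x. (C + 1) * norm (G x) powr q)" by (intro integrable_mult_right Lp_integrable G)
    show "AE x in M. norm (V n x) \<le> (C + 1) * norm (G x) powr q" for n
      using We[of n] C by (intro AE_I2) (auto simp: V_def max_def algebra_simps)
    show "AE x in M. (\<lambda>n. V n x) \<longlonglongrightarrow> 0"
    proof (rule AE_I2)
      fix x assume x: "x \<in> space M"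
      have "(\<lambda>n. norm (g n x - G x)) \<longlonglongrightarrow> norm (G x - G x)" by (intro tendsto_intros lim x)
      then have z: "(\<lambda>n. norm (g n x - G x) powr q) \<longlonglongrightarrow> 0" using q by (intro tendsto_zero_powrI[of _ _ _ q]) auto
      have "(\<lambda>n. norm (g n x) powr q) \<longlonglongrightarrow> norm (G x) powr q"
        using q by (intro tendsto_powr2 tendsto_norm lim x) auto
      from tendsto_rabs[OF tendsto_diff[OF tendsto_diff[OF this z] tendsto_const]]
      have "(\<lambda>n. W n x) \<longlonglongrightarrow> \<bar>norm (G x) powr q - 0 - norm (G x) powr q\<bar>"
        unfolding W_def .
      then have "(\<lambda>n. V n x) \<longlonglongrightarrow> max 0 (0 - e * 0)"
        unfolding V_def by (intro tendsto_max tendsto_diff tendsto_mult_left z tendsto_const) simp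
      then show "(\<lambda>n. V n x) \<longlonglongrightarrow> 0" by simp
    qed
  qed (auto intro: borel_measurable_integrable Vi)
  then have "eventually (\<lambda>n. (\<integral>x. V n x \<partial>M) < r / 2) sequentially"
    using r by (intro order_tendstoD) auto
  with bd' have "eventually (\<lambda>n. norm (Ip q M (g n) - Ip q M (\<lambda>x. g n x - G x) - Ip q M G) < r) sequentially"
  proof eventually_elim
    fix n assume b: "Ip q M (\<lambda>x. g n x - G x) \<le> B'" and v: "(\<integral>x. V n x \<partial>M) < r / 2"
    have "Ip q M (g n) - Ip q M (\<lambda>x. g n x - G x) - Ip q M G
       = (\<integral>x. norm (g n x) powr q - norm (g n x - G x) powr q - norm (G x) powr q \<partial>M)"
      unfolding Ip_def using g G dL by (simp add: Lp_integrable)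
    also have "norm \<dots> \<le> (\<integral>x. W n x \<partial>M)" unfolding W_def
      by (rule order_trans[OF integral_norm_bound]) simp
    also have "\<dots> \<le> (\<integral>x. V n x + e * norm (g n x - G x) powr q \<partial>M)"
    proof (rule integral_mono[OF Wi])
      show "integrable M (\<lambda>x. V n x + e * norm (g n x - G x) powr q)"
        by (intro Bochner_Integration.integrable_add Vi integrable_mult_right Lp_integrable dL)
    qed (auto simp: V_def)
    also have "\<dots> = (\<integral>x. V n x \<partial>M) + e * Ip q M (\<lambda>x. g n x - G x)"
      unfolding Ip_def using Vi Lp_integrable[OF dL] by simp
    also have "\<dots> \<le> (\<integral>x. V n x \<partial>M) + e * B'" using b e by simp
    also have "\<dots> < r" using v e by linarith
    finally show "norm (Ip q M (g n) - Ip q M (\<lambda>x. g n x - G x) - Ip q M G) < r" .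
  qed
  then show "\<exists>no. \<forall>n\<ge>no. norm (Ip q M (g n) - Ip q M (\<lambda>x. g n x - G x) - Ip q M G - 0) < r"
    by (simp add: eventually_sequentially)
qed

section \<open>Translations and Lipschitz functions in L^q\<close>

lemma
  fixes f :: "'a::euclidean_space \<Rightarrow> complex"
  shows Lp_translate: "f \<in> Lp q lborel \<Longrightarrow> (\<lambda>y. f (a + y)) \<in> Lp q lborel"
    and Ip_translate: "f \<in> borel_measurable borel \<Longrightarrow> Ip q lborel (\<lambda>y. f (a + y)) = Ip q lborel f"
proof -
  have *: "(+) a \<in> measurable lborel borel" by measurable
  show "(\<lambda>y. f (a + y)) \<in> Lp q lborel" if "f \<in> Lp q lborel"
  proof -
    have [measurable]: "f \<in> borel_measurable borel" using Lp_measurable[OF that] by simp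
    have "integrable (distr lborel borel ((+) a)) (\<lambda>x. norm (f x) powr q)"
      using Lp_integrable[OF that] by (simp add: lborel_distr_plus)
    then show ?thesis by (intro LpI) (auto simp: integrable_distr_eq)
  qed
  show "Ip q lborel (\<lambda>y. f (a + y)) = Ip q lborel f" if [measurable]: "f \<in> borel_measurable borel"
  proof -
    have "Ip q lborel f = Ip q (distr lborel borel ((+) a)) f" by (simp add: lborel_distr_plus)
    also have "\<dots> = Ip q lborel (\<lambda>y. f (a + y))" unfolding Ip_def by (rule integral_distr[OF *]) measurable
    finally show ?thesis ..
  qed
qed

lemma Ip_ge_ball:
  fixes f :: "'a::euclidean_space \<Rightarrow> complex"
  assumes f: "f \<in> Lp q lborel" and q: "0 \<le> q" and c: "0 \<le> c" and r: "0 \<le> r"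
    and ge: "\<And>y. y \<in> ball z r \<Longrightarrow> c \<le> norm (f y)"
  shows "c powr q * (unit_ball_vol DIM('a) * r ^ DIM('a)) \<le> Ip q lborel f"
proof -
  have "(\<integral>y. c powr q * indicator (ball z r) y \<partial>lborel) \<le> Ip q lborel f"
    unfolding Ip_def
  proof (rule integral_mono[OF _ Lp_integrable[OF f]])
    show "integrable lborel (\<lambda>y. c powr q * indicator (ball z r) y)"
      by (intro integrable_mult_right integrable_real_indicator) (use emeasure_bounded_finite[of "ball z r"] in auto)
    show "c powr q * indicator (ball z r) y \<le> norm (f y) powr q" for y
      using ge[of y] q c by (auto simp: indicator_def intro: powr_mono2)
  qed
  then show ?thesis using content_ball[OF r, of z] by simp
qed

text \<open>A value of size c persists at half size on the ball of radius c / (2 L) and forces a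
  definite mass. So decay of mass implies decay of values.\<close>

lemma Ip_ge_Lipschitz:
  fixes f :: "'a::euclidean_space \<Rightarrow> complex"
  assumes f: "f \<in> Lp q lborel" and q: "0 \<le> q" and L: "0 < L"
    and lip: "\<And>x y. norm (f x - f y) \<le> L * norm (x - y)" and c: "0 < c" "c \<le> norm (f z)"
  shows "(c / 2) powr q * (unit_ball_vol DIM('a) * (c / (2 * L)) ^ DIM('a)) \<le> Ip q lborel f"
proof (rule Ip_ge_ball[OF f q])
  show "c / 2 \<le> norm (f y)" if "y \<in> ball z (c / (2 * L))" for y
  proof -
    have "L * norm (z - y) \<le> L * (c / (2 * L))" using that L by (intro mult_left_mono) (auto simp: dist_norm)
    then have "norm (f z - f y) \<le> c / 2" using lip[of z y] L by simp
    then show ?thesis using c norm_triangle_ineq2[of "f z" "f y"] by linarith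
  qed
qed (use c L in auto)

text \<open>A far value of size c would put a fixed mass into the tail of the integral, while the
  tails tend to 0.\<close>

lemma Lipschitz_Lp_vanishes:
  fixes f :: "'a::euclidean_space \<Rightarrow> complex"
  assumes f: "f \<in> Lp q lborel" and q: "0 < q" and L: "0 < L"
    and lip: "\<And>x y. norm (f x - f y) \<le> L * norm (x - y)"
  shows "(f \<longlongrightarrow> 0) at_infinity"
proof (rule tendstoI)
  fix c :: real assume c: "0 < c"
  have [measurable]: "f \<in> borel_measurable borel" using Lp_measurable[OF f] by simp
  define t where "t n y = (if real n \<le> norm y then f y else 0)" for n :: nat and y
  have [measurable]: "t n \<in> borel_measurable borel" for n unfolding t_def by measurable
  have tL: "t n \<in> Lp q lborel" for n by (rule Lp_mono[OF f]) (use q in \<open>auto simp: t_def\<close>)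
  have "(\<lambda>n. lpn q lborel (t n)) \<longlonglongrightarrow> 0"
  proof (rule lpn_tendsto_dominated[OF q _ f])
    show "(\<lambda>n. t n y) \<longlonglongrightarrow> 0" for y
    proof -
      have "eventually (\<lambda>k. norm y < real k) sequentially"
        using eventually_gt_at_top[of "nat \<lceil>norm y\<rceil>"] by eventually_elim linarith
      then show ?thesis by (intro tendsto_eventually) (elim eventually_mono, simp add: t_def)
    qed
  qed (auto simp: t_def)
  then have "(\<lambda>n. lpn q lborel (t n) powr q) \<longlonglongrightarrow> 0" using q by (intro tendsto_zero_powrI[of _ _ _ q]) auto
  then have lim: "(\<lambda>n. Ip q lborel (t n)) \<longlonglongrightarrow> 0" using q by (simp add: lpn_powr)
  \<comment> \<open>The cap 1 keeps the ball around a point of norm at least n + 1 in the region of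
    norm at least n.\<close>
  define r where "r = min 1 (c / (2 * L))"
  have r: "0 < r" "r \<le> 1" "L * r \<le> c / 2"
    using c L by (auto simp: r_def min_def field_simps)
  define m where "m = (c / 2) powr q * (unit_ball_vol DIM('a) * r ^ DIM('a))"
  have "0 < m" using c r by (simp add: m_def)
  then have "eventually (\<lambda>n. Ip q lborel (t n) < m) sequentially" using lim by (intro order_tendstoD) auto
  then obtain n where n: "Ip q lborel (t n) < m" by (meson eventually_happens' sequentially_bot)
  have "norm (f z) < c" if z: "norm z \<ge> real n + 1" for z
  proof (rule ccontr)
    assume "\<not> norm (f z) < c"
    have "m \<le> Ip q lborel (t n)" unfolding m_def
    proof (rule Ip_ge_ball[OF tL])
      show "c / 2 \<le> norm (t n y)" if y: "y \<in> ball z r" for y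
      proof -
        have "norm (z - y) \<le> r" using y by (simp add: dist_norm)
        then have "real n \<le> norm y" using z r norm_triangle_ineq2[of z y] by linarith
        moreover have "L * norm (z - y) \<le> L * r" using \<open>norm (z - y) \<le> r\<close> L by simp
        then have "norm (f z - f y) \<le> c / 2" using lip[of z y] r by linarith
        then have "c / 2 \<le> norm (f y)" using \<open>\<not> norm (f z) < c\<close> norm_triangle_ineq2[of "f z" "f y"] by linarith
        ultimately show ?thesis by (simp add: t_def)
      qed
    qed (use q c r in auto)
    then show False using n by simp
  qed
  then show "eventually (\<lambda>z. dist (f z) 0 < c) at_infinity"
    unfolding eventually_at_infinity by (intro exI[of _ "real n + 1"]) simp
qed

text \<open>From |w|^q = |w|^(q - q1) |w|^q1. For q1 < q and bounded L^q1 norm, a small supremum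
  makes the L^q norm small; this is how the gain in the exponent is exploited.\<close>

lemma Ip_interpolate:
  assumes w: "w \<in> Lp q1 M" and wm: "\<And>x. x \<in> space M \<Longrightarrow> norm (w x) \<le> s" and q: "0 < q1" "q1 \<le> q"
  shows "w \<in> Lp q M" "Ip q M w \<le> s powr (q - q1) * Ip q1 M w"
proof -
  have [measurable]: "w \<in> borel_measurable M" using w by (rule Lp_measurable)
  have le: "norm (w x) powr q \<le> s powr (q - q1) * norm (w x) powr q1" if "x \<in> space M" for x
  proof -
    have "norm (w x) powr q = norm (w x) powr (q - q1) * norm (w x) powr q1"
      by (simp flip: powr_add)
    also have "\<dots> \<le> s powr (q - q1) * norm (w x) powr q1"
      using q wm[OF that] by (intro mult_right_mono powr_mono2) auto
    finally show ?thesis .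
  qed
  have i: "integrable M (\<lambda>x. s powr (q - q1) * norm (w x) powr q1)" by (intro integrable_mult_right Lp_integrable w)
  show wL: "w \<in> Lp q M"
    by (rule LpI) (auto intro!: Bochner_Integration.integrable_bound[OF i] AE_I2 simp: le)
  show "Ip q M w \<le> s powr (q - q1) * Ip q1 M w"
    using integral_mono[OF Lp_integrable[OF wL] i le] by (simp add: Ip_def)
qed

text \<open>Here \<open>x j n\<close> is the position of the j-th peak on the extension side. The
  extension of \<open>modulate y f\<close> is that of f translated by -y, so the modulation points
  of the theorem are the negatives of these positions.\<close>

definition remainder :: "(nat \<Rightarrow> 'a::euclidean_space \<Rightarrow> complex) \<Rightarrow> (nat \<Rightarrow> nat \<Rightarrow> 'a) \<Rightarrow> (nat \<Rightarrow> 'a \<Rightarrow> complex) \<Rightarrow> nat \<Rightarrow> nat \<Rightarrow> 'a \<Rightarrow> complex" where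
  "remainder u x U J n y = u n y - (\<Sum>j<J. U j (y - x j n))"

lemma shifted_vanish:
  fixes U :: "'a::euclidean_space \<Rightarrow> complex"
  assumes U: "(U \<longlongrightarrow> 0) at_infinity" and a: "filterlim (\<lambda>n. norm (a n)) at_top F"
  shows "((\<lambda>n. U (a n + y)) \<longlongrightarrow> 0) F"
proof (rule filterlim_compose[OF U])
  have "filterlim a at_infinity F" using a by (rule filterlim_norm_at_top_imp_at_infinity)
  then have "filterlim (\<lambda>n. y + a n) at_infinity F" by (rule tendsto_add_filterlim_at_infinity[OF tendsto_const])
  then show "filterlim (\<lambda>n. a n + y) at_infinity F" by (simp add: add.commute)
qed

text \<open>Around points running away from all old centres the subtracted profiles contribute
  nothing in the limit.\<close>

lemma remainder_at_new:
  assumes U0: "\<And>j. j < J \<Longrightarrow> (U j \<longlongrightarrow> 0) at_infinity"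
    and conv: "(\<lambda>n. u n (z n + y)) \<longlonglongrightarrow> l"
    and div: "\<And>j. j < J \<Longrightarrow> filterlim (\<lambda>n. norm (z n - x j n)) at_top sequentially"
  shows "(\<lambda>n. remainder u x U J n (z n + y)) \<longlonglongrightarrow> l"
proof -
  have "(\<lambda>n. U j (z n + y - x j n)) \<longlonglongrightarrow> 0" if "j < J" for j
    using shifted_vanish[OF U0[OF that] div[OF that], of y] by (simp add: algebra_simps)
  then have "(\<lambda>n. u n (z n + y) - (\<Sum>j<J. U j (z n + y - x j n))) \<longlonglongrightarrow> l - (\<Sum>j<J. 0)"
    by (intro tendsto_diff conv tendsto_sum) auto
  then show ?thesis by (simp add: remainder_def)
qed

text \<open>At an old centre its own profile cancels the local limit of u and the others have moved
  away, so no peak is left there.\<close>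

lemma remainder_at_old:
  assumes U0: "\<And>j. j < J \<Longrightarrow> (U j \<longlongrightarrow> 0) at_infinity" and i: "i < J"
    and conv: "(\<lambda>n. u n (x i n + y)) \<longlonglongrightarrow> U i y"
    and div: "\<And>j. j < J \<Longrightarrow> j \<noteq> i \<Longrightarrow> filterlim (\<lambda>n. norm (x i n - x j n)) at_top sequentially"
  shows "(\<lambda>n. remainder u x U J n (x i n + y)) \<longlonglongrightarrow> 0"
proof -
  have "(\<lambda>n. U j (x i n + y - x j n)) \<longlonglongrightarrow> (if j = i then U i y else 0)" if "j < J" for j
    using shifted_vanish[OF U0[OF that] div[OF that], of y] by (auto simp: algebra_simps)
  then have "(\<lambda>n. u n (x i n + y) - (\<Sum>j<J. U j (x i n + y - x j n))) \<longlonglongrightarrow> U i y - (\<Sum>j<J. if j = i then U i y else 0)"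
    by (intro tendsto_diff conv tendsto_sum) auto
  then show ?thesis using i by (simp add: remainder_def)
qed

lemma remainder_Lp:
  fixes u :: "nat \<Rightarrow> 'a::euclidean_space \<Rightarrow> complex"
  assumes "\<And>n. u n \<in> Lp q lborel" "\<And>j. j < J \<Longrightarrow> U j \<in> Lp q lborel" "0 \<le> q"
  shows "remainder u x U J n \<in> Lp q lborel"
proof -
  have "(\<lambda>y. u n y - (\<Sum>j<J. U j (- x j n + y))) \<in> Lp q lborel"
    using assms by (intro Lp_diff Lp_sum Lp_translate) auto
  then show ?thesis by (simp add: remainder_def[abs_def])
qed

text \<open>Induction on J: the remainder after J profiles, translated by \<open>x J n\<close>,
  converges pointwise to U J, so the Brezis-Lieb lemma splits off the integral of U J; translation
  invariance undoes the shift.\<close>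

lemma decoupling:
  fixes u :: "nat \<Rightarrow> 'a::euclidean_space \<Rightarrow> complex"
  assumes q: "0 < q" and u: "\<And>n. u n \<in> Lp q lborel" and bd: "eventually (\<lambda>n. Ip q lborel (u n) \<le> B) sequentially"
    and UL: "\<And>j. j < J \<Longrightarrow> U j \<in> Lp q lborel" and U0: "\<And>j. j < J \<Longrightarrow> (U j \<longlongrightarrow> 0) at_infinity"
    and conv: "\<And>j y. j < J \<Longrightarrow> (\<lambda>n. u n (x j n + y)) \<longlonglongrightarrow> U j y"
    and div: "\<And>j k. j < J \<Longrightarrow> k < J \<Longrightarrow> j \<noteq> k \<Longrightarrow> filterlim (\<lambda>n. norm (x j n - x k n)) at_top sequentially"
  shows "(\<lambda>n. Ip q lborel (u n) - (\<Sum>j<J. Ip q lborel (U j)) - Ip q lborel (remainder u x U J n)) \<longlonglongrightarrow> 0"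
  using UL U0 conv div
proof (induction J)
  case 0
  then show ?case by (simp add: remainder_def[abs_def])
next
  case (Suc J)
  have IH: "(\<lambda>n. Ip q lborel (u n) - (\<Sum>j<J. Ip q lborel (U j)) - Ip q lborel (remainder u x U J n)) \<longlonglongrightarrow> 0"
    using Suc.prems by (intro Suc.IH) auto
  have rL: "remainder u x U J n \<in> Lp q lborel" "remainder u x U (Suc J) n \<in> Lp q lborel" for n
    using Suc.prems q by (auto intro!: remainder_Lp u)
  have [measurable]: "remainder u x U J n \<in> borel_measurable borel" "remainder u x U (Suc J) n \<in> borel_measurable borel" for n
    using Lp_measurable[OF rL(1)] Lp_measurable[OF rL(2)] by simp_all
  define g where "g n y = remainder u x U J n (x J n + y)" for n y
  have gI: "Ip q lborel (g n) = Ip q lborel (remainder u x U J n)" for n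
    unfolding g_def[abs_def] by (rule Ip_translate) measurable
  have "(\<lambda>n. Ip q lborel (g n) - Ip q lborel (\<lambda>y. g n y - U J y) - Ip q lborel (U J)) \<longlonglongrightarrow> 0"
  proof (rule Brezis_Lieb[OF q])
    show "g n \<in> Lp q lborel" for n unfolding g_def[abs_def] by (intro Lp_translate rL)
    show "(\<lambda>n. g n y) \<longlonglongrightarrow> U J y" for y unfolding g_def
      by (rule remainder_at_new) (use Suc.prems in auto)
    \<comment> \<open>Brezis-Lieb asks for a bound on the remainder rather than on u; the induction
      hypothesis supplies it up to an error 1.\<close>
    have "eventually (\<lambda>n. norm (Ip q lborel (u n) - (\<Sum>j<J. Ip q lborel (U j)) - Ip q lborel (remainder u x U J n) - 0) < 1) sequentially"
      using IH unfolding tendsto_iff dist_norm by (auto dest: spec[of _ 1])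
    then show "eventually (\<lambda>n. Ip q lborel (g n) \<le> B + 1) sequentially"
      using bd
    proof eventually_elim
      case (elim n)
      have "0 \<le> (\<Sum>j<J. Ip q lborel (U j))" by (intro sum_nonneg) simp
      then show ?case using elim unfolding gI real_norm_def by linarith
    qed
  qed (use Suc.prems in auto)
  moreover have "Ip q lborel (\<lambda>y. g n y - U J y) = Ip q lborel (remainder u x U (Suc J) n)" for n
  proof -
    have "g n y - U J y = remainder u x U (Suc J) n (x J n + y)" for y by (simp add: g_def remainder_def)
    then show ?thesis using Ip_translate[of "remainder u x U (Suc J) n" q "x J n"] by simp
  qed
  ultimately have "(\<lambda>n. (Ip q lborel (u n) - (\<Sum>j<J. Ip q lborel (U j)) - Ip q lborel (remainder u x U J n)) +
     (Ip q lborel (remainder u x U J n) - Ip q lborel (remainder u x U (Suc J) n) - Ip q lborel (U J))) \<longlonglongrightarrow> 0 + 0"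
    by (intro tendsto_add IH) (simp add: gI)
  then show ?case by (simp add: algebra_simps)
qed

section \<open>Selection of profiles\<close>

text \<open>A diagonal sequence converges for all i on a countable dense set, and the Lipschitz
  bounds, uniform in n, carry this to every point.\<close>

lemma Lipschitz_convergent_subsequence:
  fixes h :: "nat \<Rightarrow> nat \<Rightarrow> 'a::euclidean_space \<Rightarrow> complex"
  assumes bd: "\<And>i n y. norm (h i n y) \<le> B i"
    and lip: "\<And>i n y z. norm (h i n y - h i n z) \<le> L i * norm (y - z)"
  obtains v :: "nat \<Rightarrow> nat" where "strict_mono v" "\<And>i y. convergent (\<lambda>n. h i (v n) y)"
proof -
  obtain D :: "'a set" where D: "countable D" "\<And>X. open X \<Longrightarrow> X \<noteq> {} \<Longrightarrow> \<exists>d\<in>D. d \<in> X"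
    by (erule countable_dense_setE)
  have B: "0 \<le> B i" for i using bd[of i 0 0] norm_ge_zero order_trans by blast
  \<comment> \<open>Normalised to the unit disc: the members have different bounds, and the diagonal
    argument is applied with the common bound 1.\<close>
  define f where "f n a = h (fst a) n (snd a) / (B (fst a) + 1)" for n and a :: "nat \<times> 'a"
  have "norm (f n a) \<le> 1" for n a
  proof -
    have "norm (f n a) = norm (h (fst a) n (snd a)) / (B (fst a) + 1)"
      using B[of "fst a"] by (simp add: f_def norm_divide flip: of_real_add of_real_1[where 'a=complex])
    then show ?thesis using bd[of "fst a" n "snd a"] B[of "fst a"] by (simp add: divide_le_eq)
  qed
  moreover have "countable ((UNIV :: nat set) \<times> D)" using D(1) by (intro countable_SIGMA) auto
  ultimately obtain v :: "nat \<Rightarrow> nat" where v: "strict_mono v" "\<And>a. a \<in> UNIV \<times> D \<Longrightarrow> \<exists>l. (\<lambda>n. f (v n) a) \<longlonglongrightarrow> l"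
    using function_convergent_subsequence[of "UNIV \<times> D" f 1] by blast
  have cD: "convergent (\<lambda>n. h i (v n) d)" if dD: "d \<in> D" for i d
  proof -
    obtain l where "(\<lambda>n. f (v n) (i, d)) \<longlonglongrightarrow> l" using v(2)[of "(i, d)"] dD by auto
    then have "(\<lambda>n. (B i + 1) * f (v n) (i, d)) \<longlonglongrightarrow> (B i + 1) * l" by (intro tendsto_mult_left)
    moreover have "complex_of_real (B i) + 1 \<noteq> 0"
      using B[of i] by (metis add_nonneg_pos of_real_1 of_real_add of_real_eq_0_iff less_irrefl zero_less_one)
    ultimately have "(\<lambda>n. h i (v n) d) \<longlonglongrightarrow> (B i + 1) * l" by (simp add: f_def)
    then show ?thesis by (auto simp: convergent_def)
  qed
  have "convergent (\<lambda>n. h i (v n) y)" for i y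
  proof (rule Cauchy_convergent, rule metric_CauchyI)
    fix e :: real assume e: "0 < e"
    define r where "r = e / (3 * (\<bar>L i\<bar> + 1))"
    have r: "0 < r" using e by (simp add: r_def)
    obtain d where d: "d \<in> D" "dist y d < r" using D(2)[of "ball y r"] r by auto
    have "\<bar>L i\<bar> * norm (y - d) \<le> (\<bar>L i\<bar> + 1) * r" using d by (intro mult_mono) (auto simp: dist_norm)
    also have "\<dots> = e / 3" by (simp add: r_def field_simps)
    finally have small: "norm (h i n y - h i n d) \<le> e / 3" for n
      using lip[of i n y d] mult_right_mono[OF abs_ge_self norm_ge_zero, of "L i" "y - d"] by linarith
    have "Cauchy (\<lambda>n. h i (v n) d)" using cD[OF d(1)] by (rule convergent_Cauchy)
    then obtain N where N: "\<And>m n. m \<ge> N \<Longrightarrow> n \<ge> N \<Longrightarrow> dist (h i (v m) d) (h i (v n) d) < e / 3"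
      using metric_CauchyD[of _ "e/3"] e by (metis zero_less_divide_iff zero_less_numeral)
    show "\<exists>N. \<forall>m\<ge>N. \<forall>n\<ge>N. dist (h i (v m) y) (h i (v n) y) < e"
    proof (intro exI[of _ N] allI impI)
      fix m n assume "m \<ge> N" "n \<ge> N"
      from N[OF this] small[of "v m"] small[of "v n"]
      show "dist (h i (v m) y) (h i (v n) y) < e"
        using dist_triangle[of "h i (v m) y" "h i (v n) y" "h i (v m) d"] dist_triangle[of "h i (v m) d" "h i (v n) y" "h i (v n) d"]
        by (simp add: dist_norm norm_minus_commute)
    qed
  qed
  with v(1) that show ?thesis by blast
qed

lemma eventually_diagonal:
  fixes P :: "nat \<Rightarrow> nat \<Rightarrow> bool"
  assumes "\<And>k. eventually (P k) sequentially"
  obtains v :: "nat \<Rightarrow> nat" where "strict_mono v" "\<And>k. P k (v k)"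
proof -
  have "\<forall>k. \<exists>N. \<forall>n\<ge>N. P k n" using assms by (simp add: eventually_sequentially)
  then obtain N where N: "\<And>k n. n \<ge> N k \<Longrightarrow> P k n" by metis
  define v where "v k = (\<Sum>i\<le>k. N i) + k" for k
  have "N k \<le> v k" for k unfolding v_def by (rule trans_le_add1, rule member_le_sum) auto
  moreover have "strict_mono v" by (auto simp: strict_mono_Suc_iff v_def)
  ultimately show ?thesis using N that by blast
qed

text \<open>Convergence at the points of a finite r-net of the ball suffices, since moving to the
  nearest net point costs at most e / 2.\<close>

lemma Lipschitz_uniform_zero:
  fixes W :: "nat \<Rightarrow> 'a::euclidean_space \<Rightarrow> complex"
  assumes lip: "\<And>n y z. norm (W n y - W n z) \<le> L * norm (y - z)"
    and z: "\<And>y. (\<lambda>n. W n y) \<longlonglongrightarrow> 0" and e: "0 < e"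
  shows "eventually (\<lambda>n. \<forall>y. norm y \<le> R \<longrightarrow> norm (W n y) \<le> e) sequentially"
proof -
  define r where "r = e / (2 * (\<bar>L\<bar> + 1))"
  have r: "0 < r" using e by (simp add: r_def)
  have "compact (cball (0::'a) R)" by simp
  then obtain K where K: "finite K" "cball (0::'a) R \<subseteq> (\<Union>k\<in>K. ball k r)"
    using r by (auto simp: compact_eq_totally_bounded)
  have "eventually (\<lambda>n. \<forall>k\<in>K. norm (W n k) < e / 2) sequentially"
  proof (rule eventually_ball_finite[OF K(1)], rule ballI)
    show "eventually (\<lambda>n. norm (W n k) < e / 2) sequentially" for k
      using tendstoD[OF z[of k], of "e/2"] e by simp
  qed
  then show ?thesis
  proof eventually_elim
    case (elim n)
    show ?case
    proof (intro allI impI)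
      fix y :: 'a assume "norm y \<le> R"
      then have "y \<in> cball 0 R" by simp
      then obtain k where k: "k \<in> K" "dist k y < r" using K(2) by (auto dest: subsetD)
      have "L * norm (y - k) \<le> (\<bar>L\<bar> + 1) * r" using k(2) r
        by (intro mult_mono) (auto simp: dist_norm norm_minus_commute)
      also have "\<dots> = e / 2" by (simp add: r_def field_simps)
      finally have "norm (W n y - W n k) \<le> e / 2" using lip[of n y k] by linarith
      then show "norm (W n y) \<le> e" using elim k(1) norm_triangle_ineq2[of "W n y" "W n k"] by force
    qed
  qed
qed

text \<open>i numbers the members, n is the sequence index. Each member has its own exponent
  \<open>Q i\<close>, so that the sequence and its truncations, which obey different estimates, can
  share the centres.\<close>

locale profile_family =
  fixes u :: "nat \<Rightarrow> nat \<Rightarrow> 'a::euclidean_space \<Rightarrow> complex" and Q B C L :: "nat \<Rightarrow> real"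
  assumes Q: "0 < Q i" and uL: "u i n \<in> Lp (Q i) lborel" and uC: "Ip (Q i) lborel (u i n) \<le> C i"
    and uB: "norm (u i n y) \<le> B i" and L: "0 < L i"
    and ulip: "norm (u i n y - u i n z) \<le> L i * norm (y - z)"
begin

lemma u_measurable [measurable]: "u i n \<in> borel_measurable borel"
  using Lp_measurable[OF uL] by simp

lemma limit_profile:
  assumes lim: "\<And>y. (\<lambda>n. u i (t n) (z n + y)) \<longlonglongrightarrow> U y"
  shows "norm (U y - U y') \<le> L i * norm (y - y')" "norm (U y) \<le> B i"
    "U \<in> Lp (Q i) lborel" "(U \<longlongrightarrow> 0) at_infinity"
proof -
  show lip: "norm (U y - U y') \<le> L i * norm (y - y')" for y y'
  proof (rule tendsto_upperbound)
    show "(\<lambda>n. norm (u i (t n) (z n + y) - u i (t n) (z n + y'))) \<longlonglongrightarrow> norm (U y - U y')"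
      by (intro tendsto_intros lim)
    show "eventually (\<lambda>n. norm (u i (t n) (z n + y) - u i (t n) (z n + y')) \<le> L i * norm (y - y')) sequentially"
      using ulip[of i] by (intro always_eventually allI) (metis add_diff_cancel_left)
  qed simp
  show "norm (U y) \<le> B i"
    by (rule tendsto_upperbound[OF tendsto_norm[OF lim]]) (auto simp: uB)
  have [measurable]: "U \<in> borel_measurable borel"
    by (rule borel_measurable_LIMSEQ_metric[of "\<lambda>n y. u i (t n) (z n + y)"]) (auto simp: lim)
  show "U \<in> Lp (Q i) lborel"
  proof (rule Lp_Fatou(1)[OF Q])
    show "(\<lambda>y. u i (t n) (z n + y)) \<in> Lp (Q i) lborel" for n by (intro Lp_translate uL)
    show "eventually (\<lambda>n. Ip (Q i) lborel (\<lambda>y. u i (t n) (z n + y)) \<le> C i) sequentially"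
      by (simp add: Ip_translate uC)
  qed (auto simp: lim)
  then show "(U \<longlongrightarrow> 0) at_infinity" by (rule Lipschitz_Lp_vanishes[OF _ Q L lip])
qed

text \<open>Stage \<open>j\<close> of the selection extracts a peak of the remainder of the member \<open>sel j\<close>;
  every member is treated infinitely often.\<close>

definition sel :: "nat \<Rightarrow> nat" where "sel j = fst (prod_decode j)"

text \<open>\<open>t\<close> is the subsequence so far. The centres are functions of the original
  index and occur as \<open>x k (t n)\<close>, so thinning out the subsequence leaves x and U
  unchanged. By the third clause the new profile of member \<open>sel j\<close> has at 0
  asymptotically the size of the supremum of the remainder.\<close>

definition selected :: "nat \<Rightarrow> (nat \<Rightarrow> nat) \<Rightarrow> (nat \<Rightarrow> nat \<Rightarrow> 'a) \<Rightarrow> (nat \<Rightarrow> nat \<Rightarrow> 'a \<Rightarrow> complex) \<Rightarrow> bool" where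
  "selected J t x U \<longleftrightarrow>
    (\<forall>j<J. \<forall>i y. (\<lambda>n. u i (t n) (x j (t n) + y)) \<longlonglongrightarrow> U i j y) \<and>
    (\<forall>j<J. \<forall>k<j. filterlim (\<lambda>n. norm (x j (t n) - x k (t n))) at_top sequentially) \<and>
    (\<forall>j<J. \<forall>e>0. eventually (\<lambda>n. \<forall>y. norm (remainder (\<lambda>n. u (sel j) (t n)) (\<lambda>k n. x k (t n)) (U (sel j)) j n y)
        \<le> norm (U (sel j) j 0) + e) sequentially)"

lemma remainder_cong:
  assumes "\<And>j. j < J \<Longrightarrow> x j = x' j" "\<And>j. j < J \<Longrightarrow> U j = U' j"
  shows "remainder u' (\<lambda>k n. x k (t n)) U J n y = remainder u' (\<lambda>k n. x' k (t n)) U' J n y"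
  unfolding remainder_def using assms by simp

lemma selected_cong:
  assumes "\<And>j. j < J \<Longrightarrow> x j = x' j" "\<And>i j. j < J \<Longrightarrow> U i j = U' i j"
  shows "selected J t x U \<longleftrightarrow> selected J t x' U'"
proof -
  have "remainder u' (\<lambda>k n. x k (t n)) (U i) j n y = remainder u' (\<lambda>k n. x' k (t n)) (U' i) j n y" if "j < J" for u' i j n y
    by (rule remainder_cong) (use assms that in auto)
  then show ?thesis unfolding selected_def using assms by (auto cong: conj_cong)
qed

text \<open>All clauses are asymptotic, so eventual agreement suffices. The diagonal sequence, a
  reindexing of stage J only from index J on, thus inherits \<open>selected\<close>.\<close>

lemma selected_reindex:
  assumes "selected J t x U" and v: "filterlim v at_top sequentially"
    and eq: "eventually (\<lambda>n. t' n = t (v n)) sequentially"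
  shows "selected J t' x U"
  unfolding selected_def
proof (intro conjI allI impI)
  fix j i y assume j: "j < J"
  then have "(\<lambda>n. u i (t n) (x j (t n) + y)) \<longlonglongrightarrow> U i j y" using assms(1) by (simp add: selected_def)
  from filterlim_compose[OF this v] show "(\<lambda>n. u i (t' n) (x j (t' n) + y)) \<longlonglongrightarrow> U i j y"
    by (rule Lim_transform_eventually) (use eq in eventually_elim, simp)
next
  fix j k assume "j < J" "k < j"
  then have "filterlim (\<lambda>n. norm (x j (t n) - x k (t n))) at_top sequentially" using assms(1) by (simp add: selected_def)
  from filterlim_compose[OF this v] show "filterlim (\<lambda>n. norm (x j (t' n) - x k (t' n))) at_top sequentially"
    by (rule filterlim_mono_eventually) (use eq in \<open>auto elim!: eventually_mono\<close>)
next
  fix j and e :: real assume "j < J" "0 < e"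
  then have "eventually (\<lambda>n. \<forall>y. norm (remainder (\<lambda>n. u (sel j) (t n)) (\<lambda>k n. x k (t n)) (U (sel j)) j n y)
        \<le> norm (U (sel j) j 0) + e) sequentially" using assms(1) by (simp add: selected_def)
  from eventually_compose_filterlim[OF this v] eq
  show "eventually (\<lambda>n. \<forall>y. norm (remainder (\<lambda>n. u (sel j) (t' n)) (\<lambda>k n. x k (t' n)) (U (sel j)) j n y)
        \<le> norm (U (sel j) j 0) + e) sequentially"
    by eventually_elim (simp add: remainder_def)
qed

lemma selected_limit:
  assumes "selected J t x U" "j < J"
  shows "norm (U i j y - U i j y') \<le> L i * norm (y - y')" "norm (U i j y) \<le> B i"
    "U i j \<in> Lp (Q i) lborel" "(U i j \<longlongrightarrow> 0) at_infinity"
  using limit_profile[of i t "\<lambda>n. x j (t n)" "U i j"] assms by (auto simp: selected_def)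

lemma selected_diverge:
  assumes "selected J t x U" "j < J" "k < J" "j \<noteq> k"
  shows "filterlim (\<lambda>n. norm (x j (t n) - x k (t n))) at_top sequentially"
proof (cases "k < j")
  case False
  then have "filterlim (\<lambda>n. norm (x k (t n) - x j (t n))) at_top sequentially"
    using assms by (auto simp: selected_def)
  then show ?thesis by (simp add: norm_minus_commute)
qed (use assms in \<open>auto simp: selected_def\<close>)

text \<open>The remainder is at most e on the balls of radius R around the old centres. A point
  within e of the supremum therefore lies outside them, or else the supremum is at most 2 e and any
  outside point serves.\<close>

lemma far_peak:
  fixes i :: nat
  assumes S: "selected J t x U"
  defines "W \<equiv> remainder (\<lambda>n. u i (t n)) (\<lambda>k n. x k (t n)) (U i) J"
  assumes e: "0 < e"
  shows "eventually (\<lambda>n. \<exists>z. (\<forall>k<J. R \<le> norm (z - x k (t n))) \<and> (\<forall>y. norm (W n y) \<le> norm (W n z) + 2 * e)) sequentially"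
proof -
  have Wlip: "norm (W n y - W n y') \<le> (L i + real J * L i) * norm (y - y')" for n y y'
  proof -
    have "W n y - W n y' = (u i (t n) y - u i (t n) y') - (\<Sum>j<J. U i j (y - x j (t n)) - U i j (y' - x j (t n)))"
      by (simp add: W_def remainder_def sum_subtractf)
    also have "norm \<dots> \<le> norm (u i (t n) y - u i (t n) y') + norm (\<Sum>j<J. U i j (y - x j (t n)) - U i j (y' - x j (t n)))"
      by (rule norm_triangle_ineq4)
    also have "\<dots> \<le> L i * norm (y - y') + (\<Sum>j<J. L i * norm (y - y'))"
    proof (intro add_mono ulip order_trans[OF norm_sum] sum_mono)
      fix j assume "j \<in> {..<J}"
      then show "norm (U i j (y - x j (t n)) - U i j (y' - x j (t n))) \<le> L i * norm (y - y')"
        using selected_limit(1)[OF S, of j i "y - x j (t n)" "y' - x j (t n)"] by simp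
    qed
    finally show ?thesis by (simp add: algebra_simps)
  qed
  have Wbd: "norm (W n y) \<le> B i + real J * B i" for n y
  proof -
    have "norm (W n y) \<le> norm (u i (t n) y) + norm (\<Sum>j<J. U i j (y - x j (t n)))"
      unfolding W_def remainder_def by (rule norm_triangle_ineq4)
    also have "\<dots> \<le> B i + (\<Sum>j<J. B i)"
      by (intro add_mono uB order_trans[OF norm_sum] sum_mono) (use selected_limit(2)[OF S] in auto)
    finally show ?thesis by simp
  qed
  have "eventually (\<lambda>n. \<forall>y. norm y \<le> R \<longrightarrow> norm (W n (x k (t n) + y)) \<le> e) sequentially" if k: "k < J" for k
  proof (rule Lipschitz_uniform_zero[OF _ _ e])
    show "norm (W n (x k (t n) + y) - W n (x k (t n) + z)) \<le> (L i + real J * L i) * norm (y - z)" for n y z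
      using Wlip[of n "x k (t n) + y" "x k (t n) + z"] by simp
    show "(\<lambda>n. W n (x k (t n) + y)) \<longlonglongrightarrow> 0" for y unfolding W_def
      by (rule remainder_at_old[where x = "\<lambda>k n. x k (t n)"])
         (use S k selected_limit(4)[OF S] selected_diverge[OF S] in \<open>auto simp: selected_def\<close>)
  qed
  then have "eventually (\<lambda>n. \<forall>k\<in>{..<J}. \<forall>y. norm y \<le> R \<longrightarrow> norm (W n (x k (t n) + y)) \<le> e) sequentially"
    by (intro eventually_ball_finite) auto
  then show ?thesis
  proof eventually_elim
    case (elim n)
    define s where "s = (SUP y. norm (W n y))"
    have bdd: "bdd_above (range (\<lambda>y. norm (W n y)))" using Wbd by (auto intro!: bdd_aboveI2)
    have s: "norm (W n y) \<le> s" for y unfolding s_def by (rule cSUP_upper[OF UNIV_I bdd])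
    have "\<exists>y. s - e < norm (W n y)"
      using less_cSUP_iff[of UNIV "\<lambda>y. norm (W n y)" "s - e"] bdd e by (auto simp: s_def)
    then obtain y0 where y0: "s - e < norm (W n y0)" by blast
    show ?case
    proof (cases "\<forall>k<J. R \<le> norm (y0 - x k (t n))")
      case True
      have "norm (W n y) \<le> norm (W n y0) + 2 * e" for y using s[of y] y0 e by linarith
      with True show ?thesis by blast
    next
      case False
      then obtain k where k: "k < J" "norm (y0 - x k (t n)) < R" by auto
      then have "norm (W n (x k (t n) + (y0 - x k (t n)))) \<le> e"
        using elim[rule_format, of k "y0 - x k (t n)"] by simp
      then have s2: "s \<le> 2 * e" using y0 by simp
      \<comment> \<open>Finitely many balls leave some point uncovered; there the allowance 2 e
        alone dominates the remainder.\<close>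
      have "bounded (\<Union>k\<in>{..<J}. ball (x k (t n)) R)" by (intro bounded_UN) auto
      then have "(\<Union>k\<in>{..<J}. ball (x k (t n)) R) \<noteq> UNIV" using not_bounded_UNIV by metis
      then obtain z where "z \<notin> (\<Union>k\<in>{..<J}. ball (x k (t n)) R)" by blast
      then have z: "z \<notin> ball (x k (t n)) R" if "k < J" for k using that by blast
      have "norm (W n y) \<le> norm (W n z) + 2 * e" for y using s[of y] s2 norm_ge_zero[of "W n z"] by linarith
      moreover have "R \<le> norm (z - x k (t n))" if "k < J" for k using z[OF that] by (simp add: dist_norm norm_minus_commute)
      ultimately show ?thesis by blast
    qed
  qed
qed

text \<open>\<open>far_peak\<close> with R = m and e = 1/(m+1) along a diagonal gives points z m
  running away from the old centres; a further subsequence makes all members converge around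
  them.\<close>

lemma select_step:
  assumes S: "selected J t x U" and t: "strict_mono t"
  shows "\<exists>v x' U'. strict_mono v \<and> selected (Suc J) (t \<circ> v) x' U' \<and> (\<forall>j<J. x' j = x j \<and> (\<forall>i. U' i j = U i j))"
proof -
  define W where "W = remainder (\<lambda>n. u (sel J) (t n)) (\<lambda>k n. x k (t n)) (U (sel J)) J"
  define E where "E m = 1 / real (Suc m)" for m
  have E0: "0 < E m" for m by (simp add: E_def)
  define F where "F m n \<longleftrightarrow> (\<exists>z. (\<forall>k<J. real m \<le> norm (z - x k (t n))) \<and> (\<forall>y. norm (W n y) \<le> norm (W n z) + 2 * E m))" for m n
  have "eventually (F m) sequentially" for m
    unfolding W_def F_def by (rule far_peak[OF S E0])
  then obtain v1 where v1: "strict_mono v1" and F: "\<And>m. F m (v1 m)"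
    by (rule eventually_diagonal[of F]) blast
  have "\<forall>m. \<exists>z. (\<forall>k<J. real m \<le> norm (z - x k (t (v1 m)))) \<and> (\<forall>y. norm (W (v1 m) y) \<le> norm (W (v1 m) z) + 2 * E m)"
    using F unfolding F_def by blast
  from choice[OF this] obtain z where z1: "\<And>m k. k < J \<Longrightarrow> real m \<le> norm (z m - x k (t (v1 m)))"
    and z2: "\<And>m y. norm (W (v1 m) y) \<le> norm (W (v1 m) (z m)) + 2 * E m" by blast
  obtain v2 where v2: "strict_mono v2" and conv: "\<And>i y. convergent (\<lambda>n. u i (t (v1 (v2 n))) (z (v2 n) + y))"
  proof (rule Lipschitz_convergent_subsequence[of "\<lambda>i m y. u i (t (v1 m)) (z m + y)" B L])
    show "norm (u i (t (v1 n)) (z n + y) - u i (t (v1 n)) (z n + za)) \<le> L i * norm (y - za)" for i n y za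
      using ulip[of i _ "z n + y" "z n + za"] by simp
  qed (auto simp: uB)
  have inj: "inj (t \<circ> v1)" using t v1 by (intro strict_mono_imp_inj_on strict_mono_o)
  \<comment> \<open>Centres depend on the original index, so z is transported along the injection
    \<open>t \<circ> v1\<close>; off its range the value is arbitrary.\<close>
  define x' where "x' = x(J := \<lambda>N. z (inv (t \<circ> v1) N))"
  have x'J: "x' J (t (v1 m)) = z m" for m
    using inv_f_f[OF inj, of m] by (simp add: x'_def)
  define U' where "U' i = (U i)(J := \<lambda>y. lim (\<lambda>n. u i (t (v1 (v2 n))) (z (v2 n) + y)))" for i
  define t' where "t' = t \<circ> (v1 \<circ> v2)"
  have v12: "strict_mono (v1 \<circ> v2)" using v1 v2 by (rule strict_mono_o)
  have agree: "\<forall>j<J. x' j = x j \<and> (\<forall>i. U' i j = U i j)" by (simp add: x'_def U'_def)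
  have "selected J t' x U"
    by (rule selected_reindex[OF S filterlim_subseq[OF v12]]) (simp add: t'_def)
  then have S': "selected J t' x' U'" using agree selected_cong[of J x x' U U'] by simp
  have newconv: "(\<lambda>n. u i (t' n) (x' J (t' n) + y)) \<longlonglongrightarrow> U' i J y" for i y
    using conv[of i y] by (simp add: t'_def x'J U'_def convergent_LIMSEQ_iff)
  have newdiv: "filterlim (\<lambda>n. norm (x' J (t' n) - x' k (t' n))) at_top sequentially" if k: "k < J" for k
  proof (rule filterlim_at_top_mono)
    show "filterlim (\<lambda>n. real (v2 n)) at_top sequentially"
      by (rule filterlim_compose[OF filterlim_real_sequentially filterlim_subseq[OF v2]])
    show "eventually (\<lambda>n. real (v2 n) \<le> norm (x' J (t' n) - x' k (t' n))) sequentially"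
      using z1[OF k] k by (simp add: t'_def x'J) (simp add: x'_def)
  qed
  have W': "remainder (\<lambda>n. u (sel J) (t' n)) (\<lambda>k n. x' k (t' n)) (U' (sel J)) J n y = W (v1 (v2 n)) y" for n y
    unfolding W_def remainder_def by (simp add: t'_def x'_def U'_def)
  have peak: "eventually (\<lambda>n. \<forall>y. norm (remainder (\<lambda>n. u (sel J) (t' n)) (\<lambda>k n. x' k (t' n)) (U' (sel J)) J n y)
        \<le> norm (U' (sel J) J 0) + e) sequentially" if e: "0 < e" for e
  proof -
    \<comment> \<open>The old profiles are far away, so the value at the near-maximum converges to
      the new profile at 0; with the error 2 E this bounds the supremum.\<close>
    have "(\<lambda>n. remainder (\<lambda>n. u (sel J) (t' n)) (\<lambda>k n. x' k (t' n)) (U' (sel J)) J n (x' J (t' n) + 0)) \<longlonglongrightarrow> U' (sel J) J 0"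
      by (rule remainder_at_new[where y = 0 and u = "\<lambda>n. u (sel J) (t' n)" and z = "\<lambda>n. x' J (t' n)", OF _ newconv])
         (use newdiv selected_limit(4)[OF S'] in auto)
    then have "(\<lambda>n. norm (W (v1 (v2 n)) (z (v2 n))) + 2 * E (v2 n)) \<longlonglongrightarrow> norm (U' (sel J) J 0) + 2 * 0"
      unfolding W' E_def
      by (intro tendsto_add tendsto_norm tendsto_mult_left LIMSEQ_subseq_LIMSEQ[OF LIMSEQ_Suc[OF lim_1_over_n] v2, unfolded o_def])
         (simp add: t'_def x'J)
    then have "eventually (\<lambda>n. norm (W (v1 (v2 n)) (z (v2 n))) + 2 * E (v2 n) < norm (U' (sel J) J 0) + e) sequentially"
      using e by (intro order_tendstoD) auto
    then show ?thesis unfolding W'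
    proof eventually_elim
      case (elim n)
      then show ?case using z2[of "v2 n"] by (meson less_imp_le order_trans)
    qed
  qed
  have "selected (Suc J) t' x' U'"
    using S' newconv newdiv peak unfolding selected_def less_Suc_eq by blast
  then show ?thesis using v12 agree unfolding t'_def by blast
qed

text \<open>Dependent choice gives nested subsequences that never alter earlier centres or profiles;
  the diagonal s n = t n n is eventually a reindexing of every stage.\<close>

theorem selection:
  obtains s x U where "strict_mono (s :: nat \<Rightarrow> nat)" "\<And>J. selected J s x U"
proof -
  define P where "P J a = (case a of (t, x, U) \<Rightarrow> strict_mono t \<and> selected J t x U)" for J and a :: "(nat \<Rightarrow> nat) \<times> (nat \<Rightarrow> nat \<Rightarrow> 'a) \<times> (nat \<Rightarrow> nat \<Rightarrow> 'a \<Rightarrow> complex)"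
  define R where "R J a b = (case a of (t, x, U) \<Rightarrow> case b of (t', x', U') \<Rightarrow>
      (\<exists>v. strict_mono v \<and> t' = t \<circ> v) \<and> (\<forall>j<J. x' j = x j \<and> (\<forall>i. U' i j = U i j)))"
    for J and a b :: "(nat \<Rightarrow> nat) \<times> (nat \<Rightarrow> nat \<Rightarrow> 'a) \<times> (nat \<Rightarrow> nat \<Rightarrow> 'a \<Rightarrow> complex)"
  have "\<exists>a. \<forall>J. P J (a J) \<and> R J (a J) (a (Suc J))"
  proof (rule dependent_nat_choice)
    show "\<exists>a. P 0 a" by (rule exI[of _ "(id, undefined, undefined)"]) (simp add: P_def selected_def strict_mono_def)
  next
    fix a J assume "P J a"
    then obtain t x U where a: "a = (t, x, U)" "strict_mono t" "selected J t x U" by (auto simp: P_def)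
    from select_step[OF a(3,2)] obtain v x' U' where
      "strict_mono v" "selected (Suc J) (t \<circ> v) x' U'" "\<forall>j<J. x' j = x j \<and> (\<forall>i. U' i j = U i j)" by blast
    then show "\<exists>b. P (Suc J) b \<and> R J a b"
      using a by (intro exI[of _ "(t \<circ> v, x', U')"]) (auto simp: P_def R_def intro: strict_mono_o)
  qed
  then obtain a where a: "\<And>J. P J (a J)" "\<And>J. R J (a J) (a (Suc J))" by blast
  define t where "t J = fst (a J)" for J
  define X where "X J = fst (snd (a J))" for J
  define V where "V J = snd (snd (a J))" for J
  have tJ: "strict_mono (t J)" and SJ: "selected J (t J) (X J) (V J)" for J
    using a(1)[of J] by (auto simp: P_def t_def X_def V_def split: prod.splits)
  have "\<exists>v. strict_mono v \<and> t (Suc J) = t J \<circ> v" and agr: "\<forall>j<J. X (Suc J) j = X J j \<and> (\<forall>i. V (Suc J) i j = V J i j)" for J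
    using a(2)[of J] by (auto simp: R_def t_def X_def V_def split: prod.splits)
  then obtain v where v: "\<And>J. strict_mono (v J)" "\<And>J. t (Suc J) = t J \<circ> v J" by metis
  define s where "s n = t n n" for n
  define x where "x j = X (Suc j) j" for j
  define U where "U i j = V (Suc j) i j" for i j
  have agree: "X J j = x j \<and> V J i j = U i j" if "j < J" for J i j
  proof -
    have "Suc j \<le> J" using that by simp
    then show ?thesis
    proof (induction J rule: dec_induct)
      case base then show ?case by (simp add: x_def U_def)
    next
      case (step J) then show ?case using agr[of J] by auto
    qed
  qed
  have "s n < s (Suc n)" for n
  proof -
    have "n < v n (Suc n)" using seq_suble[OF v(1), of "Suc n" n] by simp
    then show ?thesis using strict_monoD[OF tJ[of n]] by (simp add: s_def v(2))
  qed
  then have s: "strict_mono s" by (simp add: strict_mono_Suc_iff)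
  have "selected J s x U" for J
  proof -
    have "\<exists>w. strict_mono w \<and> t n = t J \<circ> w" if "J \<le> n" for n
      using that
    proof (induction n rule: dec_induct)
      case base
      show ?case by (intro exI[of _ id]) (simp add: strict_mono_def)
    next
      case (step n)
      then obtain w where "strict_mono w" "t n = t J \<circ> w" by blast
      then show ?case using v(1)[of n] v(2)[of n]
        by (intro exI[of _ "w \<circ> v n"] conjI strict_mono_o) (simp_all add: comp_assoc)
    qed
    then obtain w where w: "\<And>n. J \<le> n \<Longrightarrow> strict_mono (w n) \<and> t n = t J \<circ> w n" by metis
    have "filterlim (\<lambda>n. w n n) at_top sequentially"
    proof (rule filterlim_at_top_mono[OF filterlim_ident])
      show "eventually (\<lambda>n. n \<le> w n n) sequentially"
        using eventually_ge_at_top[of J] by eventually_elim (use w seq_suble in blast)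
    qed
    moreover have "eventually (\<lambda>n. s n = t J (w n n)) sequentially"
      using eventually_ge_at_top[of J]
    proof eventually_elim
      case (elim n)
      then have "t n = t J \<circ> w n" using w by blast
      then have "t n n = (t J \<circ> w n) n" by (rule fun_cong)
      then show ?case by (simp only: s_def comp_apply)
    qed
    ultimately have "selected J s (X J) (V J)" by (rule selected_reindex[OF SJ])
    then show ?thesis using selected_cong[of J "X J" x "V J" U s] agree by simp
  qed
  with s that show ?thesis by blast
qed

text \<open>Decoupling in L^(Q i) bounds the total mass of the profiles by C i, so their values at 0
  tend to 0. At a late stage treating member i the remainder is thus uniformly small, and small in
  L^q by interpolation; decoupling in L^q shows that later stages do not increase it, up to
  o(1).\<close>

lemma remainder_vanishes:
  assumes S: "\<And>J. selected J s x U" and qi: "Q i < q" and e: "0 < e"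
  shows "\<exists>J0. \<forall>J\<ge>J0. eventually (\<lambda>n. Ip q lborel (remainder (\<lambda>n. u i (s n)) (\<lambda>k n. x k (s n)) (U i) J n) \<le> e) sequentially"
proof -
  have q: "Q i \<le> q" "Q i < q" using qi by auto
  define w where "w J n = remainder (\<lambda>n. u i (s n)) (\<lambda>k n. x k (s n)) (U i) J n" for J n
  have ULi: "U i j \<in> Lp (Q i) lborel" and U0: "(U i j \<longlongrightarrow> 0) at_infinity"
    and Ulip: "\<And>y y'. norm (U i j y - U i j y') \<le> L i * norm (y - y')" and UB: "\<And>y. norm (U i j y) \<le> B i" for j
    using selected_limit[OF S[of "Suc j"], of j i] by auto
  have q0: "0 < q" using Q[of i] q by linarith
  have dec: "(\<lambda>n. Ip r lborel (u i (s n)) - (\<Sum>j<J. Ip r lborel (U i j)) - Ip r lborel (w J n)) \<longlonglongrightarrow> 0"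
    if r: "0 < r" and uLr: "\<And>n. u i n \<in> Lp r lborel" and uI: "\<And>n. Ip r lborel (u i n) \<le> K" and ULr: "\<And>j. U i j \<in> Lp r lborel"
    for r K J unfolding w_def
  proof (rule decoupling[OF r])
    show "(\<lambda>n. u i (s n) (x j (s n) + y)) \<longlonglongrightarrow> U i j y" if "j < J" for j y
      using S[of J] that by (simp add: selected_def)
    show "eventually (\<lambda>n. Ip r lborel (u i (s n)) \<le> K) sequentially" using uI by simp
  qed (use uLr ULr U0 selected_diverge[OF S] in auto)
  have dec1: "(\<lambda>n. Ip (Q i) lborel (u i (s n)) - (\<Sum>j<J. Ip (Q i) lborel (U i j)) - Ip (Q i) lborel (w J n)) \<longlonglongrightarrow> 0" for J
    by (rule dec[OF Q uL uC ULi])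
  have uLq: "u i n \<in> Lp q lborel" "Ip q lborel (u i n) \<le> B i powr (q - Q i) * C i" for n
  proof -
    show "u i n \<in> Lp q lborel" by (rule Ip_interpolate(1)[OF uL uB Q q(1)])
    have "Ip q lborel (u i n) \<le> B i powr (q - Q i) * Ip (Q i) lborel (u i n)"
      by (rule Ip_interpolate(2)[OF uL uB Q q(1)])
    also have "\<dots> \<le> B i powr (q - Q i) * C i" by (intro mult_left_mono uC) simp
    finally show "Ip q lborel (u i n) \<le> B i powr (q - Q i) * C i" .
  qed
  have ULq: "U i j \<in> Lp q lborel" for j by (rule Ip_interpolate(1)[OF ULi UB Q q(1)])
  have dec2: "(\<lambda>n. Ip q lborel (u i (s n)) - (\<Sum>j<J. Ip q lborel (U i j)) - Ip q lborel (w J n)) \<longlonglongrightarrow> 0" for J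
    by (rule dec[OF q0 uLq ULq])
  have C0: "0 \<le> C i" using uC[of i 0] by (rule order_trans[OF Ip_nonneg])
  have sumC: "(\<Sum>j<J. Ip (Q i) lborel (U i j)) \<le> C i" for J
  proof (rule field_le_epsilon)
    fix d :: real assume "0 < d"
    then have "eventually (\<lambda>n. Ip (Q i) lborel (u i (s n)) - (\<Sum>j<J. Ip (Q i) lborel (U i j)) - Ip (Q i) lborel (w J n) > - d) sequentially"
      by (intro order_tendstoD(1)[OF dec1]) simp
    then obtain n where "Ip (Q i) lborel (u i (s n)) - (\<Sum>j<J. Ip (Q i) lborel (U i j)) - Ip (Q i) lborel (w J n) > - d"
      by (meson eventually_happens' sequentially_bot)
    then show "(\<Sum>j<J. Ip (Q i) lborel (U i j)) \<le> C i + d"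
      using uC[of i "s n"] Ip_nonneg[of "Q i" lborel "w J n"] by linarith
  qed
  have "summable (\<lambda>j. Ip (Q i) lborel (U i j))"
    by (rule summableI_nonneg_bounded[of _ "C i"]) (auto intro: sumC)
  then have Uz: "(\<lambda>j. Ip (Q i) lborel (U i j)) \<longlonglongrightarrow> 0" by (rule summable_LIMSEQ_zero)
  \<comment> \<open>Here 2 b will bound the supremum of the remainder and C i + 1 its L^(Q i)
    integral; b is chosen to make the interpolated bound e / 2.\<close>
  define b where "b = (e / (2 * (C i + 1))) powr (1 / (q - Q i)) / 2"
  have b: "0 < b" "(2 * b) powr (q - Q i) * (C i + 1) = e / 2"
    using e C0 q by (auto simp: b_def powr_powr field_simps)
  \<comment> \<open>The mass forced by a profile of modulus at least b at 0.\<close>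
  define m where "m = (b / 2) powr Q i * (unit_ball_vol DIM('a) * (b / (2 * L i)) ^ DIM('a))"
  have "0 < m" using b L[of i] by (simp add: m_def)
  then have "eventually (\<lambda>j. Ip (Q i) lborel (U i j) < m) sequentially" using Uz by (intro order_tendstoD) auto
  then obtain N where N: "\<And>j. j \<ge> N \<Longrightarrow> Ip (Q i) lborel (U i j) < m" by (auto simp: eventually_sequentially)
  \<comment> \<open>A stage that treats member i and comes no earlier than N, since a pair code is
    at least its second component.\<close>
  define j where "j = prod_encode (i, N)"
  have j: "sel j = i" "N \<le> j" by (auto simp: j_def sel_def le_prod_encode_2)
  have Uj: "norm (U i j 0) < b"
  proof (rule ccontr)
    assume "\<not> norm (U i j 0) < b"
    then have "m \<le> Ip (Q i) lborel (U i j)" unfolding m_def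
      by (intro Ip_ge_Lipschitz[where z = 0, OF ULi _ L Ulip b(1)]) (use Q[of i] in auto)
    then show False using N[OF j(2)] by simp
  qed
  have wL: "w J n \<in> Lp (Q i) lborel" for J n unfolding w_def using Q[of i] by (intro remainder_Lp uL ULi) auto
  have "eventually (\<lambda>n. \<forall>y. norm (w j n y) \<le> norm (U i j 0) + b) sequentially"
  proof -
    have "\<forall>k<Suc j. \<forall>e>0. eventually (\<lambda>n. \<forall>y. norm (remainder (\<lambda>n. u (sel k) (s n)) (\<lambda>k n. x k (s n)) (U (sel k)) k n y)
        \<le> norm (U (sel k) k 0) + e) sequentially"
      using S[of "Suc j"] unfolding selected_def by (elim conjE)
    from this[rule_format, of j b] b(1) show ?thesis unfolding w_def by (simp add: j(1))
  qed
  moreover have "eventually (\<lambda>n. Ip (Q i) lborel (u i (s n)) - (\<Sum>j<j. Ip (Q i) lborel (U i j)) - Ip (Q i) lborel (w j n) > -1) sequentially"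
    by (intro order_tendstoD(1)[OF dec1]) simp
  ultimately have base: "eventually (\<lambda>n. Ip q lborel (w j n) \<le> e / 2) sequentially"
  proof eventually_elim
    case (elim n)
    have wb: "norm (w j n y) \<le> 2 * b" for y using elim(1)[rule_format, of y] Uj by linarith
    have "Ip q lborel (w j n) \<le> (2 * b) powr (q - Q i) * Ip (Q i) lborel (w j n)"
      by (rule Ip_interpolate(2)[OF wL _ Q q(1)]) (use wb in auto)
    also have "\<dots> \<le> (2 * b) powr (q - Q i) * (C i + 1)"
    proof (intro mult_left_mono)
      have "0 \<le> (\<Sum>j<j. Ip (Q i) lborel (U i j))" by (intro sum_nonneg) simp
      then show "Ip (Q i) lborel (w j n) \<le> C i + 1" using elim(2) uC[of i "s n"] by linarith
    qed simp
    finally show ?case using b(2) by simp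
  qed
  have "eventually (\<lambda>n. Ip q lborel (w J n) \<le> e) sequentially" if J: "j \<le> J" for J
  proof -
    \<comment> \<open>Stage J subtracts at least the profiles of stage j, so its remainder exceeds
      the earlier one by at most two decoupling errors e / 4.\<close>
    have le: "(\<Sum>j<j. Ip q lborel (U i j)) \<le> (\<Sum>j<J. Ip q lborel (U i j))" using J by (intro sum_mono2) auto
    have "eventually (\<lambda>n. Ip q lborel (u i (s n)) - (\<Sum>j<j. Ip q lborel (U i j)) - Ip q lborel (w j n) < e / 4) sequentially"
      using e by (intro order_tendstoD(2)[OF dec2]) simp
    moreover have "eventually (\<lambda>n. Ip q lborel (u i (s n)) - (\<Sum>j<J. Ip q lborel (U i j)) - Ip q lborel (w J n) > - (e / 4)) sequentially"
      using e by (intro order_tendstoD(1)[OF dec2]) simp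
    ultimately show ?thesis using base by eventually_elim (use le in linarith)
  qed
  then show ?thesis unfolding w_def by blast
qed

end

section \<open>The surface measure of the sphere\<close>

text \<open>Chord of the convex function (1 + h)^n between h = 0 and h = 1. With Bernoulli's
  inequality for the inner ball it bounds the shell volume linearly in h.\<close>

lemma power_one_plus_le:
  fixes h :: real
  assumes "0 \<le> h" "h \<le> 1"
  shows "(1 + h) ^ n \<le> 1 + (2 ^ n - 1) * h"
proof (induction n)
  case (Suc n)
  have "(1 + h) ^ Suc n \<le> (1 + h) * (1 + (2 ^ n - 1) * h)"
    using Suc assms by (simp add: mult_left_mono)
  also have "\<dots> = 1 + 2 ^ n * h + (2 ^ n - 1) * (h * h)" by (simp add: algebra_simps)
  also have "\<dots> \<le> 1 + 2 ^ n * h + (2 ^ n - 1) * h"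
    using assms by (intro add_left_mono mult_left_mono mult_left_le) auto
  also have "\<dots> = 1 + (2 ^ Suc n - 1) * h" by (simp add: algebra_simps)
  finally show ?case .
qed simp

text \<open>The balls of radius \<open>h\<close> around the points are disjoint and lie in the shell between the radii
  \<open>1 - h\<close> and \<open>1 + h\<close>.\<close>

lemma card_separated_sphere:
  fixes P :: "'a::euclidean_space set"
  assumes P: "finite P" "P \<subseteq> sphere 0 1" and sep: "\<And>p q. p \<in> P \<Longrightarrow> q \<in> P \<Longrightarrow> p \<noteq> q \<Longrightarrow> 2 * h \<le> dist p q"
    and h: "0 < h" "h \<le> 1"
  shows "real (card P) * h ^ (DIM('a) - 1) \<le> 2 ^ DIM('a) + real DIM('a)"
proof -
  define D where "D = DIM('a)"
  define v where "v = unit_ball_vol D"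
  have v: "0 < v" by (simp add: v_def)
  have D: "D = Suc (D - 1)" using DIM_positive[where 'a='a] by (simp add: D_def)
  have vol: "emeasure lborel (ball c r) = ennreal (v * r ^ D)" if "0 \<le> r" for c :: 'a and r
    using emeasure_ball[OF that, of c] by (simp add: v_def D_def)
  have disj: "disjoint_family_on (\<lambda>p. ball p h) P"
  proof (unfold disjoint_family_on_def, intro ballI impI)
    fix p q assume "p \<in> P" "q \<in> P" "p \<noteq> q"
    from sep[OF this] show "ball p h \<inter> ball q h = {}"
      using dist_triangle_half_l[of p _ "2 * h" q] by (force simp: dist_commute)
  qed
  have "(\<Sum>p\<in>P. emeasure lborel (ball p h)) = emeasure lborel (\<Union>p\<in>P. ball p h)"
    using disj P by (intro sum_emeasure) auto
  moreover have "(\<Sum>p\<in>P. emeasure lborel (ball p h)) = ennreal (real (card P) * (v * h ^ D))"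
    using h v by (simp add: vol ennreal_mult' flip: ennreal_of_nat_eq_real_of_nat)
  ultimately have U: "emeasure lborel (\<Union>p\<in>P. ball p h) = ennreal (real (card P) * (v * h ^ D))" by simp
  have "(\<Union>p\<in>P. ball p h) \<inter> ball 0 (1 - h) = {}"
  proof -
    have "False" if "p \<in> P" "dist p x < h" "norm x < 1 - h" for p x
    proof -
      have "norm p = 1" using that P by auto
      moreover have "norm p \<le> norm (p - x) + norm x" by (metis diff_add_cancel norm_triangle_ineq)
      ultimately show False using that by (simp add: dist_norm)
    qed
    then show ?thesis by auto
  qed
  then have "emeasure lborel ((\<Union>p\<in>P. ball p h) \<union> ball 0 (1 - h)) = emeasure lborel (\<Union>p\<in>P. ball p h) + emeasure lborel (ball (0::'a) (1 - h))"
    by (intro plus_emeasure[symmetric]) (auto intro: borel_open)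
  moreover have "emeasure lborel ((\<Union>p\<in>P. ball p h) \<union> ball 0 (1 - h)) \<le> emeasure lborel (ball (0::'a) (1 + h))"
  proof (rule emeasure_mono)
    have "norm x < 1 + h" if "p \<in> P" "dist p x < h" for p x
    proof -
      have "norm p = 1" using that P by auto
      moreover have "norm x \<le> norm (x - p) + norm p" by (metis diff_add_cancel norm_triangle_ineq)
      ultimately show ?thesis using that by (simp add: dist_norm norm_minus_commute)
    qed
    then show "(\<Union>p\<in>P. ball p h) \<union> ball 0 (1 - h) \<subseteq> ball 0 (1 + h)" using h by auto
  qed simp
  ultimately have "ennreal (real (card P) * (v * h ^ D)) + ennreal (v * (1 - h) ^ D) \<le> ennreal (v * (1 + h) ^ D)"
    using U h by (simp add: vol)
  moreover have nn: "0 \<le> real (card P) * (v * h ^ D)" "0 \<le> v * (1 - h) ^ D" "0 \<le> v * (1 + h) ^ D" using h v by auto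
  ultimately have "ennreal (real (card P) * (v * h ^ D) + v * (1 - h) ^ D) \<le> ennreal (v * (1 + h) ^ D)"
    by (simp only: ennreal_plus)
  then have "real (card P) * (v * h ^ D) + v * (1 - h) ^ D \<le> v * (1 + h) ^ D"
    using nn by (simp only: ennreal_le_iff)
  then have "v * (real (card P) * h ^ D + (1 - h) ^ D) \<le> v * (1 + h) ^ D" by (simp add: algebra_simps)
  then have "real (card P) * h ^ D + (1 - h) ^ D \<le> (1 + h) ^ D" using v by simp
  \<comment> \<open>In units of the unit ball the shell has volume at most (2^D + D) h; one factor h
    then cancels and leaves the power D - 1.\<close>
  moreover have "1 + real D * (- h) \<le> (1 + (- h)) ^ D" by (rule Bernoulli_inequality) (use h in simp)
  moreover have "(1 + h) ^ D \<le> 1 + (2 ^ D - 1) * h" using h by (intro power_one_plus_le) auto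
  ultimately have "real (card P) * h ^ D \<le> (2 ^ D + real D) * h" using h by (simp add: algebra_simps)
  moreover have "h ^ D = h ^ (D - 1) * h" by (subst D) simp
  ultimately have "(real (card P) * h ^ (D - 1)) * h \<le> (2 ^ D + real D) * h" by (simp add: mult.assoc)
  then show ?thesis using h unfolding D_def by simp
qed

text \<open>P is a 2h-separated set of greatest cardinality, which exists by
  \<open>card_separated_sphere\<close>; an uncovered point could be added to it.\<close>

lemma sphere_finite_cover:
  assumes h: "0 < h" "h \<le> 1"
  obtains P :: "'a::euclidean_space set" where "finite P" "sphere 0 1 \<subseteq> (\<Union>p\<in>P. ball p (2 * h))"
    "real (card P) * h ^ (DIM('a) - 1) \<le> 2 ^ DIM('a) + real DIM('a)"
proof -
  define S where "S P \<longleftrightarrow> finite P \<and> P \<subseteq> sphere 0 1 \<and> (\<forall>p\<in>P. \<forall>q\<in>P. p \<noteq> q \<longrightarrow> 2 * h \<le> dist p q)" for P :: "'a set"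
  have bd: "card P < Suc (nat \<lceil>(2 ^ DIM('a) + real DIM('a)) / h ^ (DIM('a) - 1)\<rceil>)" if "S P" for P
  proof -
    have "real (card P) * h ^ (DIM('a) - 1) \<le> 2 ^ DIM('a) + real DIM('a)"
      using that h unfolding S_def by (intro card_separated_sphere) auto
    then have "real (card P) \<le> (2 ^ DIM('a) + real DIM('a)) / h ^ (DIM('a) - 1)" using h by (simp add: field_simps)
    then show ?thesis by linarith
  qed
  have "S {}" by (simp add: S_def)
  from ex_has_greatest_nat[of S "{}" card, OF this] bd
  obtain P where P: "S P" "\<And>P'. S P' \<Longrightarrow> card P' \<le> card P" by (metis less_imp_le)
  have "sphere 0 1 \<subseteq> (\<Union>p\<in>P. ball p (2 * h))"
  proof
    fix x :: 'a assume x: "x \<in> sphere 0 1"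
    show "x \<in> (\<Union>p\<in>P. ball p (2 * h))"
    proof (rule ccontr)
      assume "x \<notin> (\<Union>p\<in>P. ball p (2 * h))"
      then have far: "\<forall>p\<in>P. 2 * h \<le> dist p x" by auto
      then have "x \<notin> P" using h by auto
      moreover have "S (insert x P)" using P(1) far x by (auto simp: S_def dist_commute)
      ultimately show False using P(2)[of "insert x P"] P(1) by (simp add: S_def)
    qed
  qed
  moreover have "real (card P) * h ^ (DIM('a) - 1) \<le> 2 ^ DIM('a) + real DIM('a)"
    using P(1) h unfolding S_def by (intro card_separated_sphere) auto
  ultimately show ?thesis using P(1) that unfolding S_def by blast
qed

text \<open>Covers by balls of radius 2h have d-dimensional weight card P times a multiple of h^d,
  which is bounded independently of h and hence of \<delta>.\<close>

lemma hausdorff_outer_measure_sphere: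
  "hausdorff_outer_measure (DIM('a) - 1) (sphere (0::'a::euclidean_space) 1) < \<infinity>"
proof -
  define d where "d = DIM('a) - 1"
  define v where "v = unit_ball_vol (real d)"
  define K where "K = v * 2 ^ d * (2 ^ DIM('a) + real DIM('a))"
  have v: "0 \<le> v" by (simp add: v_def)
  have "hausdorff_content d \<delta> (sphere (0::'a) 1) \<le> ennreal K" if \<delta>: "0 < \<delta>" for \<delta>
  proof -
    \<comment> \<open>h <= 1 is the range of the packing bound; 4 h <= \<delta> makes the balls
      admissible in the content.\<close>
    define h where "h = min 1 (\<delta> / 4)"
    have h: "0 < h" "h \<le> 1" "4 * h \<le> \<delta>" using \<delta> by (auto simp: h_def)
    obtain P :: "'a set" where P: "finite P" "sphere 0 1 \<subseteq> (\<Union>p\<in>P. ball p (2 * h))"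
      "real (card P) * h ^ d \<le> 2 ^ DIM('a) + real DIM('a)"
      using sphere_finite_cover[OF h(1,2)] unfolding d_def by blast
    obtain e where e: "bij_betw e {..<card P} P"
      using ex_bij_betw_nat_finite[OF P(1)] by (auto simp: atLeast0LessThan)
    define C where "C i = (if i < card P then ball (e i) (2 * h) else {})" for i
    have sub: "sphere 0 1 \<subseteq> (\<Union>i. C i)"
    proof -
      have "(\<Union>p\<in>P. ball p (2 * h)) \<subseteq> (\<Union>i. C i)"
        using e by (force simp: C_def bij_betw_def)
      with P(2) show ?thesis by (rule subset_trans)
    qed
    have bdd: "bounded (C i) \<and> diameter (C i) \<le> \<delta>" for i
      using h \<delta> by (cases "i < card P") (simp_all add: C_def diameter_ball diameter_empty)
    have "hausdorff_content d \<delta> (sphere (0::'a) 1) \<le>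
      (\<Sum>i. if C i = {} then 0 else ennreal (unit_ball_vol (real d) * (diameter (C i) / 2) ^ d))"
      unfolding hausdorff_content_def by (rule INF_lower) (use sub bdd in simp)
    also have "\<dots> = (\<Sum>i<card P. if C i = {} then 0 else ennreal (unit_ball_vol (real d) * (diameter (C i) / 2) ^ d))"
      by (rule suminf_finite) (auto simp: C_def)
    also have "\<dots> \<le> (\<Sum>i<card P. ennreal (v * (2 * h) ^ d))"
      using h by (intro sum_mono) (auto simp: C_def diameter_ball v_def)
    also have "\<dots> = ennreal (real (card P) * (v * (2 * h) ^ d))"
      using h v by (simp add: ennreal_mult' flip: ennreal_of_nat_eq_real_of_nat)
    also have "\<dots> \<le> ennreal K"
    proof (rule ennreal_leI)
      have "real (card P) * (v * (2 * h) ^ d) = v * 2 ^ d * (real (card P) * h ^ d)" by (simp add: power_mult_distrib)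
      also have "\<dots> \<le> K" unfolding K_def using v P(3) by (intro mult_left_mono) auto
      finally show "real (card P) * (v * (2 * h) ^ d) \<le> K" .
    qed
    finally show ?thesis .
  qed
  then have "hausdorff_outer_measure d (sphere (0::'a) 1) \<le> ennreal K"
    unfolding hausdorff_outer_measure_def by (intro SUP_least) auto
  then show ?thesis unfolding d_def by (rule le_less_trans) simp
qed

section \<open>The surface measure as a finite Borel measure, and modulations\<close>

lemma sets_hausdorff_measure [simp, measurable_cong]: "sets (hausdorff_measure d) = sets borel"
  unfolding hausdorff_measure_def using sets.sigma_sets_eq[of borel] by simp

lemma space_hausdorff_measure [simp]: "space (hausdorff_measure d) = UNIV"
  unfolding hausdorff_measure_def by (simp add: space_measure_of)

lemma space_sphere_measure [simp]: "space sphere_measure = sphere 0 1"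
  by (simp add: sphere_measure_def space_restrict_space)

lemma sets_sphere_measure: "sets sphere_measure = sets (restrict_space borel (sphere 0 1))"
  by (simp add: sphere_measure_def sets_restrict_space)

text \<open>Countable additivity of the outer measure is irrelevant here: without it \<^const>\<open>measure_of\<close>
  would be \<open>0\<close>.\<close>

lemma emeasure_sphere_measure_finite: "emeasure sphere_measure (sphere (0::'a::euclidean_space) 1) < \<infinity>"
proof -
  have "emeasure (sphere_measure :: 'a measure) (sphere 0 1) = emeasure (hausdorff_measure (DIM('a) - 1)) (sphere (0::'a) 1)"
    unfolding sphere_measure_def by (rule emeasure_restrict_space) auto
  also have "\<dots> \<le> hausdorff_outer_measure (DIM('a) - 1) (sphere (0::'a) 1)"
    unfolding hausdorff_measure_def emeasure_measure_of_conv by simp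
  finally show ?thesis using hausdorff_outer_measure_sphere[where 'a='a] by (rule le_less_trans)
qed

lemma finite_measure_sphere: "finite_measure (sphere_measure :: 'a::euclidean_space measure)"
proof (rule finite_measureI)
  show "emeasure (sphere_measure :: 'a measure) (space sphere_measure) \<noteq> \<infinity>"
    unfolding space_sphere_measure by (rule less_imp_neq[OF emeasure_sphere_measure_finite])
qed

lemma borel_measurable_sphere [measurable (raw)]:
  "f \<in> borel_measurable borel \<Longrightarrow> f \<in> borel_measurable sphere_measure"
  unfolding measurable_cong_sets[OF sets_sphere_measure refl] by (rule measurable_restrict_space1)

lemma modulate_measurable [measurable (raw)]:
  "f \<in> borel_measurable sphere_measure \<Longrightarrow> modulate x f \<in> borel_measurable sphere_measure"
  unfolding modulate_def
  by (rule borel_measurable_times[OF borel_measurable_sphere]) (intro borel_measurable_continuous_onI continuous_intros)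

lemma norm_modulate [simp]: "norm (modulate x f \<omega>) = norm (f \<omega>)"
  by (simp add: modulate_def norm_mult)

lemma modulate_Lp: "f \<in> Lp p sphere_measure \<Longrightarrow> modulate x f \<in> Lp p sphere_measure"
  by (auto simp: Lp_def modulate_measurable)

lemma lpn_modulate [simp]: "lpn p M (modulate x f) = lpn p M f"
  by (rule lpn_cong) simp

lemma modulate_integrable: "integrable sphere_measure f \<Longrightarrow> integrable sphere_measure (modulate x f)"
  by (rule Bochner_Integration.integrable_bound) (auto intro: modulate_measurable)

section \<open>The extension operator\<close>

lemma extension_op_eq: "extension_op f x = (\<integral>\<omega>. modulate x f \<omega> \<partial>sphere_measure)"
  by (simp add: extension_op_def modulate_def)

lemma norm_extension_op_le:
  assumes "integrable sphere_measure f"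
  shows "norm (extension_op f x) \<le> (\<integral>\<omega>. norm (f \<omega>) \<partial>sphere_measure)"
  unfolding extension_op_eq using integral_norm_bound[of sphere_measure "modulate x f"] by simp

lemma extension_op_diff:
  assumes "integrable sphere_measure f" "integrable sphere_measure g"
  shows "extension_op (\<lambda>\<omega>. f \<omega> - g \<omega>) x = extension_op f x - extension_op g x"
  using Bochner_Integration.integral_diff[OF modulate_integrable[OF assms(1), of x] modulate_integrable[OF assms(2), of x]]
  by (simp add: extension_op_eq modulate_def algebra_simps)

lemma extension_op_scale: "extension_op (\<lambda>\<omega>. c * f \<omega>) x = c * extension_op f x"
proof -
  have "modulate x (\<lambda>\<omega>. c * f \<omega>) = (\<lambda>\<omega>. c * modulate x f \<omega>)" by (auto simp: modulate_def)
  then show ?thesis by (simp add: extension_op_eq)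
qed

lemma extension_op_sum:
  assumes "\<And>i. i \<in> A \<Longrightarrow> integrable sphere_measure (f i)"
  shows "extension_op (\<lambda>\<omega>. \<Sum>i\<in>A. f i \<omega>) x = (\<Sum>i\<in>A. extension_op (f i) x)"
proof -
  have "modulate x (\<lambda>\<omega>. \<Sum>i\<in>A. f i \<omega>) = (\<lambda>\<omega>. \<Sum>i\<in>A. modulate x (f i) \<omega>)"
    by (auto simp: modulate_def sum_distrib_left)
  then show ?thesis using assms
    by (simp add: extension_op_eq modulate_integrable)
qed

lemma modulate_modulate: "modulate x (modulate y f) = modulate (x + y) f"
  by (auto simp: modulate_def inner_add_left distrib_left exp_add mult.assoc)

lemma extension_op_modulate: "extension_op (modulate y f) x = extension_op f (x + y)"
  by (simp add: extension_op_eq modulate_modulate)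

lemma norm_cis_diff_le: "norm (cis a - cis b) \<le> \<bar>a - b\<bar>"
proof -
  have "cis a - cis b = cis b * (exp (\<i> * of_real (a - b)) - 1)"
    by (simp add: cis_conv_exp algebra_simps flip: exp_add)
  then have "norm (cis a - cis b) = 2 * \<bar>sin ((a - b) / 2)\<bar>"
    by (simp only: norm_mult norm_cis dist_exp_i_1)
  then show ?thesis using abs_sin_x_le_abs_x[of "(a - b) / 2"] by simp
qed

text \<open>On the unit sphere |e^(i x.w) - e^(i y.w)| <= |(x - y).w| <= |x - y|. The constant is an
  L^1 norm, hence uniform over bounded sequences in L^p.\<close>

lemma extension_op_Lipschitz:
  assumes f: "integrable sphere_measure f"
  shows "norm (extension_op f x - extension_op f y) \<le> (\<integral>\<omega>. norm (f \<omega>) \<partial>sphere_measure) * norm (x - y)"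
proof -
  have "extension_op f x - extension_op f y = (\<integral>\<omega>. modulate x f \<omega> - modulate y f \<omega> \<partial>sphere_measure)"
    unfolding extension_op_eq by (intro Bochner_Integration.integral_diff[symmetric] modulate_integrable f)
  also have "norm \<dots> \<le> (\<integral>\<omega>. norm (modulate x f \<omega> - modulate y f \<omega>) \<partial>sphere_measure)" by (rule integral_norm_bound)
  also have "\<dots> \<le> (\<integral>\<omega>. norm (f \<omega>) * norm (x - y) \<partial>sphere_measure)"
  proof (rule integral_mono)
    fix \<omega> :: 'a assume "\<omega> \<in> space sphere_measure"
    then have w: "norm \<omega> = 1" by simp
    have "modulate x f \<omega> - modulate y f \<omega> = (cis (x \<bullet> \<omega>) - cis (y \<bullet> \<omega>)) * f \<omega>"
      by (simp add: modulate_def cis_conv_exp algebra_simps)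
    moreover have "norm (cis (x \<bullet> \<omega>) - cis (y \<bullet> \<omega>)) \<le> \<bar>x \<bullet> \<omega> - y \<bullet> \<omega>\<bar>"
      by (rule norm_cis_diff_le)
    moreover have "\<bar>x \<bullet> \<omega> - y \<bullet> \<omega>\<bar> \<le> norm (x - y)"
      using Cauchy_Schwarz_ineq2[of "x - y" \<omega>] w by (simp add: inner_diff_left)
    ultimately show "norm (modulate x f \<omega> - modulate y f \<omega>) \<le> norm (f \<omega>) * norm (x - y)"
      by (simp add: norm_mult mult.commute[of "norm (f \<omega>)"] mult_right_mono)
  qed (intro integrable_norm Bochner_Integration.integrable_diff modulate_integrable f integrable_mult_left)+
  also have "\<dots> = (\<integral>\<omega>. norm (f \<omega>) \<partial>sphere_measure) * norm (x - y)" by simp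
  finally show ?thesis .
qed

lemma ennreal_powr_ennreal: "0 \<le> c \<Longrightarrow> ennreal_powr (ennreal c) a = ennreal (c powr a)"
  by (simp add: ennreal_powr_def)

lemma Lnorm_eq_lpn:
  assumes p: "0 < p" and f: "f \<in> Lp p M"
  shows "Lnorm (ennreal p) M f = ennreal (lpn p M f)"
proof -
  have "(\<integral>\<^sup>+x. ennreal (norm (f x) powr p) \<partial>M) = ennreal (Ip p M f)"
    unfolding Ip_def by (rule nn_integral_eq_integral[OF Lp_integrable[OF f]]) auto
  then show ?thesis using p by (simp add: Lnorm_def lpn_def ennreal_powr_ennreal)
qed

lemma Lspace_eq_Lp:
  assumes p: "0 < p"
  shows "Lspace (ennreal p) M = Lp p M"
proof (intro equalityI subsetI)
  fix f assume f: "f \<in> Lspace (ennreal p) M"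
  then have [measurable]: "f \<in> borel_measurable M" by (simp add: Lspace_def)
  have "(\<integral>\<^sup>+x. ennreal (norm (f x) powr p) \<partial>M) \<noteq> \<infinity>"
  proof
    assume "(\<integral>\<^sup>+x. ennreal (norm (f x) powr p) \<partial>M) = \<infinity>"
    then have "Lnorm (ennreal p) M f = \<infinity>" using p by (simp add: Lnorm_def ennreal_powr_def)
    then show False using f by (simp add: Lspace_def)
  qed
  then have "integrable M (\<lambda>x. norm (f x) powr p)"
    by (intro integrableI_bounded) (auto simp: less_top)
  then show "f \<in> Lp p M" by (intro LpI) auto
next
  fix f assume f: "f \<in> Lp p M"
  then show "f \<in> Lspace (ennreal p) M"
    using Lnorm_eq_lpn[OF p f] by (simp add: Lspace_def Lp_measurable)
qed

section \<open>Trigonometric polynomials\<close>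

text \<open>The characters live on the whole space, so they are smooth without a choice of extension
  and admissible in \<open>extension_norm\<close>; their span is an algebra, as Stone-Weierstrass
  requires.\<close>

inductive_set trig :: "('a::euclidean_space \<Rightarrow> complex) set" where
  char: "(\<lambda>\<omega>. c * exp (\<i> * complex_of_real (y \<bullet> \<omega>))) \<in> trig"
| add: "f \<in> trig \<Longrightarrow> g \<in> trig \<Longrightarrow> (\<lambda>\<omega>. f \<omega> + g \<omega>) \<in> trig"

lemma trig_scale: "f \<in> trig \<Longrightarrow> (\<lambda>\<omega>. a * f \<omega>) \<in> trig"
proof (induction rule: trig.induct)
  case (char c y)
  then show ?case using trig.char[of "a * c" y] by (simp add: mult.assoc)
next
  case (add f g)
  then show ?case using trig.add[OF add.IH] by (simp add: distrib_left)
qed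

lemma trig_mult_char: "g \<in> trig \<Longrightarrow> (\<lambda>\<omega>. (c * exp (\<i> * complex_of_real (y \<bullet> \<omega>))) * g \<omega>) \<in> trig"
proof (induction rule: trig.induct)
  case (char c' y')
  have "(c * exp (\<i> * complex_of_real (y \<bullet> \<omega>))) * (c' * exp (\<i> * complex_of_real (y' \<bullet> \<omega>)))
    = c * c' * exp (\<i> * complex_of_real ((y + y') \<bullet> \<omega>))" for \<omega>
    by (simp add: inner_add_left distrib_left exp_add)
  then show ?case by (simp only: trig.char)
next
  case (add f g)
  then show ?case using trig.add[OF add.IH] by (simp add: distrib_left)
qed

lemma trig_mult: "f \<in> trig \<Longrightarrow> g \<in> trig \<Longrightarrow> (\<lambda>\<omega>. f \<omega> * g \<omega>) \<in> trig"
proof (induction rule: trig.induct)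
  case (char c y)
  then show ?case by (rule trig_mult_char)
next
  case (add f h)
  then show ?case using trig.add[OF add.IH(1)[OF add.prems] add.IH(2)[OF add.prems]] by (simp add: distrib_right)
qed

text \<open>Directional derivatives stay in \<open>trig\<close>, so this single step gives C^k for
  all k by induction.\<close>

lemma trig_has_derivative:
  "f \<in> trig \<Longrightarrow> \<exists>f'. (\<forall>x. (f has_derivative f' x) (at x)) \<and> (\<forall>v. (\<lambda>x. f' x v) \<in> trig)"
proof (induction rule: trig.induct)
  case (char c y)
  define f' where "f' x v = (c * \<i> * complex_of_real (y \<bullet> v)) * exp (\<i> * complex_of_real (y \<bullet> x))" for x v
  have "((\<lambda>\<omega>. c * exp (\<i> * complex_of_real (y \<bullet> \<omega>))) has_derivative f' x) (at x)" for x
  proof -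
    have 1: "((\<lambda>\<omega>. \<i> * complex_of_real (y \<bullet> \<omega>)) has_derivative (\<lambda>v. \<i> * complex_of_real (y \<bullet> v))) (at x)"
      by (intro bounded_linear_imp_has_derivative bounded_linear_compose[OF bounded_linear_mult_right]
          bounded_linear_compose[OF bounded_linear_of_real] bounded_linear_inner_right)
    have 2: "(exp has_derivative (\<lambda>h. exp (\<i> * complex_of_real (y \<bullet> x)) * h)) (at (\<i> * complex_of_real (y \<bullet> x)))"
      using DERIV_exp by (simp add: has_field_derivative_def)
    from bounded_linear.has_derivative[OF bounded_linear_mult_right has_derivative_compose[OF 1 2], of c]
    show ?thesis unfolding f'_def by (simp add: mult_ac)
  qed
  moreover have "(\<lambda>x. f' x v) \<in> trig" for v unfolding f'_def by (rule trig.char)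
  ultimately show ?case by blast
next
  case (add f g)
  then obtain f' g' where "\<forall>x. (f has_derivative f' x) (at x)" "\<forall>v. (\<lambda>x. f' x v) \<in> trig"
    "\<forall>x. (g has_derivative g' x) (at x)" "\<forall>v. (\<lambda>x. g' x v) \<in> trig" by blast
  then show ?case
    by (intro exI[of _ "\<lambda>x v. f' x v + g' x v"]) (auto intro!: has_derivative_add trig.add)
qed

lemma trig_Ck: "f \<in> trig \<Longrightarrow> Ck_on k f UNIV"
proof (induction k arbitrary: f)
  case 0
  from trig_has_derivative[OF 0] obtain f' where "\<forall>x. (f has_derivative f' x) (at x)" by blast
  then have "\<forall>x. isCont f x" using has_derivative_continuous by blast
  then show ?case by (simp add: continuous_at_imp_continuous_on)
next
  case (Suc k)
  from trig_has_derivative[OF Suc.prems] obtain f'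
    where f': "\<And>x. (f has_derivative f' x) (at x)" "\<And>v. (\<lambda>x. f' x v) \<in> trig" by blast
  then have "frechet_derivative f (at x) = f' x" for x using frechet_derivative_at by metis
  then show ?case using f' Suc.IH by (auto simp: differentiable_def)
qed

lemma trig_smooth: "f \<in> trig \<Longrightarrow> smooth_on_sphere f"
  unfolding smooth_on_sphere_def by (intro exI[of _ UNIV] exI[of _ f]) (auto simp: trig_Ck)

lemma trig_measurable: "f \<in> trig \<Longrightarrow> f \<in> borel_measurable borel"
  using trig_Ck[of f 0] by (simp add: borel_measurable_continuous_onI)

lemma trig_bounded: "f \<in> trig \<Longrightarrow> \<exists>B. \<forall>x. norm (f x) \<le> B"
proof (induction rule: trig.induct)
  case (char c y)
  show ?case by (intro exI[of _ "norm c"]) (simp add: norm_mult)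
next
  case (add f g)
  then obtain A B where "\<forall>x. norm (f x) \<le> A" "\<forall>x. norm (g x) \<le> B" by blast
  then have "norm (f x + g x) \<le> A + B" for x by (intro norm_triangle_le add_mono) auto
  then show ?case by blast
qed

lemma trig_Lp: "f \<in> trig \<Longrightarrow> 0 \<le> p \<Longrightarrow> f \<in> Lp p sphere_measure"
proof -
  assume f: "f \<in> trig" and p: "0 \<le> p"
  obtain B where "\<forall>x. norm (f x) \<le> B" using trig_bounded[OF f] by blast
  then show "f \<in> Lp p sphere_measure"
    by (intro finite_measure.Lp_bounded[where B = B, OF finite_measure_sphere borel_measurable_sphere[OF trig_measurable[OF f]] _ p]) simp
qed

lemma trig_cos_sin:
  "(\<lambda>\<omega>. complex_of_real (cos (z \<bullet> \<omega>))) \<in> trig" "(\<lambda>\<omega>. complex_of_real (sin (z \<bullet> \<omega>))) \<in> trig"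
proof -
  have "complex_of_real (cos t) = 1/2 * exp (\<i> * complex_of_real t) + 1/2 * exp (\<i> * complex_of_real (- t))" for t
    by (simp add: cos_exp_eq flip: cos_of_real)
  then have "(\<lambda>\<omega>. complex_of_real (cos (z \<bullet> \<omega>))) = (\<lambda>\<omega>. 1/2 * exp (\<i> * complex_of_real (z \<bullet> \<omega>)) + 1/2 * exp (\<i> * complex_of_real ((- z) \<bullet> \<omega>)))"
    by (simp add: fun_eq_iff)
  then show "(\<lambda>\<omega>. complex_of_real (cos (z \<bullet> \<omega>))) \<in> trig" by (simp only:) (intro trig.intros)
  have "complex_of_real (sin t) = 1/(2*\<i>) * exp (\<i> * complex_of_real t) + (- 1/(2*\<i>)) * exp (\<i> * complex_of_real (- t))" for t
    by (simp add: sin_exp_eq diff_divide_distrib right_diff_distrib flip: sin_of_real)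
  then have "(\<lambda>\<omega>. complex_of_real (sin (z \<bullet> \<omega>))) = (\<lambda>\<omega>. 1/(2*\<i>) * exp (\<i> * complex_of_real (z \<bullet> \<omega>)) + (- 1/(2*\<i>)) * exp (\<i> * complex_of_real ((- z) \<bullet> \<omega>)))"
    by (simp add: fun_eq_iff)
  then show "(\<lambda>\<omega>. complex_of_real (sin (z \<bullet> \<omega>))) \<in> trig" by (simp only:) (intro trig.intros)
qed

text \<open>Stone-Weierstrass for the real algebra of functions whose complexification lies in
  \<open>trig\<close>.\<close>

lemma trig_uniform_approx:
  fixes g :: "'a::euclidean_space \<Rightarrow> real"
  assumes g: "continuous_on (sphere 0 1) g" and e: "0 < e"
  shows "\<exists>t\<in>trig. \<forall>x\<in>sphere 0 1. norm (complex_of_real (g x) - t x) < e"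
proof -
  define R where "R = {g :: 'a \<Rightarrow> real. (\<lambda>\<omega>. complex_of_real (g \<omega>)) \<in> trig}"
  interpret function_ring_on R "sphere 0 1"
  proof
    fix f assume f: "f \<in> R"
    then have "Ck_on 0 (\<lambda>\<omega>. complex_of_real (f \<omega>)) UNIV" unfolding R_def by (blast intro: trig_Ck)
    then have "continuous_on UNIV (\<lambda>\<omega>. Re (complex_of_real (f \<omega>)))" by (intro continuous_on_Re) simp
    then show "continuous_on (sphere 0 1) f" by (auto intro: continuous_on_subset)
    fix g assume g: "g \<in> R"
    show "(\<lambda>x. f x + g x) \<in> R" "(\<lambda>x. f x * g x) \<in> R"
      using f g trig.add[of "\<lambda>\<omega>. complex_of_real (f \<omega>)"] trig_mult[of "\<lambda>\<omega>. complex_of_real (f \<omega>)"] by (auto simp: R_def)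
  next
    show "(\<lambda>_. c) \<in> R" for c using trig.char[of "complex_of_real c" 0] by (simp add: R_def)
  next
    fix x y :: 'a assume xy: "x \<in> sphere 0 1" "y \<in> sphere 0 1" "x \<noteq> y"
    \<comment> \<open>For this unit vector z.x and z.y are distinct and lie in [-1, 1], where sin is
      injective, so sin (z.w) separates x and y.\<close>
    define z where "z = (1 / norm (x - y)) *\<^sub>R (x - y)"
    have nz: "norm z = 1" using xy by (simp add: z_def)
    have b: "\<bar>z \<bullet> x\<bar> \<le> 1" "\<bar>z \<bullet> y\<bar> \<le> 1"
      using Cauchy_Schwarz_ineq2[of z x] Cauchy_Schwarz_ineq2[of z y] nz xy by auto
    have "z \<bullet> x - z \<bullet> y = norm (x - y)"
    proof -
      have "z \<bullet> x - z \<bullet> y = z \<bullet> (x - y)" by (simp add: inner_diff_right)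
      also have "\<dots> = (1 / norm (x - y)) * (norm (x - y))\<^sup>2" by (simp add: z_def power2_norm_eq_inner)
      finally show ?thesis using xy by (simp add: power2_eq_square)
    qed
    then have ne: "z \<bullet> x \<noteq> z \<bullet> y" using xy by auto
    have pi: "1 \<le> pi / 2" using pi_ge_two by simp
    have "sin (z \<bullet> x) \<noteq> sin (z \<bullet> y)"
    proof
      assume "sin (z \<bullet> x) = sin (z \<bullet> y)"
      moreover have "- (pi / 2) \<le> z \<bullet> x" "z \<bullet> x \<le> pi / 2" "- (pi / 2) \<le> z \<bullet> y" "z \<bullet> y \<le> pi / 2"
        using b pi by linarith+
      ultimately have "z \<bullet> x = z \<bullet> y" by (rule sin_inj_pi[rotated 4])
      then show False using ne by simp
    qed
    moreover have "(\<lambda>\<omega>. sin (z \<bullet> \<omega>)) \<in> R" unfolding R_def using trig_cos_sin(2)[of z] by simp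
    ultimately show "\<exists>f\<in>R. f x \<noteq> f y" by (rule bexI[where x = "\<lambda>\<omega>. sin (z \<bullet> \<omega>)"])
  qed simp
  obtain h where h: "h \<in> R" "\<forall>x\<in>sphere 0 1. \<bar>g x - h x\<bar> < e"
    using Stone_Weierstrass_basic[OF g e] by blast
  have "norm (complex_of_real (g x) - complex_of_real (h x)) = \<bar>g x - h x\<bar>" for x
    by (metis norm_of_real of_real_diff)
  then show ?thesis using h by (intro bexI[of _ "\<lambda>x. complex_of_real (h x)"]) (auto simp: R_def)
qed

definition trig_approx :: "real \<Rightarrow> ('a::euclidean_space \<Rightarrow> complex) \<Rightarrow> bool" where
  "trig_approx p h \<longleftrightarrow> h \<in> Lp p sphere_measure \<and> (\<forall>e>0. \<exists>g\<in>trig. lpn p sphere_measure (\<lambda>x. h x - g x) < e)"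

lemma trig_approx_limit:
  assumes p: "1 \<le> p" and h: "h \<in> Lp p sphere_measure" and k: "\<And>m. trig_approx p (k m)"
    and lim: "(\<lambda>m. lpn p sphere_measure (\<lambda>x. h x - k m x)) \<longlonglongrightarrow> 0"
  shows "trig_approx p h"
  unfolding trig_approx_def
proof (intro conjI allI impI h)
  fix e :: real assume e: "0 < e"
  have "eventually (\<lambda>m. lpn p sphere_measure (\<lambda>x. h x - k m x) < e / 2) sequentially"
    using e by (intro order_tendstoD[OF lim]) simp
  then obtain m where m: "lpn p sphere_measure (\<lambda>x. h x - k m x) < e / 2"
    by (meson eventually_happens' sequentially_bot)
  have "\<exists>g\<in>trig. lpn p sphere_measure (\<lambda>x. k m x - g x) < e / 2"
    using k[of m] e unfolding trig_approx_def by (meson half_gt_zero)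
  then obtain g where g: "g \<in> trig" "lpn p sphere_measure (\<lambda>x. k m x - g x) < e / 2" by blast
  have kL: "k m \<in> Lp p sphere_measure" using k by (simp add: trig_approx_def)
  have "lpn p sphere_measure (\<lambda>x. (h x - k m x) + (k m x - g x)) \<le> lpn p sphere_measure (\<lambda>x. h x - k m x) + lpn p sphere_measure (\<lambda>x. k m x - g x)"
    using p g by (intro lpn_triangle Lp_diff h kL trig_Lp) auto
  then show "\<exists>g\<in>trig. lpn p sphere_measure (\<lambda>x. h x - g x) < e"
    using g m by (intro bexI[of _ g]) auto
qed

lemma trig_approx_add:
  assumes p: "1 \<le> p" and f: "trig_approx p f" and g: "trig_approx p g"
  shows "trig_approx p (\<lambda>x. f x + g x)"
  unfolding trig_approx_def
proof (intro conjI allI impI)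
  have L: "f \<in> Lp p sphere_measure" "g \<in> Lp p sphere_measure" using f g by (auto simp: trig_approx_def)
  then show "(\<lambda>x. f x + g x) \<in> Lp p sphere_measure" using p by (intro Lp_add) auto
  fix e :: real assume e: "0 < e"
  have "\<exists>s\<in>trig. lpn p sphere_measure (\<lambda>x. f x - s x) < e / 2" "\<exists>t\<in>trig. lpn p sphere_measure (\<lambda>x. g x - t x) < e / 2"
    using f g e unfolding trig_approx_def by (meson half_gt_zero)+
  then obtain s t where s: "s \<in> trig" "lpn p sphere_measure (\<lambda>x. f x - s x) < e / 2"
    and t: "t \<in> trig" "lpn p sphere_measure (\<lambda>x. g x - t x) < e / 2" by blast
  have "lpn p sphere_measure (\<lambda>x. (f x - s x) + (g x - t x)) \<le> lpn p sphere_measure (\<lambda>x. f x - s x) + lpn p sphere_measure (\<lambda>x. g x - t x)"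
    using p s t by (intro lpn_triangle Lp_diff L trig_Lp) auto
  moreover have "(f x - s x) + (g x - t x) = (f x + g x) - (s x + t x)" for x by simp
  ultimately show "\<exists>h\<in>trig. lpn p sphere_measure (\<lambda>x. f x + g x - h x) < e"
    using s t by (intro bexI[of _ "\<lambda>x. s x + t x"]) (auto intro: trig.add)
qed

lemma trig_approx_trig: "0 \<le> p \<Longrightarrow> f \<in> trig \<Longrightarrow> trig_approx p f"
  unfolding trig_approx_def by (auto intro!: trig_Lp bexI[of _ f])

lemma trig_approx_scale:
  assumes p: "1 \<le> p" and f: "trig_approx p f"
  shows "trig_approx p (\<lambda>x. c * f x)"
  unfolding trig_approx_def
proof (intro conjI allI impI)
  show "(\<lambda>x. c * f x) \<in> Lp p sphere_measure" using f by (intro Lp_scale) (simp add: trig_approx_def)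
  fix e :: real assume e: "0 < e"
  have "0 < e / (norm c + 1)" using e by (intro divide_pos_pos add_nonneg_pos) auto
  then obtain s where s: "s \<in> trig" "lpn p sphere_measure (\<lambda>x. f x - s x) < e / (norm c + 1)"
    using f unfolding trig_approx_def by blast
  have "lpn p sphere_measure (\<lambda>x. c * f x - c * s x) = norm c * lpn p sphere_measure (\<lambda>x. f x - s x)"
    using lpn_scale[of p sphere_measure c "\<lambda>x. f x - s x"] p by (simp add: right_diff_distrib)
  also have "\<dots> \<le> (norm c + 1) * lpn p sphere_measure (\<lambda>x. f x - s x)" by (intro mult_right_mono) auto
  also have "\<dots> < e" using s(2) by (simp add: pos_less_divide_eq add_nonneg_pos mult.commute)
  finally show "\<exists>g\<in>trig. lpn p sphere_measure (\<lambda>x. c * f x - g x) < e"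
    using s by (intro bexI[of _ "\<lambda>x. c * s x"]) (auto intro: trig_scale)
qed

lemma trig_approx_sum:
  fixes f :: "'b \<Rightarrow> 'a::euclidean_space \<Rightarrow> complex"
  assumes p: "1 \<le> p" and "finite A" "\<And>i. i \<in> A \<Longrightarrow> trig_approx p (f i)"
  shows "trig_approx p (\<lambda>x. \<Sum>i\<in>A. f i x)"
  using assms(2,3)
proof (induction A)
  case empty
  have "(\<lambda>x::'a. 0) \<in> trig" using trig.char[of 0 "0::'a"] by simp
  then show ?case using p by (simp add: trig_approx_trig)
next
  case (insert a A)
  then show ?case using trig_approx_add[OF p, of "f a" "\<lambda>x. \<Sum>i\<in>A. f i x"] by simp
qed

lemma trig_approx_cong:
  assumes "trig_approx p f" "g \<in> borel_measurable sphere_measure" "\<And>x. x \<in> sphere 0 1 \<Longrightarrow> f x = g x" "0 \<le> p"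
  shows "trig_approx p g"
proof -
  have "g \<in> Lp p sphere_measure"
    by (rule Lp_mono[of f]) (use assms in \<open>auto simp: trig_approx_def\<close>)
  moreover have "lpn p sphere_measure (\<lambda>x. g x - t x) = lpn p sphere_measure (\<lambda>x. f x - t x)" for t
    by (rule lpn_cong) (use assms in auto)
  ultimately show ?thesis using assms(1) by (simp add: trig_approx_def)
qed

lemma trig_approx_continuous:
  fixes g :: "'a::euclidean_space \<Rightarrow> real"
  assumes p: "1 \<le> p" and g: "continuous_on UNIV g"
  shows "trig_approx p (\<lambda>x. complex_of_real (g x))"
  unfolding trig_approx_def
proof (intro conjI allI impI)
  have [measurable]: "g \<in> borel_measurable borel" using g by (rule borel_measurable_continuous_onI)
  have m: "(\<lambda>x. complex_of_real (g x)) \<in> borel_measurable sphere_measure"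
    by (rule borel_measurable_sphere) measurable
  have gs: "continuous_on (sphere 0 1) g" using g by (rule continuous_on_subset) simp
  have "compact (g ` sphere 0 1)" by (rule compact_continuous_image[OF gs]) simp
  then obtain B where "\<forall>x\<in>sphere 0 1. \<bar>g x\<bar> \<le> B" using compact_imp_bounded bounded_real by (metis imageI)
  then show "(\<lambda>x. complex_of_real (g x)) \<in> Lp p sphere_measure"
    using p by (intro finite_measure.Lp_bounded[OF finite_measure_sphere m, of B]) auto
  fix e :: real assume e: "0 < e"
  define c where "c = measure sphere_measure (sphere (0::'a) 1) powr (1/p)"
  have c: "0 \<le> c" by (simp add: c_def)
  obtain t where t: "t \<in> trig" "\<forall>x\<in>sphere 0 1. norm (complex_of_real (g x) - t x) < e / (c + 1)"
    using trig_uniform_approx[OF gs, of "e / (c + 1)"] e c by auto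
  have [measurable]: "t \<in> borel_measurable borel" using t(1) by (rule trig_measurable)
  have "lpn p sphere_measure (\<lambda>x. complex_of_real (g x) - t x) \<le> e / (c + 1) * measure sphere_measure (space (sphere_measure :: 'a measure)) powr (1/p)"
  proof (rule finite_measure.lpn_bounded[OF finite_measure_sphere])
    show "(\<lambda>x. complex_of_real (g x) - t x) \<in> borel_measurable sphere_measure"
      by (rule borel_measurable_sphere) measurable
    show "norm (complex_of_real (g x) - t x) \<le> e / (c + 1)" if "x \<in> space sphere_measure" for x
      using t(2) that by (intro less_imp_le) simp
  qed (use e c p in auto)
  also have "\<dots> = e / (c + 1) * c" by (simp add: c_def)
  also have "\<dots> < e" using e c by (simp add: field_simps)
  finally show "\<exists>t\<in>trig. lpn p sphere_measure (\<lambda>x. complex_of_real (g x) - t x) < e" using t(1) by blast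
qed

section \<open>Density in L^p: from closed sets to simple functions\<close>

lemma indicator_sphere_measurable:
  "B \<in> sets borel \<Longrightarrow> (indicator B :: 'a::euclidean_space \<Rightarrow> complex) \<in> borel_measurable sphere_measure"
  by (intro borel_measurable_sphere borel_measurable_indicator)

lemma indicator_sphere_Lp:
  assumes "B \<in> sets borel" "0 \<le> p"
  shows "(indicator B :: 'a::euclidean_space \<Rightarrow> complex) \<in> Lp p sphere_measure"
  by (rule finite_measure.Lp_bounded[OF finite_measure_sphere indicator_sphere_measurable[OF assms(1)], of 1])
     (use assms(2) in \<open>auto simp: indicator_def\<close>)

lemma trig_approx_dominated:
  fixes h :: "'a::euclidean_space \<Rightarrow> complex"
  assumes p: "1 \<le> p" and h: "h \<in> Lp p sphere_measure" and k: "\<And>m. trig_approx p (k m)"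
    and g: "g \<in> Lp p sphere_measure"
    and bd: "\<And>m x. x \<in> sphere 0 1 \<Longrightarrow> norm (h x - k m x) \<le> norm (g x)"
    and lim: "\<And>x. x \<in> sphere 0 1 \<Longrightarrow> (\<lambda>m. k m x) \<longlonglongrightarrow> h x"
  shows "trig_approx p h"
proof (rule trig_approx_limit[OF p h k])
  show "(\<lambda>m. lpn p sphere_measure (\<lambda>x. h x - k m x)) \<longlonglongrightarrow> 0"
  proof (rule lpn_tendsto_dominated[OF _ _ g])
    have kL: "k m \<in> Lp p sphere_measure" for m using k by (simp add: trig_approx_def)
    show "(\<lambda>x. h x - k m x) \<in> borel_measurable sphere_measure" for m
      by (rule borel_measurable_diff[OF Lp_measurable[OF h] Lp_measurable[OF kL]])
    show "(\<lambda>m. h x - k m x) \<longlonglongrightarrow> 0" if "x \<in> space sphere_measure" for x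
      using tendsto_diff[OF tendsto_const lim[of x], of "h x"] that by simp
  qed (use p bd in auto)
qed

lemma trig_approx_closed:
  fixes C :: "'a::euclidean_space set"
  assumes p: "1 \<le> p" and C: "closed C"
  shows "trig_approx p (indicator C)"
proof (cases "C = {}")
  case True
  have "(\<lambda>x::'a. 0) \<in> trig" using trig.char[of 0 "0::'a"] by simp
  moreover have "indicator C = (\<lambda>x::'a. 0::complex)" using True by (simp add: fun_eq_iff)
  ultimately show ?thesis using trig_approx_trig[of p "\<lambda>x::'a. 0"] p by simp
next
  case False
  \<comment> \<open>Continuous cutoffs, equal to 1 on C and eventually 0 at each point off the
    closed set C.\<close>
  define k where "k m x = max 0 (1 - real m * infdist x C)" for m :: nat and x
  have kC: "k m x = 1" if "x \<in> C" for m x using that by (simp add: k_def)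
  have k01: "0 \<le> k m x" "k m x \<le> 1" for m x using infdist_nonneg[of x C] by (auto simp: k_def)
  show ?thesis
  proof (rule trig_approx_dominated[OF p, where k = "\<lambda>m x. complex_of_real (k m x)" and g = "\<lambda>x. 1"])
    show "indicator C \<in> Lp p sphere_measure" using C p by (intro indicator_sphere_Lp) auto
    show "trig_approx p (\<lambda>x. complex_of_real (k m x))" for m
      by (rule trig_approx_continuous[OF p]) (auto simp: k_def intro!: continuous_intros)
    show "(\<lambda>x. 1) \<in> Lp p sphere_measure"
      using p by (intro finite_measure.Lp_bounded[where B = 1, OF finite_measure_sphere]) auto
    show "norm (indicator C x - complex_of_real (k m x)) \<le> norm (1::complex)" for m x
    proof (cases "x \<in> C")
      case False
      then show ?thesis using k01[of m x] by simp
    qed (simp add: kC)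
    show "(\<lambda>m. complex_of_real (k m x)) \<longlonglongrightarrow> indicator C x" for x
    proof (cases "x \<in> C")
      case True
      then show ?thesis by (simp add: kC)
    next
      case x: False
      then have pos: "0 < infdist x C"
        using in_closed_iff_infdist_zero[OF C False, of x] infdist_nonneg[of x C] by linarith
      have "eventually (\<lambda>m. complex_of_real (k m x) = 0) sequentially"
        using eventually_ge_at_top[of "nat \<lceil>1 / infdist x C\<rceil>"]
      proof eventually_elim
        case (elim m)
        then have "1 / infdist x C \<le> real m" by linarith
        then have "1 \<le> real m * infdist x C" using pos by (simp add: divide_le_eq)
        then show ?case by (simp add: k_def)
      qed
      then show ?thesis using x by (simp add: tendsto_eventually)
    qed
  qed
qed

text \<open>Dynkin's theorem: closed sets are an intersection-stable generator, and approximability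
  passes to complements and countable disjoint unions.\<close>

lemma trig_approx_borel:
  fixes B :: "'a::euclidean_space set"
  assumes p: "1 \<le> p" and B: "B \<in> sets borel"
  shows "trig_approx p (indicator B)"
proof -
  have st: "Int_stable (Collect closed :: 'a set set)" "Collect closed \<subseteq> Pow (UNIV :: 'a set)"
    by (auto simp: Int_stable_def)
  have eq: "sigma_sets UNIV (Collect closed) = sets (borel :: 'a measure)"
    by (simp add: borel_eq_closed)
  have "B \<in> sigma_sets UNIV (Collect closed)" using B by (simp add: eq)
  from st this show ?thesis
  proof (induct rule: sigma_sets_induct_disjoint)
    case (basic A)
    then show ?case by (intro trig_approx_closed p) simp
  next
    case empty
    show ?case by (rule trig_approx_closed[OF p closed_empty])
  next
    case (compl A)
    have A: "A \<in> sets borel" using compl(1) by (simp add: eq)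
    have "(\<lambda>x. 1 + (-1) * indicator A x) = (indicator (UNIV - A) :: 'a \<Rightarrow> complex)"
      by (auto simp: fun_eq_iff indicator_def)
    moreover have "trig_approx p (\<lambda>x::'a. 1)" using trig_approx_continuous[OF p, of "\<lambda>x::'a. 1"] by simp
    ultimately show ?case using trig_approx_add[OF p _ trig_approx_scale[OF p compl(2), of "-1"], of "\<lambda>x. 1"] by simp
  next
    case (union A)
    have A: "A i \<in> sets borel" for i using union(2) by (auto simp: eq)
    show ?case
    proof (rule trig_approx_dominated[OF p, where k = "\<lambda>m x. \<Sum>i<m. indicator (A i) x" and g = "\<lambda>x. 1"])
      show "indicator (\<Union>i. A i) \<in> Lp p sphere_measure" using A p by (intro indicator_sphere_Lp) auto
      show "trig_approx p (\<lambda>x. \<Sum>i<m. indicator (A i) x)" for m by (rule trig_approx_sum[OF p]) (auto intro: union)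
      show "(\<lambda>x. 1) \<in> Lp p sphere_measure"
        using p by (intro finite_measure.Lp_bounded[where B = 1, OF finite_measure_sphere]) auto
      have part: "(\<Sum>i<m. indicator (A i) x :: complex) = indicator (\<Union>i<m. A i) x" for m x
      proof -
        have "disjoint_family_on A {..<m}" using union(1) by (rule disjoint_family_on_mono[rotated]) simp
        then show ?thesis by (simp add: indicator_UN_disjoint)
      qed
      show "norm ((indicator (\<Union>i. A i) x :: complex) - (\<Sum>i<m. indicator (A i) x)) \<le> norm (1::complex)" for m x
        unfolding part by (auto simp: indicator_def)
      show "(\<lambda>m. \<Sum>i<m. indicator (A i) x) \<longlonglongrightarrow> (indicator (\<Union>i. A i) x :: complex)" for x
      proof (cases "x \<in> (\<Union>i. A i)")
        case True
        then obtain i where i: "x \<in> A i" by blast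
        have "eventually (\<lambda>m. indicator (\<Union>i<m. A i) x = (1::complex)) sequentially"
          using eventually_gt_at_top[of i]
        proof eventually_elim
          case (elim m)
          then have "x \<in> (\<Union>i<m. A i)" using i by blast
          then show ?case by (rule indicator_simps(1))
        qed
        then show ?thesis unfolding part using True by (simp add: tendsto_eventually)
      next
        case False
        then show ?thesis unfolding part by (simp add: indicator_def)
      qed
    qed
  qed
qed

text \<open>Simple functions dominated by 2 |h| converge to h in L^p and reduce the claim to
  indicators.\<close>

lemma trig_approx_Lp:
  fixes h :: "'a::euclidean_space \<Rightarrow> complex"
  assumes p: "1 \<le> p" and h: "h \<in> Lp p sphere_measure"
  shows "trig_approx p h"
proof -
  have hm: "h \<in> borel_measurable sphere_measure" using h by (rule Lp_measurable)
  obtain F where F: "\<And>i. simple_function sphere_measure (F i)"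
    "\<And>x. x \<in> space sphere_measure \<Longrightarrow> (\<lambda>i. F i x) \<longlonglongrightarrow> h x"
    "\<And>i x. x \<in> space sphere_measure \<Longrightarrow> dist (F i x) 0 \<le> 2 * dist (h x) 0"
    using borel_measurable_implies_sequence_metric[OF hm, of 0] by blast
  have FA: "trig_approx p (F i)" for i
  proof -
    define A where "A v = F i -` {v} \<inter> space sphere_measure" for v
    \<comment> \<open>Measurable subsets of the sphere are traces of Borel sets of the whole space,
      to which \<open>trig_approx_borel\<close> applies.\<close>
    have "\<exists>B\<in>sets borel. A v = B \<inter> sphere 0 1" for v
    proof -
      have "A v \<in> sets sphere_measure" unfolding A_def using simple_functionD(2)[OF F(1)] .
      then show ?thesis by (auto simp: sets_sphere_measure sets_restrict_space)
    qed
    then obtain B where B: "\<And>v. B v \<in> sets borel" "\<And>v. A v = B v \<inter> sphere 0 1" by metis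
    have fin: "finite (F i ` sphere 0 1)" using simple_functionD(1)[OF F(1)] by simp
    show ?thesis
    proof (rule trig_approx_cong)
      show "trig_approx p (\<lambda>x. \<Sum>v\<in>F i ` sphere 0 1. v * indicator (B v) x)"
        by (intro trig_approx_sum trig_approx_scale trig_approx_borel p fin B(1))
      show "F i \<in> borel_measurable sphere_measure" using F(1) by (rule borel_measurable_simple_function)
      fix x :: 'a assume x: "x \<in> sphere 0 1"
      have "(\<Sum>v\<in>F i ` sphere 0 1. v * indicator (B v) x) = (\<Sum>v\<in>F i ` sphere 0 1. if v = F i x then v else 0)"
      proof (rule sum.cong[OF refl])
        fix v
        have "x \<in> B v \<longleftrightarrow> x \<in> A v" using B(2)[of v] x by blast
        then show "v * indicator (B v) x = (if v = F i x then v else 0)"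
          using x by (auto simp: A_def)
      qed
      then show "(\<Sum>v\<in>F i ` sphere 0 1. v * indicator (B v) x) = F i x"
        using fin x by (simp add: sum.delta)
    qed (use p in simp)
  qed
  show ?thesis
  proof (rule trig_approx_dominated[OF p h FA Lp_scale[OF h, of 3]])
    fix i and x :: 'a assume "x \<in> sphere 0 1"
    then have "norm (F i x) \<le> 2 * norm (h x)" using F(3)[of x i] by simp
    then show "norm (h x - F i x) \<le> norm (3 * h x)"
      using norm_triangle_ineq4[of "h x" "F i x"] by (simp add: norm_mult)
  qed (use F(2) in simp)
qed

section \<open>Extension estimates and weak compactness\<close>

lemma extension_op_measurable:
  fixes f :: "'a::euclidean_space \<Rightarrow> complex"
  assumes "integrable sphere_measure f"
  shows "extension_op f \<in> borel_measurable borel"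
proof (rule borel_measurable_continuous_onI, rule lipschitz_on_continuous_on)
  show "(\<integral>\<omega>. norm (f \<omega>) \<partial>sphere_measure)-lipschitz_on UNIV (extension_op f)"
    using extension_op_Lipschitz[OF assms] by (intro lipschitz_onI) (auto simp: dist_norm)
qed

lemma lpn_le_of_Lnorm:
  assumes "0 < q" "g \<in> borel_measurable M" "0 \<le> N" "Lnorm (ennreal q) M g \<le> ennreal N"
  shows "g \<in> Lp q M" "lpn q M g \<le> N"
proof -
  have "g \<in> Lspace (ennreal q) M" unfolding Lspace_def using assms by (auto intro: le_less_trans)
  then show g: "g \<in> Lp q M" using Lspace_eq_Lp assms(1) by metis
  show "lpn q M g \<le> N" using assms(3,4) unfolding Lnorm_eq_lpn[OF assms(1) g] by simp
qed

text \<open>\<open>extension_norm\<close> speaks of smooth functions of norm one. Homogeneity gives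
  the bound for trigonometric polynomials; density, pointwise convergence of the extensions and
  Fatou's lemma carry it to L^p.\<close>

lemma extension_bound:
  assumes p: "1 < p" and q: "1 \<le> q" and fin: "extension_norm TYPE('a::euclidean_space) (ennreal p) (ennreal q) < \<infinity>"
  shows "\<exists>C\<ge>0. \<forall>f\<in>Lp p (sphere_measure :: 'a measure). extension_op f \<in> Lp q lborel \<and>
    lpn q lborel (extension_op f) \<le> C * lpn p sphere_measure f"
proof -
  define C where "C = enn2real (extension_norm TYPE('a) (ennreal p) (ennreal q))"
  have C: "0 \<le> C" "extension_norm TYPE('a) (ennreal p) (ennreal q) = ennreal C"
    using fin by (auto simp: C_def less_top)
  define c where "c = measure sphere_measure (sphere (0::'a) 1) powr (1 - 1/p)"
  have int: "integrable sphere_measure f" if "f \<in> Lp p sphere_measure" for f :: "'a \<Rightarrow> complex"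
    using finite_measure.Lp_imp_integrable[OF finite_measure_sphere that] p by simp
  have sup: "norm (extension_op f x) \<le> lpn p sphere_measure f * c" if "f \<in> Lp p sphere_measure" for f :: "'a \<Rightarrow> complex" and x
    using norm_extension_op_le[OF int[OF that], of x] finite_measure.L1_le_lpn[OF finite_measure_sphere p that]
    by (simp add: c_def)
  have trig: "extension_op g \<in> Lp q lborel \<and> lpn q lborel (extension_op g) \<le> C * lpn p sphere_measure g"
    if g: "g \<in> trig" for g :: "'a \<Rightarrow> complex"
  proof (cases "lpn p sphere_measure g = 0")
    \<comment> \<open>Norm 0 cannot be normalised, but then the extension vanishes, being bounded by
      a multiple of the norm.\<close>
    case True
    then have "extension_op g = (\<lambda>x. 0)" using sup[OF trig_Lp[OF g]] p by (auto simp: fun_eq_iff)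
    then show ?thesis by (simp add: True)
  next
    case False
    define a where "a = lpn p sphere_measure g"
    have a: "0 < a" using False lpn_nonneg[of p sphere_measure g] by (simp add: a_def less_le)
    define g' where "g' \<omega> = complex_of_real (1/a) * g \<omega>" for \<omega>
    have g': "g' \<in> trig" unfolding g'_def[abs_def] by (rule trig_scale[OF g])
    have gL: "g \<in> Lp p sphere_measure" using g p by (intro trig_Lp) auto
    have g'L: "g' \<in> Lp p sphere_measure" using g' p by (intro trig_Lp) auto
    have "lpn p sphere_measure g' = norm (complex_of_real (1/a)) * lpn p sphere_measure g"
      unfolding g'_def[abs_def] using p by (intro lpn_scale) simp
    then have "lpn p sphere_measure g' = 1" using a by (simp add: a_def[symmetric] norm_divide)
    then have "Lnorm (ennreal p) sphere_measure g' = 1" using Lnorm_eq_lpn[OF _ g'L] p by simp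
    then have "Lnorm (ennreal q) lborel (extension_op g') \<le> extension_norm TYPE('a) (ennreal p) (ennreal q)"
      unfolding extension_norm_def using trig_smooth[OF g'] by (intro SUP_upper) simp
    then have le: "Lnorm (ennreal q) lborel (extension_op g') \<le> ennreal C" by (simp add: C(2))
    have m: "extension_op g' \<in> borel_measurable lborel" using extension_op_measurable[OF int[OF g'L]] by simp
    have E: "extension_op g' \<in> Lp q lborel" "lpn q lborel (extension_op g') \<le> C"
      using lpn_le_of_Lnorm[OF _ m C(1) le] q by auto
    have "g \<omega> = complex_of_real a * g' \<omega>" for \<omega> using a by (simp add: g'_def)
    then have "g = (\<lambda>\<omega>. complex_of_real a * g' \<omega>)" by (simp add: fun_eq_iff)
    then have "extension_op g = (\<lambda>x. complex_of_real a * extension_op g' x)"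
      by (simp only: extension_op_scale[abs_def])
    then show ?thesis
      using E lpn_scale[of q lborel "complex_of_real a" "extension_op g'"] q a
      by (simp add: Lp_scale a_def[symmetric] mult.commute)
  qed
  \<comment> \<open>The slack e covers the norms of the approximating polynomials, which eventually
    exceed that of f by at most e.\<close>
  have main: "extension_op f \<in> Lp q lborel \<and> lpn q lborel (extension_op f) \<le> C * (lpn p sphere_measure f + e)"
    if f: "f \<in> Lp p sphere_measure" and e: "0 < e" for f :: "'a \<Rightarrow> complex" and e
  proof -
    have "\<exists>g\<in>trig. lpn p sphere_measure (\<lambda>x. f x - g x) < 1 / real (Suc k)" for k
      using trig_approx_Lp[OF _ f] p unfolding trig_approx_def by simp
    then obtain g where g: "\<And>k. g k \<in> trig" and gf: "\<And>k. lpn p sphere_measure (\<lambda>x. f x - g k x) < 1 / real (Suc k)"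
      by metis
    have gL: "g k \<in> Lp p sphere_measure" for k using g p by (intro trig_Lp) auto
    have dL: "(\<lambda>x. f x - g k x) \<in> Lp p sphere_measure" for k using p by (intro Lp_diff f gL) simp
    have z: "(\<lambda>k. 1 / real (Suc k)) \<longlonglongrightarrow> 0" by (rule LIMSEQ_Suc[OF lim_1_over_n])
    have lim: "(\<lambda>k. extension_op (g k) x) \<longlonglongrightarrow> extension_op f x" for x
    proof (rule Lim_transform[OF tendsto_const])
      show "(\<lambda>k. extension_op (g k) x - extension_op f x) \<longlonglongrightarrow> 0"
      proof (rule Lim_null_comparison)
        show "eventually (\<lambda>k. norm (extension_op (g k) x - extension_op f x) \<le> 1 / real (Suc k) * c) sequentially"
        proof (intro always_eventually allI)
          fix k
          have "norm (extension_op (g k) x - extension_op f x) = norm (extension_op (\<lambda>x. f x - g k x) x)"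
            by (simp add: extension_op_diff[OF int[OF f] int[OF gL]] norm_minus_commute)
          also have "\<dots> \<le> lpn p sphere_measure (\<lambda>x. f x - g k x) * c" by (rule sup[OF dL])
          also have "\<dots> \<le> 1 / real (Suc k) * c"
            using gf[of k] by (intro mult_right_mono) (auto simp: c_def)
          finally show "norm (extension_op (g k) x - extension_op f x) \<le> 1 / real (Suc k) * c" .
        qed
        show "(\<lambda>k. 1 / real (Suc k) * c) \<longlonglongrightarrow> 0" using tendsto_mult_right[OF z, of c] by simp
      qed
    qed
    have EgL: "extension_op (g k) \<in> Lp q lborel" "lpn q lborel (extension_op (g k)) \<le> C * lpn p sphere_measure (g k)" for k
      using trig[OF g] by auto
    have "eventually (\<lambda>k. 1 / real (Suc k) < e) sequentially" using order_tendstoD(2)[OF z e] .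
    then have bd: "eventually (\<lambda>k. Ip q lborel (extension_op (g k)) \<le> (C * (lpn p sphere_measure f + e)) powr q) sequentially"
    proof eventually_elim
      case (elim k)
      have "lpn p sphere_measure (g k) \<le> lpn p sphere_measure f + e"
        using lpn_diff_abs[OF _ f gL[of k]] gf[of k] elim p by linarith
      then have "C * lpn p sphere_measure (g k) \<le> C * (lpn p sphere_measure f + e)" using C(1) by (rule mult_left_mono)
      then have "lpn q lborel (extension_op (g k)) \<le> C * (lpn p sphere_measure f + e)" using EgL(2)[of k] by linarith
      then show ?case using q C(1) e by (subst lpn_le_iff[symmetric]) auto
    qed
    have m: "extension_op f \<in> borel_measurable lborel" using extension_op_measurable[OF int[OF f]] by simp
    have "extension_op f \<in> Lp q lborel" "Ip q lborel (extension_op f) \<le> (C * (lpn p sphere_measure f + e)) powr q"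
      using Lp_Fatou[OF _ EgL(1) m AE_I2[OF lim] bd] q by auto
    then show ?thesis using q C(1) e by (subst lpn_le_iff) auto
  qed
  have "lpn q lborel (extension_op f) \<le> C * lpn p sphere_measure f" if f: "f \<in> Lp p sphere_measure" for f :: "'a \<Rightarrow> complex"
    using le_limit_right[of "lpn q lborel (extension_op f)" "\<lambda>e. C * (lpn p sphere_measure f + e)"] main[OF f] by simp
  moreover have "extension_op f \<in> Lp q lborel" if f: "f \<in> Lp p sphere_measure" for f :: "'a \<Rightarrow> complex"
    using main[OF f, of 1] by simp
  ultimately show ?thesis using C(1) by blast
qed

text \<open>The integrals against characters are values of the extension operator.\<close>

lemma weak_compactness:
  fixes f :: "nat \<Rightarrow> 'a::euclidean_space \<Rightarrow> complex"
  assumes p: "1 < p" and pq: "1/p + 1/q = 1"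
    and f: "\<And>n. f n \<in> Lp p sphere_measure" and K: "\<And>n. lpn p sphere_measure (f n) \<le> K"
    and conv: "\<And>y. convergent (\<lambda>n. extension_op (f n) y)"
  obtains \<phi> where "\<phi> \<in> Lp p sphere_measure"
    "\<And>h. h \<in> Lp q sphere_measure \<Longrightarrow> (\<lambda>n. \<integral>\<omega>. f n \<omega> * h \<omega> \<partial>sphere_measure) \<longlonglongrightarrow> (\<integral>\<omega>. \<phi> \<omega> * h \<omega> \<partial>sphere_measure)"
proof -
  have q: "1 < q" using conjugate_exponent[OF p pq] by simp
  have qp: "1/q + 1/p = 1" using pq by simp
  have K0: "0 \<le> K" using K[of 0] lpn_nonneg order_trans by blast
  define S where "S h n = (\<integral>\<omega>. f n \<omega> * h \<omega> \<partial>sphere_measure)" for h :: "'a \<Rightarrow> complex" and n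
  have int: "integrable sphere_measure (\<lambda>\<omega>. f n \<omega> * h \<omega>)" if "h \<in> Lp q sphere_measure" for h n
    by (rule Holder(1)[OF p q pq f that])
  have Sle: "norm (S h n) \<le> K * lpn q sphere_measure h" if "h \<in> Lp q sphere_measure" for h n
    unfolding S_def
    by (rule order_trans[OF Holder(3)[OF p q pq f that]]) (intro mult_right_mono K lpn_nonneg)
  have Slin: "S (\<lambda>\<omega>. a * g \<omega> + b * h \<omega>) n = a * S g n + b * S h n"
    if "g \<in> Lp q sphere_measure" "h \<in> Lp q sphere_measure" for g h a b n
  proof -
    have "S (\<lambda>\<omega>. a * g \<omega> + b * h \<omega>) n = (\<integral>\<omega>. a * (f n \<omega> * g \<omega>) + b * (f n \<omega> * h \<omega>) \<partial>sphere_measure)"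
      unfolding S_def by (rule Bochner_Integration.integral_cong) (auto simp: algebra_simps)
    also have "\<dots> = a * S g n + b * S h n"
      unfolding S_def using int[OF that(1), of n] int[OF that(2), of n] by simp
    finally show ?thesis .
  qed
  have trigc: "convergent (S g)" if "g \<in> trig" for g
    using that
  proof (induction rule: trig.induct)
    case (char c y)
    have "S (\<lambda>\<omega>. c * exp (\<i> * complex_of_real (y \<bullet> \<omega>))) = (\<lambda>n. c * extension_op (f n) y)"
    proof
      fix n
      have "S (\<lambda>\<omega>. c * exp (\<i> * complex_of_real (y \<bullet> \<omega>))) n
        = (\<integral>\<omega>. c * (exp (\<i> * complex_of_real (y \<bullet> \<omega>)) * f n \<omega>) \<partial>sphere_measure)"
        unfolding S_def by (rule Bochner_Integration.integral_cong) (auto simp: mult_ac)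
      then show "S (\<lambda>\<omega>. c * exp (\<i> * complex_of_real (y \<bullet> \<omega>))) n = c * extension_op (f n) y"
        by (simp add: extension_op_def)
    qed
    moreover obtain l where "(\<lambda>n. extension_op (f n) y) \<longlonglongrightarrow> l" using conv[of y] by (auto simp: convergent_def)
    then have "(\<lambda>n. c * extension_op (f n) y) \<longlonglongrightarrow> c * l" by (rule tendsto_mult_left)
    ultimately have "S (\<lambda>\<omega>. c * exp (\<i> * complex_of_real (y \<bullet> \<omega>))) \<longlonglongrightarrow> c * l" by (simp only:)
    then show ?case by (rule convergentI)
  next
    case (add g h)
    have L: "g \<in> Lp q sphere_measure" "h \<in> Lp q sphere_measure"
      using trig_Lp[OF add.hyps(1), of q] trig_Lp[OF add.hyps(2), of q] q by auto
    have "S (\<lambda>\<omega>. g \<omega> + h \<omega>) = (\<lambda>n. S g n + S h n)"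
      using Slin[OF L, of 1 1] by (simp add: fun_eq_iff)
    then show ?case using convergent_add[OF add.IH] by simp
  qed
  have Sconv: "convergent (S h)" if h: "h \<in> Lp q sphere_measure" for h
  proof (rule Cauchy_convergent, rule metric_CauchyI)
    fix e :: real assume e: "0 < e"
    have "\<exists>g\<in>trig. lpn q sphere_measure (\<lambda>x. h x - g x) < e / (3 * (K + 1))"
      using trig_approx_Lp[OF _ h] q e K0 unfolding trig_approx_def by simp
    then obtain g where g: "g \<in> trig" "lpn q sphere_measure (\<lambda>x. h x - g x) < e / (3 * (K + 1))" by blast
    have gL: "g \<in> Lp q sphere_measure" using g(1) q by (intro trig_Lp) auto
    have dL: "(\<lambda>x. h x - g x) \<in> Lp q sphere_measure" using q by (intro Lp_diff h gL) simp
    have small: "norm (S h n - S g n) \<le> e / 3" for n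
    proof -
      have "S h n - S g n = S (\<lambda>x. h x - g x) n" using Slin[OF h gL, of 1 "-1" n] by simp
      then have "norm (S h n - S g n) \<le> K * lpn q sphere_measure (\<lambda>x. h x - g x)" using Sle[OF dL, of n] by simp
      also have "\<dots> \<le> (K + 1) * (e / (3 * (K + 1)))" using g(2) K0 by (intro mult_mono) auto
      also have "\<dots> = e / 3" using K0 by (simp add: field_simps)
      finally show ?thesis .
    qed
    have "Cauchy (S g)" by (rule convergent_Cauchy[OF trigc[OF g(1)]])
    moreover have "0 < e / 3" using e by simp
    ultimately obtain N where N: "\<And>m n. m \<ge> N \<Longrightarrow> n \<ge> N \<Longrightarrow> dist (S g m) (S g n) < e / 3"
      unfolding Cauchy_def by blast
    show "\<exists>N. \<forall>m\<ge>N. \<forall>n\<ge>N. dist (S h m) (S h n) < e"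
    proof (intro exI[of _ N] allI impI)
      fix m n assume "m \<ge> N" "n \<ge> N"
      from N[OF this] small[of m] small[of n]
      show "dist (S h m) (S h n) < e"
        using dist_triangle[of "S h m" "S h n" "S g m"] dist_triangle[of "S g m" "S h n" "S g n"]
        by (simp add: dist_norm norm_minus_commute)
    qed
  qed
  define \<Lambda> where "\<Lambda> h = lim (S h)" for h
  have lim: "S h \<longlonglongrightarrow> \<Lambda> h" if "h \<in> Lp q sphere_measure" for h
    using Sconv[OF that] unfolding \<Lambda>_def by (simp add: convergent_LIMSEQ_iff)
  \<comment> \<open>The limit functional acts on L^q, so the exponents in the Riesz theorem are
    exchanged and the representing function lies in L^p.\<close>
  have "\<exists>G\<in>Lp p sphere_measure. \<forall>h\<in>Lp q sphere_measure. \<Lambda> h = (\<integral>x. h x * G x \<partial>sphere_measure)"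
  proof (rule finite_measure.Riesz_Lp[OF finite_measure_sphere q qp _ _ K0])
    fix g h :: "'a \<Rightarrow> complex" and a b assume L: "g \<in> Lp q sphere_measure" "h \<in> Lp q sphere_measure"
    have "(\<lambda>\<omega>. a * g \<omega> + b * h \<omega>) \<in> Lp q sphere_measure" using q by (intro Lp_add Lp_scale L) auto
    moreover have "S (\<lambda>\<omega>. a * g \<omega> + b * h \<omega>) = (\<lambda>n. a * S g n + b * S h n)"
      by (rule ext) (rule Slin[OF L])
    ultimately have "(\<lambda>n. a * S g n + b * S h n) \<longlonglongrightarrow> \<Lambda> (\<lambda>\<omega>. a * g \<omega> + b * h \<omega>)"
      using lim by metis
    moreover have "(\<lambda>n. a * S g n + b * S h n) \<longlonglongrightarrow> a * \<Lambda> g + b * \<Lambda> h"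
      by (intro tendsto_add tendsto_mult_left lim L)
    ultimately show "\<Lambda> (\<lambda>\<omega>. a * g \<omega> + b * h \<omega>) = a * \<Lambda> g + b * \<Lambda> h" by (rule LIMSEQ_unique)
  next
    fix h :: "'a \<Rightarrow> complex" assume h: "h \<in> Lp q sphere_measure"
    show "norm (\<Lambda> h) \<le> K * lpn q sphere_measure h"
      by (rule tendsto_upperbound[OF tendsto_norm[OF lim[OF h]]]) (simp_all add: Sle[OF h])
  qed
  then obtain G where G: "G \<in> Lp p sphere_measure" "\<And>h. h \<in> Lp q sphere_measure \<Longrightarrow> \<Lambda> h = (\<integral>x. h x * G x \<partial>sphere_measure)"
    by blast
  show ?thesis
  proof (rule that[OF G(1)])
    fix h :: "'a \<Rightarrow> complex" assume h: "h \<in> Lp q sphere_measure"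
    show "(\<lambda>n. \<integral>\<omega>. f n \<omega> * h \<omega> \<partial>sphere_measure) \<longlonglongrightarrow> (\<integral>\<omega>. G \<omega> * h \<omega> \<partial>sphere_measure)"
      using lim[OF h] G(2)[OF h] unfolding S_def by (simp add: mult.commute)
  qed
qed

lemma char_Lp:
  "0 \<le> q \<Longrightarrow> (\<lambda>\<omega>. exp (\<i> * complex_of_real (y \<bullet> \<omega>))) \<in> Lp q sphere_measure"
  using trig_Lp[OF trig.char[of 1 y], of q] by simp

lemma extension_op_weak_limit:
  assumes q: "0 \<le> q" and lim: "\<And>h. h \<in> Lp q sphere_measure \<Longrightarrow>
      (\<lambda>n. \<integral>\<omega>. f n \<omega> * h \<omega> \<partial>sphere_measure) \<longlonglongrightarrow> (\<integral>\<omega>. \<phi> \<omega> * h \<omega> \<partial>sphere_measure)"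
  shows "(\<lambda>n. extension_op (f n) y) \<longlonglongrightarrow> extension_op \<phi> y"
  using lim[OF char_Lp[OF q, of y]] by (simp add: extension_op_def mult.commute)

text \<open>The definition of weak limits quantifies over abstract bounded functionals; by the Riesz
  theorem these are integrals against functions in L^q.\<close>

lemma weak_LlimitI:
  fixes f :: "nat \<Rightarrow> 'a::euclidean_space \<Rightarrow> complex"
  assumes p: "1 < p" and pq: "1/p + 1/q = 1"
    and f: "\<And>n. f n \<in> Lp p sphere_measure" and \<phi>: "\<phi> \<in> Lp p sphere_measure"
    and lim: "\<And>h. h \<in> Lp q sphere_measure \<Longrightarrow>
      (\<lambda>n. \<integral>\<omega>. f n \<omega> * h \<omega> \<partial>sphere_measure) \<longlonglongrightarrow> (\<integral>\<omega>. \<phi> \<omega> * h \<omega> \<partial>sphere_measure)"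
  shows "weak_Llimit (ennreal p) sphere_measure f \<phi>"
proof -
  have p0: "0 < p" using p by simp
  have "(\<lambda>n. \<Lambda> (f n)) \<longlonglongrightarrow> \<Lambda> \<phi>" if \<Lambda>: "bounded_Lfunctional (ennreal p) sphere_measure \<Lambda>" for \<Lambda>
  proof -
    obtain C :: real where C: "\<And>f. f \<in> Lp p sphere_measure \<Longrightarrow> ennreal (norm (\<Lambda> f)) \<le> ennreal C * Lnorm (ennreal p) sphere_measure f"
      using \<Lambda> unfolding bounded_Lfunctional_def Lspace_eq_Lp[OF p0] by blast
    \<comment> \<open>The constant C of \<open>bounded_Lfunctional\<close> may be negative, in which
      case \<open>ennreal C\<close> is 0; the absolute value covers this.\<close>
    have bd: "norm (\<Lambda> f) \<le> \<bar>C\<bar> * lpn p sphere_measure f" if f: "f \<in> Lp p sphere_measure" for f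
    proof -
      have "ennreal (norm (\<Lambda> f)) \<le> ennreal C * ennreal (lpn p sphere_measure f)"
        using C[OF f] Lnorm_eq_lpn[OF p0 f] by simp
      also have "\<dots> \<le> ennreal \<bar>C\<bar> * ennreal (lpn p sphere_measure f)"
        by (intro mult_right_mono ennreal_leI) auto
      also have "\<dots> = ennreal (\<bar>C\<bar> * lpn p sphere_measure f)" by (simp add: ennreal_mult)
      finally show ?thesis by (simp add: ennreal_le_iff)
    qed
    have lin: "\<Lambda> (\<lambda>x. a * f x + b * g x) = a * \<Lambda> f + b * \<Lambda> g"
      if "f \<in> Lp p sphere_measure" "g \<in> Lp p sphere_measure" for f g a b
      using \<Lambda> that unfolding bounded_Lfunctional_def Lspace_eq_Lp[OF p0] by blast
    obtain G where G: "G \<in> Lp q sphere_measure" "\<And>h. h \<in> Lp p sphere_measure \<Longrightarrow> \<Lambda> h = (\<integral>x. h x * G x \<partial>sphere_measure)"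
      using finite_measure.Riesz_Lp[OF finite_measure_sphere p pq lin bd abs_ge_zero] by blast
    show ?thesis using lim[OF G(1)] G(2)[OF f] G(2)[OF \<phi>] by simp
  qed
  then show ?thesis unfolding weak_Llimit_def Lspace_eq_Lp[OF p0] using f \<phi> by blast
qed

section \<open>Interpolation\<close>

text \<open>The factor exp (e (w^2 - 1)) has modulus at most 1 on the strip and decays for large |Im
  w|, so the maximum principle on a large rectangle applies; e then tends to 0.\<close>

lemma three_lines:
  fixes H :: "complex \<Rightarrow> complex"
  assumes holo: "H holomorphic_on UNIV"
    and bd: "\<And>z. 0 \<le> Re z \<Longrightarrow> Re z \<le> 1 \<Longrightarrow> norm (H z) \<le> B"
    and left: "\<And>z. Re z = 0 \<Longrightarrow> norm (H z) \<le> 1" and right: "\<And>z. Re z = 1 \<Longrightarrow> norm (H z) \<le> 1"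
    and z: "0 \<le> Re z" "Re z \<le> 1"
  shows "norm (H z) \<le> 1"
proof -
  define c where "c = (Re z)\<^sup>2 - (Im z)\<^sup>2 - 1"
  have B0: "0 \<le> B" using order_trans[OF norm_ge_zero bd[of 0]] by simp
  have key: "norm (H z) \<le> exp (- (e * c))" if e: "0 < e" for e
  proof -
    define G where "G w = H w * exp (complex_of_real e * (w\<^sup>2 - 1))" for w
    have Gn: "norm (G w) = norm (H w) * exp (e * ((Re w)\<^sup>2 - (Im w)\<^sup>2 - 1))" for w
      by (simp add: G_def norm_mult power2_eq_square)
    \<comment> \<open>The rectangle contains z, and e R^2 >= B, so that on the horizontal edges the
      modulus is at most B exp (- B) <= 1.\<close>
    define R where "R = \<bar>Im z\<bar> + sqrt (B / e)"
    have R: "\<bar>Im z\<bar> \<le> R" "B / e \<le> R\<^sup>2"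
    proof -
      have s: "0 \<le> sqrt (B / e)" using B0 e by simp
      then show "\<bar>Im z\<bar> \<le> R" by (simp add: R_def)
      have "(sqrt (B / e))\<^sup>2 \<le> R\<^sup>2" using s by (intro power_mono) (auto simp: R_def)
      then show "B / e \<le> R\<^sup>2" using B0 e by simp
    qed
    define S where "S = cbox (Complex 0 (- R)) (Complex 1 R)"
    have "norm (G z) \<le> 1"
    proof (rule maximum_modulus_frontier[of G S])
      have "G holomorphic_on UNIV" unfolding G_def by (intro holomorphic_intros holo)
      then show "G holomorphic_on interior S" "continuous_on (closure S) G"
        by (auto intro: holomorphic_on_subset holomorphic_on_imp_continuous_on continuous_on_subset)
      show "bounded S" by (simp add: S_def bounded_cbox)
      show "z \<in> S" using z R(1) by (simp add: S_def in_cbox_complex_iff abs_le_iff)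
      fix w assume "w \<in> frontier S"
      then have w: "w \<in> S" "w \<notin> box (Complex 0 (- R)) (Complex 1 R)" by (auto simp: S_def frontier_cbox)
      then have wS: "0 \<le> Re w" "Re w \<le> 1" "- R \<le> Im w" "Im w \<le> R" by (auto simp: S_def in_cbox_complex_iff)
      have sq: "(Re w)\<^sup>2 \<le> 1" using wS by (simp add: power_le_one)
      have ex: "exp (e * ((Re w)\<^sup>2 - (Im w)\<^sup>2 - 1)) \<le> exp (- (e * (Im w)\<^sup>2))"
        using sq e mult_left_mono[of "(Re w)\<^sup>2" 1 e] by (simp add: algebra_simps)
      have "Re w = 0 \<or> Re w = 1 \<or> (Im w)\<^sup>2 = R\<^sup>2"
        using w wS by (auto simp: in_box_complex_iff not_less power2_eq_iff)
      then consider "norm (H w) \<le> 1" | "(Im w)\<^sup>2 = R\<^sup>2" using left right by blast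
      then show "norm (G w) \<le> 1"
      proof cases
        case 1
        have "norm (H w) * exp (e * ((Re w)\<^sup>2 - (Im w)\<^sup>2 - 1)) \<le> 1 * 1"
        proof (rule mult_mono[OF 1])
          show "exp (e * ((Re w)\<^sup>2 - (Im w)\<^sup>2 - 1)) \<le> 1" by (rule order_trans[OF ex]) (use e in simp)
        qed auto
        then show ?thesis by (simp add: Gn)
      next
        case 2
        have "B \<le> e * R\<^sup>2" using R(2) e by (simp add: divide_le_eq mult.commute)
        have "norm (H w) * exp (e * ((Re w)\<^sup>2 - (Im w)\<^sup>2 - 1)) \<le> B * exp (- B)"
        proof (rule mult_mono[OF bd[OF wS(1,2)]])
          show "exp (e * ((Re w)\<^sup>2 - (Im w)\<^sup>2 - 1)) \<le> exp (- B)"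
            by (rule order_trans[OF ex]) (use 2 \<open>B \<le> e * R\<^sup>2\<close> in simp)
        qed (use B0 in auto)
        also have "B * exp (- B) \<le> 1"
        proof -
          have "B \<le> exp B" using exp_ge_add_one_self[of B] by linarith
          then show ?thesis by (simp add: exp_minus divide_le_eq flip: divide_inverse)
        qed
        finally show ?thesis by (simp add: Gn)
      qed
    qed
    then have "norm (H z) * exp (e * c) \<le> 1" by (simp add: Gn c_def)
    then show ?thesis by (simp add: exp_minus field_simps)
  qed
  have "isCont (\<lambda>e. exp (- (e * c))) 0" by (intro continuous_intros)
  from le_limit_right[OF key this] show ?thesis by simp
qed

text \<open>The analytic family through \<open>w / a\<close> used for interpolation: its modulus at \<open>z\<close> is
  \<open>(|w| / a) powr (q * (1 - Re z / 2))\<close>.\<close>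

definition interp :: "real \<Rightarrow> real \<Rightarrow> complex \<Rightarrow> complex \<Rightarrow> complex" where
  "interp q a w z = (if w = 0 then 0 else sgn w * exp (complex_of_real (q * ln (norm w / a)) * (1 - z / 2)))"

lemma norm_interp: "0 < a \<Longrightarrow> norm (interp q a w z) = (norm w / a) powr (q * (1 - Re z / 2))"
  by (simp add: interp_def norm_mult norm_sgn powr_def mult_ac)

lemma interp_holomorphic: "interp q a w holomorphic_on UNIV"
  unfolding interp_def[abs_def] by (cases "w = 0") (auto intro!: holomorphic_intros)

lemma interp_at:
  assumes a: "0 < a" and q: "q * (1 - \<theta> / 2) = 1"
  shows "interp q a w (complex_of_real \<theta>) = w / complex_of_real a"
proof (cases "w = 0")
  case False
  have "complex_of_real (q * ln (norm w / a)) * (1 - complex_of_real \<theta> / 2)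
    = complex_of_real ((q * (1 - \<theta> / 2)) * ln (norm w / a))"
    by (simp add: algebra_simps)
  then have "exp (complex_of_real (q * ln (norm w / a)) * (1 - complex_of_real \<theta> / 2)) = complex_of_real (norm w / a)"
    using a False q by (simp only: exp_of_real mult_1) simp
  then show ?thesis using False by (simp add: interp_def sgn_div_norm scaleR_conv_of_real field_simps)
qed (simp add: interp_def)

lemma norm_interp_le:
  assumes a: "0 < a" and q: "0 \<le> q" and z: "0 \<le> Re z" "Re z \<le> 1"
  shows "norm (interp q a w z) \<le> 1 + (norm w / a) powr q"
proof (cases "norm w / a \<le> 1")
  case True
  have "(norm w / a) powr (q * (1 - Re z / 2)) \<le> 1"
    using True a q z by (intro powr_le1) auto
  then show ?thesis unfolding norm_interp[OF a] by (simp add: add_increasing2)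
next
  case False
  have "q * (1 - Re z / 2) \<le> q * 1" using q z by (intro mult_left_mono) auto
  then have "(norm w / a) powr (q * (1 - Re z / 2)) \<le> (norm w / a) powr q"
    using False by (intro powr_mono) auto
  then show ?thesis unfolding norm_interp[OF a] by simp
qed

context finite_measure begin

text \<open>Riesz-Thorin interpolation between l^1 to L^infinity, from |e j| <= 1, and l^2 to L^2,
  from the Bessel-type bound, in dual form. As g is simple, \<open>H\<close> is a finite sum of
  explicit entire functions.\<close>

lemma HY_simple:
  fixes e :: "nat \<Rightarrow> 'a \<Rightarrow> complex" and c :: "nat \<Rightarrow> complex"
  assumes p: "2 \<le> p" and pq: "1/p + 1/q = 1" and K: "0 < K"
    and em: "\<And>j. e j \<in> borel_measurable M" and e1: "\<And>j x. norm (e j x) \<le> 1"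
    and Bessel: "\<And>c. Ip 2 M (\<lambda>x. \<Sum>j<J. c j * e j x) \<le> K * (\<Sum>j<J. (norm (c j))\<^sup>2)"
    and g: "simple_function M g"
  shows "norm (\<integral>x. (\<Sum>j<J. c j * e j x) * g x \<partial>M) \<le> K powr (1/p) * (\<Sum>j<J. norm (c j) powr q) powr (1/q) * lpn q M g"
proof -
  have p1: "1 < p" using p by simp
  have q: "1 < q" using conjugate_exponent[OF p1 pq] by simp
  have [measurable]: "e j \<in> borel_measurable M" for j by (rule em)
  have gm [measurable]: "g \<in> borel_measurable M" using g by (rule borel_measurable_simple_function)
  define V where "V = g ` space M"
  have V: "finite V" using simple_functionD(1)[OF g] by (simp add: V_def)
  obtain N where N: "\<And>x. x \<in> space M \<Longrightarrow> norm (g x) \<le> N"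
    using finite_imp_bounded[OF V] unfolding bounded_iff V_def by blast
  have gL: "g \<in> Lp r M" if "0 \<le> r" for r by (rule Lp_bounded[OF gm N that])
  have sb: "norm (\<Sum>j<J. c j * e j x) \<le> (\<Sum>j<J. norm (c j))" for c x
  proof (rule order_trans[OF norm_sum], rule sum_mono)
    fix j show "norm (c j * e j x) \<le> norm (c j)" using e1[of j x] by (simp add: norm_mult mult_left_le)
  qed
  have FL: "(\<lambda>x. \<Sum>j<J. c j * e j x) \<in> Lp r M" if "0 \<le> r" for c r
    by (rule Lp_bounded[OF _ sb that]) measurable
  define a where "a = (\<Sum>j<J. norm (c j) powr q) powr (1/q)"
  define b where "b = lpn q M g"
  have aq: "a powr q = (\<Sum>j<J. norm (c j) powr q)" using q by (simp add: a_def powr_powr sum_nonneg)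
  have bq: "b powr q = Ip q M g" using q by (simp add: b_def lpn_powr)
  \<comment> \<open>\<open>interp\<close> divides by a and b, so the degenerate cases are settled
    first.\<close>
  consider "a = 0" | "b = 0" | "0 < a" "0 < b" by (metis a_def b_def less_eq_real_def lpn_nonneg powr_ge_zero)
  then have "norm (\<integral>x. (\<Sum>j<J. c j * e j x) * g x \<partial>M) \<le> K powr (1/p) * a * b"
  proof cases
    case 1
    then have "\<forall>j\<in>{..<J}. norm (c j) powr q = 0" using aq by (subst sum_nonneg_eq_0_iff[symmetric]) auto
    then show ?thesis using 1 by simp
  next
    case 2
    then show ?thesis using Holder(3)[OF p1 q pq FL gL[of q], of c] p1 q by (simp add: b_def)
  next
    case 3
    define P where "P j z = interp q a (c j) z" for j z
    define G where "G z x = interp q b (g x) z" for z x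
    define H where "H z = (\<integral>x. (\<Sum>j<J. P j z * e j x) * G z x \<partial>M)" for z
    have V': "G z x = (\<Sum>v\<in>V. interp q b v z * indicator (g -` {v} \<inter> space M) x)" if "x \<in> space M" for z x
    proof -
      have "(\<Sum>v\<in>V. interp q b v z * indicator (g -` {v} \<inter> space M) x) = (\<Sum>v\<in>V. if v = g x then interp q b v z else 0)"
        using that by (intro sum.cong refl) (auto simp: indicator_def)
      also have "\<dots> = interp q b (g x) z" using V that by (simp add: sum.delta V_def)
      finally show ?thesis by (simp add: G_def)
    qed
    have Gm: "G z \<in> borel_measurable M" for z
    proof -
      have "(\<lambda>x. interp q b (g x) z) \<in> borel_measurable M"
        by (rule borel_measurable_simple_function, rule simple_function_compose1[OF g])
      then show ?thesis by (simp add: G_def[abs_def])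
    qed
    have Gb: "norm (G z x) = (norm (g x) / b) powr (q * (1 - Re z / 2))" for z x
      unfolding G_def by (rule norm_interp[OF 3(2)])
    have GL: "G z \<in> Lp r M" if "0 \<le> r" "0 \<le> Re z" "Re z \<le> 1" for r z
    proof (rule Lp_bounded[OF Gm _ that(1)])
      fix x assume "x \<in> space M"
      then have "(norm (g x) / b) powr q \<le> (N / b) powr q" using N 3 q by (intro powr_mono2 divide_right_mono) auto
      then show "norm (G z x) \<le> 1 + (N / b) powr q"
        using norm_interp_le[OF 3(2) _ that(2,3), of q "g x"] q by (simp add: G_def)
    qed
    have Pn: "norm (P j z) = (norm (c j) / a) powr (q * (1 - Re z / 2))" for j z
      unfolding P_def by (rule norm_interp[OF 3(1)])
    have sumP: "(\<Sum>j<J. (norm (c j) / a) powr q) = 1"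
    proof -
      have "(\<Sum>j<J. (norm (c j) / a) powr q) = (\<Sum>j<J. norm (c j) powr q) / a powr q"
        using 3 by (simp add: powr_divide sum_divide_distrib)
      then show ?thesis using 3 by (simp add: aq[symmetric])
    qed
    have intG: "(\<integral>x. (norm (g x) / b) powr q \<partial>M) = 1"
    proof -
      have "(\<integral>x. (norm (g x) / b) powr q \<partial>M) = Ip q M g / b powr q"
        using 3 by (simp add: powr_divide Ip_def)
      then show ?thesis using 3 by (simp add: bq[symmetric])
    qed
    \<comment> \<open>These coefficients do not depend on z, which makes the holomorphy of H
      evident.\<close>
    define m where "m j v = (\<integral>x. e j x * indicator (g -` {v} \<inter> space M) x \<partial>M)" for j v
    have im: "integrable M (\<lambda>x. e j x * indicator (g -` {v} \<inter> space M) x)" for j v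
    proof (rule integrable_const_bound[of _ 1])
      have "g -` {v} \<inter> space M \<in> sets M" by (rule simple_functionD(2)[OF g])
      then show "(\<lambda>x. e j x * indicator (g -` {v} \<inter> space M) x) \<in> borel_measurable M" by measurable
      show "AE x in M. norm (e j x * indicator (g -` {v} \<inter> space M) x) \<le> 1"
        using e1[of j] by (auto simp: indicator_def)
    qed
    have Hsum: "H z = (\<Sum>j<J. \<Sum>v\<in>V. P j z * interp q b v z * m j v)" for z
    proof -
      have "H z = (\<integral>x. (\<Sum>j<J. \<Sum>v\<in>V. P j z * interp q b v z * (e j x * indicator (g -` {v} \<inter> space M) x)) \<partial>M)"
        unfolding H_def
      proof (rule Bochner_Integration.integral_cong[OF refl])
        fix x assume "x \<in> space M"
        show "(\<Sum>j<J. P j z * e j x) * G z x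
          = (\<Sum>j<J. \<Sum>v\<in>V. P j z * interp q b v z * (e j x * indicator (g -` {v} \<inter> space M) x))"
          unfolding V'[OF \<open>x \<in> space M\<close>] sum_product by (simp only: mult_ac)
      qed
      also have "\<dots> = (\<Sum>j<J. \<Sum>v\<in>V. P j z * interp q b v z * m j v)"
        unfolding m_def using im by simp
      finally show ?thesis .
    qed
    \<comment> \<open>The factor K^(-z/2) cancels the bound K^(1/2) on Re z = 1 and has modulus 1 on
      Re z = 0.\<close>
    define H1 where "H1 z = H z * exp (- (complex_of_real (ln K) * z / 2))" for z
    have H1n: "norm (H1 z) = norm (H z) * exp (- (ln K * Re z / 2))" for z by (simp add: H1_def norm_mult)
    \<comment> \<open>The point with 1 - \<theta>/2 = 1/q, where the families pass through c j / a
      and g / b; there K^(\<theta>/2) = K^(1/p).\<close>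
    define \<theta> where "\<theta> = 2 / p"
    have \<theta>: "0 \<le> \<theta>" "\<theta> \<le> 1" "q * (1 - \<theta> / 2) = 1"
    proof -
      have "1 - \<theta> / 2 = 1 / q" using pq by (simp add: \<theta>_def)
      then show "q * (1 - \<theta> / 2) = 1" using q by simp
    qed (use p in \<open>auto simp: \<theta>_def\<close>)
    define B1 where "B1 = (\<Sum>j<J. \<Sum>v\<in>V. (1 + (norm (c j) / a) powr q) * (1 + (norm v / b) powr q) * norm (m j v))"
    have B10: "0 \<le> B1" unfolding B1_def by (rule sum_nonneg, rule sum_nonneg) simp
    have "norm (H1 (complex_of_real \<theta>)) \<le> 1"
    proof (rule three_lines[where B = "B1 * exp \<bar>ln K\<bar>" and H = H1])
      show "H1 holomorphic_on UNIV"
        unfolding H1_def[abs_def] Hsum P_def by (intro holomorphic_intros interp_holomorphic) auto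
      show "norm (H1 z) \<le> B1 * exp \<bar>ln K\<bar>" if z: "0 \<le> Re z" "Re z \<le> 1" for z
        unfolding H1n
      proof (rule mult_mono)
        show "norm (H z) \<le> B1" unfolding Hsum B1_def
        proof (intro order_trans[OF norm_sum] sum_mono)
          fix j v
          show "norm (P j z * interp q b v z * m j v) \<le> (1 + (norm (c j) / a) powr q) * (1 + (norm v / b) powr q) * norm (m j v)"
            unfolding norm_mult P_def using q z 3
            by (intro mult_mono norm_interp_le mult_nonneg_nonneg add_nonneg_nonneg) auto
        qed
        have "\<bar>ln K * Re z / 2\<bar> \<le> \<bar>ln K\<bar>"
          using z mult_left_mono[of "Re z / 2" 1 "\<bar>ln K\<bar>"] by (simp add: abs_mult)
        then show "exp (- (ln K * Re z / 2)) \<le> exp \<bar>ln K\<bar>" by simp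
      qed (use B10 in auto)
      show "norm (H1 z) \<le> 1" if z: "Re z = 0" for z
      proof -
        \<comment> \<open>On this line the moduli of P j z sum to 1 and that of G z has integral
          1.\<close>
        have le: "norm ((\<Sum>j<J. P j z * e j x) * G z x) \<le> (norm (g x) / b) powr q" for x
        proof -
          have "norm (\<Sum>j<J. P j z * e j x) \<le> (\<Sum>j<J. norm (P j z))" by (rule sb)
          also have "\<dots> = 1" using sumP by (simp add: Pn z)
          finally have "norm (\<Sum>j<J. P j z * e j x) * norm (G z x) \<le> 1 * norm (G z x)" by (intro mult_right_mono) auto
          then show ?thesis by (simp add: norm_mult Gb z)
        qed
        have ig: "integrable M (\<lambda>x. (norm (g x) / b) powr q)"
          using Lp_integrable[OF gL[of q]] q 3 by (simp add: powr_divide)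
        have iH: "integrable M (\<lambda>x. (\<Sum>j<J. P j z * e j x) * G z x)"
          by (rule Holder(1)[of 2 2, OF _ _ _ FL GL]) (use z in auto)
        have "norm (H z) \<le> (\<integral>x. (norm (g x) / b) powr q \<partial>M)"
          unfolding H_def by (rule order_trans[OF integral_norm_bound], rule integral_mono[OF integrable_norm[OF iH] ig le])
        then show ?thesis using intG z by (simp add: H1n)
      qed
      show "norm (H1 z) \<le> 1" if z: "Re z = 1" for z
      proof -
        \<comment> \<open>On this line the coefficients P j z and the function G z have l^2 and L^2
          norm 1, and the Bessel-type bound applies.\<close>
        have h2: "1 < (2::real)" "1/2 + 1/2 = (1::real)" by auto
        have "norm (H z) \<le> lpn 2 M (\<lambda>x. \<Sum>j<J. P j z * e j x) * lpn 2 M (G z)"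
          unfolding H_def by (rule Holder(3)[OF h2(1,1,2) FL GL]) (use z in auto)
        also have "lpn 2 M (G z) = 1"
        proof -
          have "norm (G z x) powr 2 = (norm (g x) / b) powr q" for x by (simp add: Gb z powr_powr)
          then show ?thesis using intG by (simp add: lpn_def Ip_def)
        qed
        also have "lpn 2 M (\<lambda>x. \<Sum>j<J. P j z * e j x) \<le> K powr (1/2)"
        proof -
          have "(norm (P j z))\<^sup>2 = (norm (c j) / a) powr q" for j
          proof (cases "P j z = 0")
            case False
            then have "(norm (P j z))\<^sup>2 = norm (P j z) powr 2" by (simp add: powr_numeral)
            then show ?thesis by (simp add: Pn z powr_powr)
          next
            case True
            then have "(norm (c j) / a) powr (q / 2) = 0" using Pn[of j z] z by simp
            then show ?thesis using True by simp
          qed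
          then have "Ip 2 M (\<lambda>x. \<Sum>j<J. P j z * e j x) \<le> K * 1"
            using Bessel[of "\<lambda>j. P j z"] sumP by simp
          then show ?thesis unfolding lpn_def by (intro powr_mono2) auto
        qed
        finally have "norm (H z) \<le> K powr (1/2)" by simp
        moreover have "exp (- (ln K * Re z / 2)) = K powr (- (1/2))" using K z by (simp add: powr_def)
        ultimately have "norm (H1 z) \<le> K powr (1/2) * K powr (- (1/2))" unfolding H1n by (intro mult_mono) auto
        also have "\<dots> = 1" using K by (simp flip: powr_add)
        finally show ?thesis .
      qed
    qed (use \<theta> in auto)
    moreover have "exp (- (ln K * \<theta> / 2)) = K powr (- (1/p))" using K by (simp add: powr_def \<theta>_def)
    ultimately have "norm (H (complex_of_real \<theta>)) * K powr (- (1/p)) \<le> 1" by (simp add: H1n)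
    then have "norm (H (complex_of_real \<theta>)) \<le> K powr (1/p)" using K by (simp add: powr_minus field_simps)
    moreover have "H (complex_of_real \<theta>) = (\<integral>x. (\<Sum>j<J. c j * e j x) * g x \<partial>M) / complex_of_real (a * b)"
    proof -
      have "(\<Sum>j<J. P j (complex_of_real \<theta>) * e j x) * G (complex_of_real \<theta>) x = ((\<Sum>j<J. c j * e j x) * g x) / complex_of_real (a * b)" for x
        unfolding P_def G_def interp_at[OF 3(1) \<theta>(3)] interp_at[OF 3(2) \<theta>(3)]
        by (simp flip: sum_divide_distrib)
      then show ?thesis unfolding H_def by simp
    qed
    ultimately have "norm (\<integral>x. (\<Sum>j<J. c j * e j x) * g x \<partial>M) / (a * b) \<le> K powr (1/p)"
      using 3 by (simp add: norm_divide norm_mult)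
    then show ?thesis using 3 by (simp add: divide_le_eq mult.assoc)
  qed
  then show ?thesis by (simp add: a_def b_def)
qed

text \<open>The \<open>e j\<close> need not be orthonormal: the Bessel-type bound with constant \<open>K\<close> allows approximately
  orthogonal families, and cutting the \<open>e j\<close> off by an indicator.\<close>

lemma HY_finite:
  fixes e :: "nat \<Rightarrow> 'a \<Rightarrow> complex" and c :: "nat \<Rightarrow> complex"
  assumes p: "2 \<le> p" and pq: "1/p + 1/q = 1" and K: "0 < K"
    and em: "\<And>j. e j \<in> borel_measurable M" and e1: "\<And>j x. norm (e j x) \<le> 1"
    and Bessel: "\<And>c. Ip 2 M (\<lambda>x. \<Sum>j<J. c j * e j x) \<le> K * (\<Sum>j<J. (norm (c j))\<^sup>2)"
  shows "Ip p M (\<lambda>x. \<Sum>j<J. c j * e j x) \<le> K * (\<Sum>j<J. norm (c j) powr q) powr (p/q)"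
proof -
  have p1: "1 < p" using p by simp
  have q: "1 < q" "q = p / (p - 1)" using conjugate_exponent[OF p1 pq] by auto
  have [measurable]: "e j \<in> borel_measurable M" for j by (rule em)
  define F where "F x = (\<Sum>j<J. c j * e j x)" for x
  define C where "C = K powr (1/p) * (\<Sum>j<J. norm (c j) powr q) powr (1/q)"
  define I where "I = Ip p M F"
  have Fm [measurable]: "F \<in> borel_measurable M" unfolding F_def by measurable
  have "norm (F x) \<le> (\<Sum>j<J. norm (c j))" for x unfolding F_def
  proof (rule order_trans[OF norm_sum], rule sum_mono)
    fix j show "norm (c j * e j x) \<le> norm (c j)" using e1[of j x] by (simp add: norm_mult mult_left_le)
  qed
  then have FL: "F \<in> Lp p M" using p by (intro Lp_bounded[OF Fm]) auto
  \<comment> \<open>Dual function of F: F G = |F|^p = |G|^q. Testing \<open>HY_simple\<close> on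
    simple approximations of G gives I <= C I^(1/q) for the integral I of |F|^p.\<close>
  define G where "G x = complex_of_real (norm (F x) powr (p - 2)) * cnj (F x)" for x
  have Gm [measurable]: "G \<in> borel_measurable M" unfolding G_def by measurable
  have Gn: "norm (G x) = norm (F x) powr (p - 1)" for x unfolding G_def by (rule norm_powr_cnj)
  have Gq: "norm (G x) powr q = norm (F x) powr p" for x
  proof -
    have "(p - 1) * q = p" unfolding q(2) using p by simp
    then show ?thesis by (simp add: Gn powr_powr)
  qed
  have GL: "G \<in> Lp q M" using FL by (intro LpI) (auto simp: Gq Lp_integrable)
  have FG: "F x * G x = complex_of_real (norm (F x) powr p)" for x
  proof (cases "F x = 0")
    case False
    have "F x * G x = complex_of_real (norm (F x) powr (p - 2)) * (F x * cnj (F x))" by (simp add: G_def)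
    also have "F x * cnj (F x) = complex_of_real ((norm (F x))\<^sup>2)" by (rule complex_norm_square[symmetric])
    also have "complex_of_real (norm (F x) powr (p - 2)) * complex_of_real ((norm (F x))\<^sup>2)
      = complex_of_real (norm (F x) powr (p - 2) * (norm (F x))\<^sup>2)" by (simp only: of_real_mult)
    also have "norm (F x) powr (p - 2) * (norm (F x))\<^sup>2 = norm (F x) powr p"
      using False by (simp add: powr_diff powr_numeral)
    finally show ?thesis .
  qed (use p in simp)
  obtain g where g: "\<And>k. simple_function M (g k)" "\<And>x. x \<in> space M \<Longrightarrow> (\<lambda>k. g k x) \<longlonglongrightarrow> G x"
    "\<And>k x. x \<in> space M \<Longrightarrow> dist (g k x) 0 \<le> 2 * dist (G x) 0"
    using borel_measurable_implies_sequence_metric[OF Gm, of 0] by blast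
  have gm [measurable]: "g k \<in> borel_measurable M" for k using g(1) by (rule borel_measurable_simple_function)
  have gL: "g k \<in> Lp q M" for k
    by (rule Lp_mono[OF Lp_scale[OF GL, of 2] gm]) (use q g(3) in \<open>auto simp: norm_mult\<close>)
  have lim0: "(\<lambda>k. lpn q M (\<lambda>x. g k x - G x)) \<longlonglongrightarrow> 0"
  proof (rule lpn_tendsto_dominated[OF _ _ Lp_scale[OF GL, of 3]])
    show "(\<lambda>k. g k x - G x) \<longlonglongrightarrow> 0" if "x \<in> space M" for x
      using tendsto_diff[OF g(2)[OF that] tendsto_const, of "G x"] by simp
    show "norm (g k x - G x) \<le> norm (3 * G x)" if "x \<in> space M" for k x
      using g(3)[OF that, of k] norm_triangle_ineq4[of "g k x" "G x"] by (simp add: norm_mult)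
  qed (use q in auto)
  have est: "I \<le> C * lpn q M G + (C + lpn p M F) * lpn q M (\<lambda>x. g k x - G x)" for k
  proof -
    have "complex_of_real I = (\<integral>x. F x * G x \<partial>M)" unfolding FG I_def Ip_def by simp
    also have "\<dots> = (\<integral>x. F x * g k x - F x * (g k x - G x) \<partial>M)" by (simp add: algebra_simps)
    also have "\<dots> = (\<integral>x. F x * g k x \<partial>M) - (\<integral>x. F x * (g k x - G x) \<partial>M)"
      using q by (intro Bochner_Integration.integral_diff Holder(1)[OF p1 q(1) pq FL] gL Lp_diff GL) auto
    also have "norm \<dots> \<le> norm (\<integral>x. F x * g k x \<partial>M) + norm (\<integral>x. F x * (g k x - G x) \<partial>M)"
      by (rule norm_triangle_ineq4)
    also have "\<dots> \<le> C * lpn q M (g k) + lpn p M F * lpn q M (\<lambda>x. g k x - G x)"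
    proof (intro add_mono)
      show "norm (\<integral>x. F x * g k x \<partial>M) \<le> C * lpn q M (g k)"
        unfolding F_def C_def by (rule HY_simple[OF p pq K em e1 Bessel g(1)])
      show "norm (\<integral>x. F x * (g k x - G x) \<partial>M) \<le> lpn p M F * lpn q M (\<lambda>x. g k x - G x)"
        using q by (intro Holder(3)[OF p1 q(1) pq FL] Lp_diff gL GL) auto
    qed
    also have "\<dots> \<le> C * (lpn q M G + lpn q M (\<lambda>x. g k x - G x)) + lpn p M F * lpn q M (\<lambda>x. g k x - G x)"
      using lpn_diff_abs[OF _ gL[of k] GL] q by (intro add_right_mono mult_left_mono) (auto simp: C_def)
    finally show ?thesis by (simp add: I_def algebra_simps)
  qed
  have "(\<lambda>k. C * lpn q M G + (C + lpn p M F) * lpn q M (\<lambda>x. g k x - G x)) \<longlonglongrightarrow> C * lpn q M G + (C + lpn p M F) * 0"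
    by (intro tendsto_add tendsto_const tendsto_mult_left lim0)
  from LIMSEQ_le_const[OF this] est have "I \<le> C * lpn q M G + (C + lpn p M F) * 0" by blast
  moreover have "lpn q M G = I powr (1/q)" by (simp add: lpn_def I_def Ip_def Gq)
  ultimately have le: "I \<le> C * I powr (1/q)" by simp
  have Cp: "C powr p = K * (\<Sum>j<J. norm (c j) powr q) powr (p/q)"
    using K p by (simp add: C_def powr_mult powr_powr)
  have "I \<le> C powr p"
  proof (cases "I = 0")
    case False
    then have pos: "0 < I" using Ip_nonneg[of p M F] unfolding I_def by linarith
    have "I powr (1/p) = I powr (1 - 1/q)" using pq by (intro arg_cong2[of _ _ _ _ "(powr)"]) auto
    also have "\<dots> = I / I powr (1/q)" using pos by (simp add: powr_diff)
    also have "\<dots> \<le> C" using le pos by (simp add: divide_le_eq)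
    finally have "(I powr (1/p)) powr p \<le> C powr p" using p by (intro powr_mono2) auto
    then show ?thesis using p pos by (simp add: powr_powr)
  qed simp
  then show ?thesis unfolding Cp by (simp add: I_def F_def[abs_def])
qed

end

section \<open>Asymptotic orthogonality of modulations\<close>

lemma powr_subadd:
  fixes x y a :: real
  assumes "0 \<le> x" "0 \<le> y" "0 < a" "a \<le> 1"
  shows "(x + y) powr a \<le> x powr a + y powr a"
proof (cases "x + y = 0")
  case True
  then have "x = 0" "y = 0" using assms by auto
  then show ?thesis by simp
next
  case False
  define s where "s = x + y"
  have s: "0 < s" using False assms by (simp add: s_def)
  have ge: "t / s \<le> (t / s) powr a" if "0 \<le> t" "t \<le> s" for t
    using powr_mono'[of a 1 "t / s"] that s assms by simp
  have "s powr a = (x / s + y / s) * s powr a" using s by (simp add: s_def add_divide_distrib[symmetric])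
  also have "\<dots> \<le> ((x / s) powr a + (y / s) powr a) * s powr a"
    using assms by (intro mult_right_mono add_mono ge) (auto simp: s_def)
  also have "\<dots> = x powr a + y powr a" using s by (simp add: powr_divide distrib_right)
  finally show ?thesis by (simp add: s_def)
qed

lemma powr_sum_le:
  fixes x :: "nat \<Rightarrow> real"
  assumes "\<And>j. 0 \<le> x j" "0 < a" "a \<le> 1"
  shows "(\<Sum>j<J. x j) powr a \<le> (\<Sum>j<J. x j powr a)"
proof (induction J)
  case (Suc J)
  have "(\<Sum>j<Suc J. x j) powr a \<le> (\<Sum>j<J. x j) powr a + x J powr a"
    using assms by (simp add: powr_subadd sum_nonneg)
  then show ?case using Suc by simp
qed simp

definition wave :: "'a::euclidean_space set \<Rightarrow> 'a \<Rightarrow> 'a \<Rightarrow> complex" where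
  "wave B y \<omega> = indicator B \<omega> * exp (\<i> * complex_of_real (y \<bullet> \<omega>))"

lemma wave_measurable: "B \<in> sets borel \<Longrightarrow> wave B y \<in> borel_measurable sphere_measure"
  unfolding wave_def[abs_def]
  by (intro borel_measurable_sphere borel_measurable_times borel_measurable_indicator
      borel_measurable_continuous_onI continuous_intros)

lemma norm_wave_le: "norm (wave B y \<omega>) \<le> 1"
  by (simp add: wave_def norm_mult indicator_def)

lemma extension_op_indicator_0:
  "extension_op (indicator B) 0 = complex_of_real (\<integral>\<omega>. indicator B \<omega> \<partial>sphere_measure)"
proof -
  have "extension_op (indicator B) 0 = (\<integral>\<omega>. complex_of_real (indicator B \<omega>) \<partial>sphere_measure)"
    unfolding extension_op_def by (rule Bochner_Integration.integral_cong) (auto simp: indicator_def)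
  then show ?thesis by simp
qed

text \<open>The Gram matrix of the waves has the entries
  \<open>extension_op (indicator B) (x j - x k)\<close>: the diagonal gives the measure s of B, and
  the other entries become small when the points separate.\<close>

lemma wave_Bessel:
  fixes x :: "nat \<Rightarrow> 'a::euclidean_space" and c :: "nat \<Rightarrow> complex"
  assumes B: "B \<in> sets borel"
  defines "s \<equiv> (\<integral>\<omega>. indicator B \<omega> \<partial>(sphere_measure :: 'a measure)) :: real"
  shows "Ip 2 sphere_measure (\<lambda>\<omega>. \<Sum>j<J. c j * wave B (x j) \<omega>)
    \<le> (s + (\<Sum>j<J. \<Sum>k\<in>{..<J} - {j}. norm (extension_op (indicator B) (x j - x k)))) * (\<Sum>j<J. (norm (c j))\<^sup>2)"
proof -
  define T where "T = (\<Sum>j<J. (norm (c j))\<^sup>2)"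
  define m where "m j k = extension_op (indicator B) (x j - x k)" for j k
  have s0: "0 \<le> s" unfolding s_def by simp
  \<comment> \<open>A crude bound by the arithmetic-geometric mean inequality; it suffices because J
    is fixed and its coefficients tend to 0.\<close>
  have cT: "norm (c j) * norm (c k) \<le> T" if "j < J" "k < J" for j k
  proof -
    have sq: "(norm (c i))\<^sup>2 \<le> T" if "i < J" for i unfolding T_def using that by (intro member_le_sum) auto
    have "(norm (c j))\<^sup>2 + (norm (c k))\<^sup>2 \<le> 2 * T" using sq[OF that(1)] sq[OF that(2)] by linarith
    then show ?thesis using sum_squares_bound[of "norm (c j)" "norm (c k)"] by linarith
  qed
  have int: "integrable sphere_measure (\<lambda>\<omega>. wave B (x j) \<omega> * cnj (wave B (x k) \<omega>))" for j k
  proof (rule finite_measure.integrable_const_bound[OF finite_measure_sphere, of _ 1])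
    show "AE \<omega> in sphere_measure. norm (wave B (x j) \<omega> * cnj (wave B (x k) \<omega>)) \<le> 1"
      by (auto simp: norm_mult intro!: mult_le_one norm_wave_le)
    show "(\<lambda>\<omega>. wave B (x j) \<omega> * cnj (wave B (x k) \<omega>)) \<in> borel_measurable sphere_measure"
      by (intro borel_measurable_times wave_measurable[OF B] measurable_compose[OF wave_measurable[OF B] borel_measurable_cnj])
  qed
  have mi: "(\<integral>\<omega>. wave B (x j) \<omega> * cnj (wave B (x k) \<omega>) \<partial>sphere_measure) = m j k" for j k
    unfolding m_def extension_op_def
  proof (rule Bochner_Integration.integral_cong[OF refl])
    fix \<omega>
    have cj: "cnj (exp (\<i> * complex_of_real t)) = exp (- (\<i> * complex_of_real t))" for t by (simp add: exp_cnj)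
    have "exp (\<i> * complex_of_real (x j \<bullet> \<omega>)) * exp (- (\<i> * complex_of_real (x k \<bullet> \<omega>)))
      = exp (\<i> * complex_of_real ((x j - x k) \<bullet> \<omega>))"
      by (simp add: inner_diff_left right_diff_distrib flip: exp_add)
    then show "wave B (x j) \<omega> * cnj (wave B (x k) \<omega>) = exp (\<i> * complex_of_real ((x j - x k) \<bullet> \<omega>)) * indicator B \<omega>"
      unfolding wave_def complex_cnj_mult cj by (cases "\<omega> \<in> B") simp_all
  qed
  have "complex_of_real (Ip 2 sphere_measure (\<lambda>\<omega>. \<Sum>j<J. c j * wave B (x j) \<omega>))
    = (\<integral>\<omega>. complex_of_real ((norm (\<Sum>j<J. c j * wave B (x j) \<omega>))\<^sup>2) \<partial>sphere_measure)"
    unfolding Ip_def by (subst integral_complex_of_real) simp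
  also have "\<dots> = (\<integral>\<omega>. (\<Sum>j<J. \<Sum>k<J. c j * cnj (c k) * (wave B (x j) \<omega> * cnj (wave B (x k) \<omega>))) \<partial>sphere_measure)"
  proof (rule Bochner_Integration.integral_cong[OF refl])
    fix \<omega>
    show "complex_of_real ((norm (\<Sum>j<J. c j * wave B (x j) \<omega>))\<^sup>2)
      = (\<Sum>j<J. \<Sum>k<J. c j * cnj (c k) * (wave B (x j) \<omega> * cnj (wave B (x k) \<omega>)))"
      unfolding complex_norm_square cnj_sum sum_product complex_cnj_mult by (simp only: mult_ac)
  qed
  also have "\<dots> = (\<Sum>j<J. \<Sum>k<J. c j * cnj (c k) * m j k)"
    using int by (simp add: mi)
  finally have "norm (complex_of_real (Ip 2 sphere_measure (\<lambda>\<omega>. \<Sum>j<J. c j * wave B (x j) \<omega>)))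
      = norm (\<Sum>j<J. \<Sum>k<J. c j * cnj (c k) * m j k)" by simp
  also have "\<dots> \<le> (\<Sum>j<J. \<Sum>k<J. norm (c j) * norm (c k) * norm (m j k))"
    by (intro order_trans[OF norm_sum] sum_mono) (simp add: norm_mult)
  also have "\<dots> = (\<Sum>j<J. (norm (c j))\<^sup>2 * s + (\<Sum>k\<in>{..<J} - {j}. norm (c j) * norm (c k) * norm (m j k)))"
  proof (rule sum.cong[OF refl])
    fix j assume "j \<in> {..<J}"
    then have "(\<Sum>k<J. norm (c j) * norm (c k) * norm (m j k)) = norm (c j) * norm (c j) * norm (m j j) + (\<Sum>k\<in>{..<J} - {j}. norm (c j) * norm (c k) * norm (m j k))"
      by (intro sum.remove) auto
    moreover have "norm (m j j) = s" unfolding m_def using s0 by (simp add: extension_op_indicator_0 s_def)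
    ultimately show "(\<Sum>k<J. norm (c j) * norm (c k) * norm (m j k)) = (norm (c j))\<^sup>2 * s + (\<Sum>k\<in>{..<J} - {j}. norm (c j) * norm (c k) * norm (m j k))"
      by (simp add: power2_eq_square)
  qed
  also have "\<dots> \<le> (\<Sum>j<J. (norm (c j))\<^sup>2 * s + (\<Sum>k\<in>{..<J} - {j}. T * norm (m j k)))"
    by (intro sum_mono add_left_mono mult_right_mono cT) auto
  also have "\<dots> = (s + (\<Sum>j<J. \<Sum>k\<in>{..<J} - {j}. norm (m j k))) * T"
  proof -
    have 1: "(\<Sum>j<J. (norm (c j))\<^sup>2 * s) = T * s" by (simp add: T_def sum_distrib_right)
    have 2: "(\<Sum>j<J. \<Sum>k\<in>{..<J} - {j}. T * norm (m j k)) = T * (\<Sum>j<J. \<Sum>k\<in>{..<J} - {j}. norm (m j k))"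
      by (simp add: sum_distrib_left)
    show ?thesis unfolding sum.distrib 1 2 by (simp add: algebra_simps)
  qed
  finally show ?thesis by (simp add: m_def T_def)
qed

text \<open>The assumption follows from an extension estimate: the extension of an indicator is
  Lipschitz and lies in some L^q, so it vanishes at infinity.\<close>

locale riemann_lebesgue =
  fixes T :: "'a::euclidean_space itself"
  assumes RL: "\<And>B :: 'a set. B \<in> sets borel \<Longrightarrow> (extension_op (indicator B) \<longlongrightarrow> 0) at_infinity"
begin

text \<open>The case of profiles constant on a set B of measure s. For p >= 2 it is
  \<open>HY_finite\<close> with constants K n tending to s; for p < 2 Hoelder's inequality based on
  L^2 and the inclusion of l^p in l^2 give the exponent p = min p q.\<close>

lemma piece_limit:
  fixes x :: "nat \<Rightarrow> nat \<Rightarrow> 'a" and c :: "nat \<Rightarrow> complex"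
  assumes p: "1 < p" and pq: "1/p + 1/q = 1" and B: "B \<in> sets borel" and e: "0 < e"
    and div: "\<And>j k. j < J \<Longrightarrow> k < J \<Longrightarrow> j \<noteq> k \<Longrightarrow> filterlim (\<lambda>n. norm (x j n - x k n)) at_top sequentially"
  defines "s \<equiv> (\<integral>\<omega>. indicator B \<omega> \<partial>(sphere_measure :: 'a measure)) :: real"
  shows "eventually (\<lambda>n. Ip p sphere_measure (\<lambda>\<omega>. \<Sum>j<J. c j * wave B (x j n) \<omega>)
    \<le> s * (\<Sum>j<J. norm (c j) powr min p q) powr (p / min p q) + e) sequentially"
proof -
  have q: "1 < q" "q = p / (p - 1)" using conjugate_exponent[OF p pq] by auto
  \<comment> \<open>The last term keeps K n positive, as \<open>HY_finite\<close> demands, even when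
    B is a null set.\<close>
  define K where "K n = s + (\<Sum>j<J. \<Sum>k\<in>{..<J} - {j}. norm (extension_op (indicator B) (x j n - x k n))) + 1 / real (Suc n)" for n
  have s0: "0 \<le> s" unfolding s_def by simp
  have K0: "0 < K n" for n
    unfolding K_def using s0 by (intro add_nonneg_pos add_nonneg_nonneg sum_nonneg) auto
  have "(\<lambda>n. norm (extension_op (indicator B) (x j n - x k n))) \<longlonglongrightarrow> 0" if "j < J" "k \<in> {..<J} - {j}" for j k
    using shifted_vanish[OF RL[OF B] div[of j k], of 0] that by (intro tendsto_norm_zero) auto
  then have "K \<longlonglongrightarrow> s + (\<Sum>j<J. \<Sum>k\<in>{..<J} - {j}. 0) + 0"
    unfolding K_def by (intro tendsto_add tendsto_const tendsto_sum LIMSEQ_Suc[OF lim_1_over_n]) auto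
  then have Klim: "K \<longlonglongrightarrow> s" by simp
  have Bes: "Ip 2 sphere_measure (\<lambda>\<omega>. \<Sum>j<J. c j * wave B (x j n) \<omega>) \<le> K n * (\<Sum>j<J. (norm (c j))\<^sup>2)" for n c
    by (rule order_trans[OF wave_Bessel[OF B]]) (intro mult_right_mono, auto simp: K_def s_def sum_nonneg)
  have m: "(\<lambda>\<omega>. \<Sum>j<J. c j * wave B (x j n) \<omega>) \<in> borel_measurable sphere_measure" for n
    by (intro borel_measurable_sum borel_measurable_times wave_measurable[OF B]) auto
  have FL: "(\<lambda>\<omega>. \<Sum>j<J. c j * wave B (x j n) \<omega>) \<in> Lp r sphere_measure" if "0 \<le> r" for n r
  proof (rule finite_measure.Lp_bounded[OF finite_measure_sphere m _ that])
    show "norm (\<Sum>j<J. c j * wave B (x j n) \<omega>) \<le> (\<Sum>j<J. norm (c j))" for \<omega>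
      by (intro order_trans[OF norm_sum] sum_mono) (simp add: norm_mult mult_left_le norm_wave_le)
  qed
  show ?thesis
  proof (cases "2 \<le> p")
    case True
    have "q \<le> p" unfolding q(2) using True by (simp add: divide_le_eq)
    then have r: "min p q = q" by simp
    have "(\<lambda>n. K n * (\<Sum>j<J. norm (c j) powr q) powr (p / q)) \<longlonglongrightarrow> s * (\<Sum>j<J. norm (c j) powr q) powr (p / q)"
      by (intro tendsto_mult_right Klim)
    then have "eventually (\<lambda>n. K n * (\<Sum>j<J. norm (c j) powr q) powr (p / q) < s * (\<Sum>j<J. norm (c j) powr q) powr (p / q) + e) sequentially"
      using e by (intro order_tendstoD) auto
    then show ?thesis unfolding r
    proof eventually_elim
      case (elim n)
      have "Ip p sphere_measure (\<lambda>\<omega>. \<Sum>j<J. c j * wave B (x j n) \<omega>) \<le> K n * (\<Sum>j<J. norm (c j) powr q) powr (p / q)"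
        by (rule finite_measure.HY_finite[OF finite_measure_sphere True pq K0])
           (use wave_measurable[OF B] norm_wave_le Bes in auto)
      then show ?case using elim by linarith
    qed
  next
    case False
    then have p2: "p < 2" by simp
    have "p \<le> q" unfolding q(2) using p2 p by (simp add: le_divide_eq)
    then have r: "min p q = p" by simp
    define S2 where "S2 = (\<Sum>j<J. (norm (c j))\<^sup>2)"
    \<comment> \<open>Hoelder against the indicator of B and not against 1: the resulting power of s
      combines with the limit of K n to exactly s.\<close>
    have Hol: "Ip p sphere_measure (\<lambda>\<omega>. \<Sum>j<J. c j * wave B (x j n) \<omega>) \<le> (K n * S2) powr (p/2) * s powr (1 - p/2)" for n
    proof -
      define F where "F \<omega> = (\<Sum>j<J. c j * wave B (x j n) \<omega>)" for \<omega>
      define F' where "F' \<omega> = complex_of_real (norm (F \<omega>) powr p)" for \<omega>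
      define q' where "q' = 2 / (2 - p)"
      have c': "1 < 2/p" "1 < q'" "1/(2/p) + 1/q' = 1" using p p2 by (auto simp: q'_def field_simps)
      have F2: "F \<in> Lp 2 sphere_measure" unfolding F_def[abs_def] using FL[of 2 n] by simp
      have np: "norm (F' \<omega>) powr (2/p) = norm (F \<omega>) powr 2" for \<omega> using p by (simp add: F'_def powr_powr)
      have F'm: "F' \<in> borel_measurable sphere_measure" unfolding F'_def[abs_def] using Lp_measurable[OF F2] by measurable
      have F'L: "F' \<in> Lp (2/p) sphere_measure"
        by (rule LpI[OF F'm]) (simp only: np Lp_integrable[OF F2])
      have iL: "(indicator B :: 'a \<Rightarrow> complex) \<in> Lp q' sphere_measure" using B c' by (intro indicator_sphere_Lp) auto
      have "(\<integral>\<omega>. norm (F' \<omega>) * norm (indicator B \<omega> :: complex) \<partial>sphere_measure) \<le> lpn (2/p) sphere_measure F' * lpn q' sphere_measure (indicator B)"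
        by (rule Holder(2)[OF c' F'L iL])
      moreover have "norm (F' \<omega>) * norm (indicator B \<omega> :: complex) = norm (F \<omega>) powr p" for \<omega>
        using p by (auto simp: F'_def F_def wave_def indicator_def)
      moreover have "lpn (2/p) sphere_measure F' = Ip 2 sphere_measure F powr (p/2)"
        by (simp add: lpn_def Ip_def np)
      moreover have "lpn q' sphere_measure (indicator B :: 'a \<Rightarrow> complex) = s powr (1 - p/2)"
      proof -
        have "norm (indicator B \<omega> :: complex) powr q' = indicator B \<omega>" for \<omega> :: 'a by (simp add: indicator_def)
        moreover have "1/q' = 1 - p/2" using p2 by (simp add: q'_def diff_divide_distrib)
        ultimately show ?thesis by (simp add: lpn_def Ip_def s_def)
      qed
      ultimately have "Ip p sphere_measure F \<le> Ip 2 sphere_measure F powr (p/2) * s powr (1 - p/2)" by (simp add: Ip_def)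
      also have "\<dots> \<le> (K n * S2) powr (p/2) * s powr (1 - p/2)"
        using Bes[of c n] p by (intro mult_right_mono powr_mono2) (auto simp: F_def[abs_def] S2_def)
      finally show ?thesis by (simp add: F_def[abs_def])
    qed
    have "(\<lambda>n. (K n * S2) powr (p/2) * s powr (1 - p/2)) \<longlonglongrightarrow> (s * S2) powr (p/2) * s powr (1 - p/2)"
    proof (rule tendsto_mult_right, rule tendsto_powr2[OF tendsto_mult_right[OF Klim] tendsto_const])
      show "eventually (\<lambda>n. 0 \<le> K n * S2) sequentially"
        unfolding S2_def
        by (intro always_eventually allI mult_nonneg_nonneg less_imp_le[OF K0] sum_nonneg) simp
    qed (use p in auto)
    moreover have "(s * S2) powr (p/2) * s powr (1 - p/2) \<le> s * (\<Sum>j<J. norm (c j) powr p)"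
    proof (cases "s = 0")
      case False
      then have "(s * S2) powr (p/2) * s powr (1 - p/2) = s * S2 powr (p/2)"
        using s0 by (simp add: powr_mult powr_diff)
      also have "S2 powr (p/2) \<le> (\<Sum>j<J. ((norm (c j))\<^sup>2) powr (p/2))"
        unfolding S2_def using p p2 by (intro powr_sum_le) auto
      also have "\<dots> = (\<Sum>j<J. norm (c j) powr p)"
      proof (rule sum.cong[OF refl])
        fix j
        have "(norm (c j))\<^sup>2 = norm (c j) powr 2" by simp
        then show "((norm (c j))\<^sup>2) powr (p/2) = norm (c j) powr p" unfolding \<open>(norm (c j))\<^sup>2 = _\<close> powr_powr by simp
      qed
      finally show ?thesis using s0 by (simp add: mult_left_mono)
    qed simp
    ultimately have "eventually (\<lambda>n. (K n * S2) powr (p/2) * s powr (1 - p/2) < s * (\<Sum>j<J. norm (c j) powr p) + e) sequentially"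
      using e by (intro order_tendstoD) auto
    then show ?thesis unfolding r
    proof eventually_elim
      case (elim n)
      have "0 \<le> (\<Sum>j<J. norm (c j) powr p)" by (intro sum_nonneg) simp
      then show ?case using elim Hol[of n] p by simp
    qed
  qed
qed

text \<open>On each level set of the vector of values \<open>piece_limit\<close> applies. The pieces
  add up to the L^p norm of the l^r norm of the profiles, r = min p q, and Minkowski's inequality
  exchanges the two norms.\<close>

lemma modulated_simple_limit:
  fixes x :: "nat \<Rightarrow> nat \<Rightarrow> 'a" and \<psi> :: "nat \<Rightarrow> 'a \<Rightarrow> complex"
  assumes p: "1 < p" and pq: "1/p + 1/q = 1" and e: "0 < e"
    and \<psi>: "\<And>j. simple_function sphere_measure (\<psi> j)"
    and div: "\<And>j k. j < J \<Longrightarrow> k < J \<Longrightarrow> j \<noteq> k \<Longrightarrow> filterlim (\<lambda>n. norm (x j n - x k n)) at_top sequentially"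
  shows "eventually (\<lambda>n. lpn p sphere_measure (\<lambda>\<omega>. \<Sum>j<J. modulate (x j n) (\<psi> j) \<omega>)
    \<le> (\<Sum>j<J. lpn p sphere_measure (\<psi> j) powr min p q) powr (1 / min p q) + e) sequentially"
proof -
  define r where "r = min p q"
  have q: "1 < q" using conjugate_exponent[OF p pq] by simp
  have r: "1 < r" "r \<le> p" using p q by (auto simp: r_def)
  have fin: "finite (\<psi> j ` sphere 0 1)" for j using simple_functionD(1)[OF \<psi>] by simp
  have \<psi>m [measurable]: "\<psi> j \<in> borel_measurable sphere_measure" for j using \<psi> by (rule borel_measurable_simple_function)
  have \<psi>L: "\<psi> j \<in> Lp u sphere_measure" if "0 \<le> u" for j u
  proof -
    obtain N where "\<forall>z\<in>\<psi> j ` sphere 0 1. norm z \<le> N" using finite_imp_bounded[OF fin[of j]] unfolding bounded_iff by blast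
    then show ?thesis by (intro finite_measure.Lp_bounded[where B = N, OF finite_measure_sphere \<psi>m _ that]) auto
  qed
  \<comment> \<open>Joint values, padded by 0 from J on so that they form a finite set of functions
    on nat.\<close>
  define T where "T \<omega> = (\<lambda>j. if j < J then \<psi> j \<omega> else 0)" for \<omega>
  define V where "V = T ` sphere 0 1"
  have V: "finite V"
  proof (rule finite_subset)
    show "V \<subseteq> {f. \<forall>j. (j \<in> {..<J} \<longrightarrow> f j \<in> (\<Union>j<J. \<psi> j ` sphere 0 1)) \<and> (j \<notin> {..<J} \<longrightarrow> f j = 0)}"
    proof
      fix v assume "v \<in> V"
      then obtain \<omega> where \<omega>: "\<omega> \<in> sphere 0 1" "v = T \<omega>" unfolding V_def by blast
      show "v \<in> {f. \<forall>j. (j \<in> {..<J} \<longrightarrow> f j \<in> (\<Union>j<J. \<psi> j ` sphere 0 1)) \<and> (j \<notin> {..<J} \<longrightarrow> f j = 0)}"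
      proof (intro CollectI allI conjI impI)
        fix j assume j: "j \<in> {..<J}"
        then have "v j = \<psi> j \<omega>" by (simp add: \<omega>(2) T_def)
        then show "v j \<in> (\<Union>j<J. \<psi> j ` sphere 0 1)" using \<omega>(1) j by blast
      qed (simp add: \<omega>(2) T_def)
    qed
    show "finite {f. \<forall>j. (j \<in> {..<J} \<longrightarrow> f j \<in> (\<Union>j<J. \<psi> j ` sphere 0 1)) \<and> (j \<notin> {..<J} \<longrightarrow> f j = (0::complex))}"
      using fin by (intro finite_set_of_finite_funs) auto
  qed
  have "\<exists>B\<in>sets borel. {\<omega> \<in> space sphere_measure. \<forall>j\<in>{..<J}. \<psi> j \<omega> = v j} = B \<inter> sphere 0 1" for v :: "nat \<Rightarrow> complex"
  proof -
    have "{\<omega> \<in> space sphere_measure. \<forall>j\<in>{..<J}. \<psi> j \<omega> = v j} \<in> sets sphere_measure" by measurable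
    then show ?thesis by (auto simp: sets_sphere_measure sets_restrict_space)
  qed
  then obtain B where B: "\<And>v. B v \<in> sets borel"
    "\<And>v. {\<omega> \<in> space sphere_measure. \<forall>j\<in>{..<J}. \<psi> j \<omega> = v j} = B v \<inter> sphere 0 1" by metis
  have Bmem: "\<omega> \<in> B v \<longleftrightarrow> v = T \<omega>" if "\<omega> \<in> sphere 0 1" "v \<in> V" for \<omega> v
  proof -
    have "\<omega> \<in> B v \<longleftrightarrow> (\<forall>j<J. \<psi> j \<omega> = v j)" using B(2)[of v] that(1) by auto
    also have "\<dots> \<longleftrightarrow> v = T \<omega>" using that(2) by (auto simp: V_def T_def fun_eq_iff)
    finally show ?thesis .
  qed
  define F where "F n \<omega> = (\<Sum>j<J. modulate (x j n) (\<psi> j) \<omega>)" for n \<omega>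
  define s where "s v = ((\<integral>\<omega>. indicator (B v) \<omega> \<partial>(sphere_measure :: 'a measure)) :: real)" for v
  define Z where "Z v = (\<Sum>j<J. norm (v j) powr r) powr (p / r)" for v :: "nat \<Rightarrow> complex"
  have FL: "F n \<in> Lp p sphere_measure" for n
    unfolding F_def[abs_def] using p by (intro Lp_sum modulate_Lp \<psi>L) auto
  have wL: "(\<lambda>\<omega>. \<Sum>j<J. v j * wave (B v) (x j n) \<omega>) \<in> Lp p sphere_measure" for v n
  proof (intro Lp_sum Lp_scale)
    show "wave (B v) (x j n) \<in> Lp p sphere_measure" for j
      using p by (intro finite_measure.Lp_bounded[where B = 1, OF finite_measure_sphere wave_measurable[OF B(1)]] norm_wave_le) auto
  qed (use p in auto)
  have IF: "Ip p sphere_measure (F n) = (\<Sum>v\<in>V. Ip p sphere_measure (\<lambda>\<omega>. \<Sum>j<J. v j * wave (B v) (x j n) \<omega>))" for n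
  proof -
    have "norm (F n \<omega>) powr p = (\<Sum>v\<in>V. norm (\<Sum>j<J. v j * wave (B v) (x j n) \<omega>) powr p)" if \<omega>: "\<omega> \<in> sphere 0 1" for \<omega>
    proof -
      have "norm (\<Sum>j<J. v j * wave (B v) (x j n) \<omega>) powr p = (if v = T \<omega> then norm (F n \<omega>) powr p else 0)" if v: "v \<in> V" for v
      proof (cases "v = T \<omega>")
        case True
        then have "\<omega> \<in> B v" using Bmem[OF \<omega> v] by simp
        then have "v j * wave (B v) (x j n) \<omega> = modulate (x j n) (\<psi> j) \<omega>" if "j < J" for j
          using that True by (simp add: wave_def modulate_def T_def)
        then show ?thesis using True by (simp add: F_def)
      next
        case False
        then have "\<omega> \<notin> B v" using Bmem[OF \<omega> v] by simp
        then have "wave (B v) (x j n) \<omega> = 0" for j by (simp add: wave_def)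
        then show ?thesis using False p by simp
      qed
      then have "(\<Sum>v\<in>V. norm (\<Sum>j<J. v j * wave (B v) (x j n) \<omega>) powr p) = (\<Sum>v\<in>V. if v = T \<omega> then norm (F n \<omega>) powr p else 0)"
        by (rule sum.cong[OF refl])
      also have "\<dots> = norm (F n \<omega>) powr p" using V \<omega> by (simp add: V_def)
      finally show ?thesis by simp
    qed
    then have "Ip p sphere_measure (F n) = (\<integral>\<omega>. (\<Sum>v\<in>V. norm (\<Sum>j<J. v j * wave (B v) (x j n) \<omega>) powr p) \<partial>sphere_measure)"
      unfolding Ip_def by (intro Bochner_Integration.integral_cong refl) simp
    also have "\<dots> = (\<Sum>v\<in>V. Ip p sphere_measure (\<lambda>\<omega>. \<Sum>j<J. v j * wave (B v) (x j n) \<omega>))"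
      unfolding Ip_def by (intro Bochner_Integration.integral_sum Lp_integrable wL)
    finally show ?thesis .
  qed
  define A where "A = (\<Sum>j<J. lpn p sphere_measure (\<psi> j) powr r) powr (1 / r)"
  \<comment> \<open>Minkowski's inequality for the functions |\<psi> j|^r in L^(p/r), available
    since r <= p.\<close>
  have sum_le: "(\<Sum>v\<in>V. s v * Z v) \<le> A powr p"
  proof -
    define h where "h j \<omega> = complex_of_real (norm (\<psi> j \<omega>) powr r)" for j \<omega>
    define u where "u = p / r"
    have u: "1 \<le> u" using r by (simp add: u_def)
    have hn: "norm (h j \<omega>) powr u = norm (\<psi> j \<omega>) powr p" for j \<omega> using r by (simp add: h_def u_def powr_powr)
    have hm: "h j \<in> borel_measurable sphere_measure" for j unfolding h_def[abs_def] by measurable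
    have hL: "h j \<in> Lp u sphere_measure" for j
      by (rule LpI[OF hm]) (simp only: hn Lp_integrable[OF \<psi>L] p less_imp_le[OF less_trans[OF zero_less_one p]])
    have hl: "lpn u sphere_measure (h j) = lpn p sphere_measure (\<psi> j) powr r" for j
    proof -
      have I: "Ip u sphere_measure (h j) = Ip p sphere_measure (\<psi> j)" by (simp add: Ip_def hn)
      show ?thesis unfolding lpn_def I by (simp add: powr_powr u_def)
    qed
    have eq: "norm (\<Sum>j<J. h j \<omega>) powr u = (\<Sum>v\<in>V. indicator (B v) \<omega> * Z v)" if \<omega>: "\<omega> \<in> sphere 0 1" for \<omega>
    proof -
      have "(\<Sum>v\<in>V. indicator (B v) \<omega> * Z v) = (\<Sum>v\<in>V. if v = T \<omega> then Z v else 0)"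
        using Bmem[OF \<omega>] by (intro sum.cong refl) (auto simp: indicator_def)
      also have "\<dots> = Z (T \<omega>)" using V \<omega> by (simp add: V_def)
      also have "\<dots> = (\<Sum>j<J. norm (\<psi> j \<omega>) powr r) powr u" by (simp add: Z_def T_def u_def)
      also have "(\<Sum>j<J. norm (\<psi> j \<omega>) powr r) = norm (\<Sum>j<J. h j \<omega>)"
        unfolding h_def of_real_sum[symmetric] norm_of_real by (simp add: sum_nonneg)
      finally show ?thesis by simp
    qed
    have ii: "integrable sphere_measure (\<lambda>\<omega>. indicator (B v) \<omega> * Z v)" for v
    proof -
      have "(\<lambda>\<omega>. indicator (B v) \<omega> * Z v) \<in> borel_measurable sphere_measure"
        using B(1) by (intro borel_measurable_sphere borel_measurable_times borel_measurable_indicator) auto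
      then show ?thesis
        by (rule finite_measure.integrable_const_bound[OF finite_measure_sphere, of _ "\<bar>Z v\<bar>", rotated]) (auto simp: indicator_def)
    qed
    have "Ip u sphere_measure (\<lambda>\<omega>. \<Sum>j<J. h j \<omega>) = (\<integral>\<omega>. (\<Sum>v\<in>V. indicator (B v) \<omega> * Z v) \<partial>sphere_measure)"
      unfolding Ip_def by (intro Bochner_Integration.integral_cong refl) (simp add: eq)
    also have "\<dots> = (\<Sum>v\<in>V. s v * Z v)"
      unfolding s_def using ii by (subst Bochner_Integration.integral_sum) auto
    finally have I: "Ip u sphere_measure (\<lambda>\<omega>. \<Sum>j<J. h j \<omega>) = (\<Sum>v\<in>V. s v * Z v)" .
    have "lpn u sphere_measure (\<lambda>\<omega>. \<Sum>j<J. h j \<omega>) \<le> (\<Sum>j<J. lpn p sphere_measure (\<psi> j) powr r)"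
      unfolding hl[symmetric] by (rule lpn_sum[OF u hL])
    then have "Ip u sphere_measure (\<lambda>\<omega>. \<Sum>j<J. h j \<omega>) \<le> (\<Sum>j<J. lpn p sphere_measure (\<psi> j) powr r) powr u"
      using u by (subst (asm) lpn_le_iff) (auto intro: sum_nonneg)
    moreover have "A powr p = (\<Sum>j<J. lpn p sphere_measure (\<psi> j) powr r) powr u"
      by (simp add: A_def powr_powr u_def)
    ultimately show ?thesis by (simp add: I)
  qed
  have A0: "0 \<le> A" by (simp add: A_def)
  \<comment> \<open>Distributes the gap between A^p and (A + e)^p over the finitely many level
    sets.\<close>
  define d where "d = ((A + e) powr p - A powr p) / (real (card V) + 1)"
  have "A powr p < (A + e) powr p" using A0 e p by (intro powr_less_mono2) auto
  then have d: "0 < d" "real (card V) * d \<le> (A + e) powr p - A powr p"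
    by (auto simp: d_def field_simps)
  have "eventually (\<lambda>n. \<forall>v\<in>V. Ip p sphere_measure (\<lambda>\<omega>. \<Sum>j<J. v j * wave (B v) (x j n) \<omega>) \<le> s v * Z v + d) sequentially"
    using piece_limit[OF p pq B(1) d(1) div]
    by (intro eventually_ball_finite[OF V]) (auto simp: s_def Z_def r_def)
  then have "eventually (\<lambda>n. lpn p sphere_measure (F n) \<le> A + e) sequentially"
  proof eventually_elim
    case (elim n)
    have "Ip p sphere_measure (F n) \<le> (\<Sum>v\<in>V. s v * Z v + d)"
      unfolding IF using elim by (intro sum_mono) auto
    also have "\<dots> = (\<Sum>v\<in>V. s v * Z v) + real (card V) * d" by (simp add: sum.distrib)
    also have "\<dots> \<le> (A + e) powr p" using sum_le d(2) by linarith
    finally show ?case using A0 e p by (subst lpn_le_iff) auto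
  qed
  then show ?thesis by (simp add: F_def[abs_def] A_def r_def)
qed

lemma simple_approx:
  fixes f :: "'a \<Rightarrow> complex"
  assumes p: "0 < p" and f: "f \<in> Lp p sphere_measure"
  shows "\<exists>g. (\<forall>k. simple_function sphere_measure (g k)) \<and> (\<forall>k. g k \<in> Lp p sphere_measure) \<and>
    (\<lambda>k::nat. lpn p sphere_measure (\<lambda>x. f x - g k x)) \<longlonglongrightarrow> 0"
proof -
  have fm: "f \<in> borel_measurable sphere_measure" using f by (rule Lp_measurable)
  obtain g where g: "\<And>k. simple_function sphere_measure (g k)" "\<And>x. x \<in> space sphere_measure \<Longrightarrow> (\<lambda>k. g k x) \<longlonglongrightarrow> f x"
    "\<And>k x. x \<in> space sphere_measure \<Longrightarrow> dist (g k x) 0 \<le> 2 * dist (f x) 0"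
    using borel_measurable_implies_sequence_metric[OF fm, of 0] by blast
  have gm: "g k \<in> borel_measurable sphere_measure" for k using g(1) by (rule borel_measurable_simple_function)
  have gL: "g k \<in> Lp p sphere_measure" for k
    by (rule Lp_mono[OF Lp_scale[OF f, of 2] gm]) (use p g(3) in \<open>auto simp: norm_mult\<close>)
  have "(\<lambda>k. lpn p sphere_measure (\<lambda>x. f x - g k x)) \<longlonglongrightarrow> 0"
  proof (rule lpn_tendsto_dominated[OF p _ Lp_scale[OF f, of 3]])
    show "(\<lambda>x. f x - g k x) \<in> borel_measurable sphere_measure" for k by (rule borel_measurable_diff[OF fm gm])
    show "(\<lambda>k. f x - g k x) \<longlonglongrightarrow> 0" if "x \<in> space sphere_measure" for x
      using tendsto_diff[OF tendsto_const g(2)[OF that], of "f x"] by simp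
    show "norm (f x - g k x) \<le> norm (3 * f x)" if "x \<in> space sphere_measure" for k x
      using g(3)[OF that, of k] norm_triangle_ineq4[of "f x" "g k x"] by (simp add: norm_mult)
  qed
  with g(1) gL show ?thesis by (intro exI[of _ g]) simp
qed

text \<open>Modulation preserves norms, so replacing the profiles by simple functions costs at most
  the sum of the approximation errors, uniformly in n.\<close>

theorem modulated_sum_limit:
  fixes x :: "nat \<Rightarrow> nat \<Rightarrow> 'a" and \<phi> :: "nat \<Rightarrow> 'a \<Rightarrow> complex"
  assumes p: "1 < p" and pq: "1/p + 1/q = 1" and e: "0 < e"
    and \<phi>: "\<And>j. \<phi> j \<in> Lp p sphere_measure"
    and div: "\<And>j k. j < J \<Longrightarrow> k < J \<Longrightarrow> j \<noteq> k \<Longrightarrow> filterlim (\<lambda>n. norm (x j n - x k n)) at_top sequentially"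
  shows "eventually (\<lambda>n. lpn p sphere_measure (\<lambda>\<omega>. \<Sum>j<J. modulate (x j n) (\<phi> j) \<omega>)
    \<le> (\<Sum>j<J. lpn p sphere_measure (\<phi> j) powr min p q) powr (1 / min p q) + e) sequentially"
proof -
  define r where "r = min p q"
  have q: "1 < q" using conjugate_exponent[OF p pq] by simp
  have r: "1 < r" using p q by (auto simp: r_def)
  have p0: "0 < p" using p by simp
  have "\<forall>j. \<exists>g. (\<forall>k. simple_function sphere_measure (g k)) \<and> (\<forall>k. g k \<in> Lp p sphere_measure) \<and>
    (\<lambda>k::nat. lpn p sphere_measure (\<lambda>x. \<phi> j x - g k x)) \<longlonglongrightarrow> 0"
    by (rule allI, rule simple_approx[OF p0 \<phi>])
  from choice[OF this] obtain g where g: "\<forall>j. (\<forall>k. simple_function sphere_measure (g j k)) \<and> (\<forall>k. g j k \<in> Lp p sphere_measure) \<and>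
    (\<lambda>k::nat. lpn p sphere_measure (\<lambda>x. \<phi> j x - g j k x)) \<longlonglongrightarrow> 0" ..
  have gs: "simple_function sphere_measure (g j k)" and gL: "g j k \<in> Lp p sphere_measure"
    and g0: "(\<lambda>k::nat. lpn p sphere_measure (\<lambda>x. \<phi> j x - g j k x)) \<longlonglongrightarrow> 0" for j k
    using g by simp_all
  have glim: "(\<lambda>k. lpn p sphere_measure (g j k)) \<longlonglongrightarrow> lpn p sphere_measure (\<phi> j)" for j
  proof (rule Lim_transform[OF tendsto_const])
    show "(\<lambda>k. lpn p sphere_measure (g j k) - lpn p sphere_measure (\<phi> j)) \<longlonglongrightarrow> 0"
      by (rule tendsto_rabs_zero_cancel, rule tendsto_sandwich[OF _ _ tendsto_const g0[of j]])
         (use lpn_diff_abs[OF _ \<phi>[of j] gL] p in \<open>auto simp: abs_minus_commute\<close>)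
  qed
  define A where "A = (\<Sum>j<J. lpn p sphere_measure (\<phi> j) powr r) powr (1 / r)"
  define Ak where "Ak k = (\<Sum>j<J. lpn p sphere_measure (g j k) powr r) powr (1 / r)" for k
  have "Ak \<longlonglongrightarrow> A" unfolding Ak_def A_def
    using r by (intro tendsto_powr2 tendsto_sum glim tendsto_const always_eventually) (auto intro: sum_nonneg)
  then have "eventually (\<lambda>k. Ak k < A + e / 3) sequentially" using e by (intro order_tendstoD) auto
  moreover have "(\<lambda>k. \<Sum>j<J. lpn p sphere_measure (\<lambda>x. \<phi> j x - g j k x)) \<longlonglongrightarrow> (\<Sum>j<J. 0)" by (intro tendsto_sum g0)
  then have "eventually (\<lambda>k. (\<Sum>j<J. lpn p sphere_measure (\<lambda>x. \<phi> j x - g j k x)) < e / 3) sequentially"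
    using e by (intro order_tendstoD) auto
  ultimately have "eventually (\<lambda>k. Ak k < A + e / 3 \<and> (\<Sum>j<J. lpn p sphere_measure (\<lambda>x. \<phi> j x - g j k x)) < e / 3) sequentially"
    by (rule eventually_conj)
  from eventually_happens'[OF sequentially_bot this] obtain k
    where k: "Ak k < A + e / 3" "(\<Sum>j<J. lpn p sphere_measure (\<lambda>x. \<phi> j x - g j k x)) < e / 3" by blast
  have "0 < e / 3" using e by simp
  from modulated_simple_limit[OF p pq this gs div]
  have "eventually (\<lambda>n. lpn p sphere_measure (\<lambda>\<omega>. \<Sum>j<J. modulate (x j n) (g j k) \<omega>) \<le> Ak k + e / 3) sequentially"
    unfolding Ak_def r_def .
  then have "eventually (\<lambda>n. lpn p sphere_measure (\<lambda>\<omega>. \<Sum>j<J. modulate (x j n) (\<phi> j) \<omega>) \<le> A + e) sequentially"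
  proof eventually_elim
    case (elim n)
    have dL: "(\<lambda>x. \<phi> j x - g j k x) \<in> Lp p sphere_measure" for j using p by (intro Lp_diff \<phi> gL) simp
    have eq: "(\<Sum>j<J. modulate (x j n) (\<phi> j) \<omega>) = (\<Sum>j<J. modulate (x j n) (g j k) \<omega>) + (\<Sum>j<J. modulate (x j n) (\<lambda>x. \<phi> j x - g j k x) \<omega>)" for \<omega>
      unfolding sum.distrib[symmetric] by (simp add: modulate_def algebra_simps)
    have "lpn p sphere_measure (\<lambda>\<omega>. \<Sum>j<J. modulate (x j n) (\<phi> j) \<omega>) \<le>
      lpn p sphere_measure (\<lambda>\<omega>. \<Sum>j<J. modulate (x j n) (g j k) \<omega>) + lpn p sphere_measure (\<lambda>\<omega>. \<Sum>j<J. modulate (x j n) (\<lambda>x. \<phi> j x - g j k x) \<omega>)"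
      unfolding eq using p by (intro lpn_triangle Lp_sum modulate_Lp gL dL) auto
    also have "lpn p sphere_measure (\<lambda>\<omega>. \<Sum>j<J. modulate (x j n) (\<lambda>x. \<phi> j x - g j k x) \<omega>) \<le> (\<Sum>j<J. lpn p sphere_measure (modulate (x j n) (\<lambda>x. \<phi> j x - g j k x)))"
      using p by (intro lpn_sum modulate_Lp dL) auto
    also have "\<dots> = (\<Sum>j<J. lpn p sphere_measure (\<lambda>x. \<phi> j x - g j k x))" by (intro sum.cong refl lpn_modulate)
    finally show ?case using elim k by linarith
  qed
  then show ?thesis by (simp add: A_def r_def)
qed

text \<open>Duality with \<open>modulated_sum_limit\<close> in L^q: with S the sum of the t-th
  powers of the profile norms, t = max p q, testing f n on a sum of modulated duals of the \<phi> j
  gives S <= c S^(1/r). The form with \<open>frequently\<close> is met by every c above the liminf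
  of the norms.\<close>

theorem weak_limits_sum_le:
  fixes x :: "nat \<Rightarrow> nat \<Rightarrow> 'a" and f \<phi> :: "nat \<Rightarrow> 'a \<Rightarrow> complex"
  assumes p: "1 < p" and pq: "1/p + 1/q = 1"
    and f: "\<And>n. f n \<in> Lp p sphere_measure" and \<phi>: "\<And>j. \<phi> j \<in> Lp p sphere_measure"
    and weak: "\<And>j h. j < J \<Longrightarrow> h \<in> Lp q sphere_measure \<Longrightarrow>
      (\<lambda>n. \<integral>\<omega>. modulate (- x j n) (f n) \<omega> * h \<omega> \<partial>sphere_measure) \<longlonglongrightarrow> (\<integral>\<omega>. \<phi> j \<omega> * h \<omega> \<partial>sphere_measure)"
    and div: "\<And>j k. j < J \<Longrightarrow> k < J \<Longrightarrow> j \<noteq> k \<Longrightarrow> filterlim (\<lambda>n. norm (x j n - x k n)) at_top sequentially"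
    and freq: "frequently (\<lambda>n. lpn p sphere_measure (f n) \<le> c) sequentially"
  shows "(\<Sum>j<J. lpn p sphere_measure (\<phi> j) powr max p q) powr (1 / max p q) \<le> c"
proof -
  have q: "1 < q" "q = p / (p - 1)" using conjugate_exponent[OF p pq] by auto
  have qp: "1/q + 1/p = 1" using pq by simp
  define t where "t = max p q"
  define r where "r = min q p"
  have tr: "1 < t" "1 < r" "p \<le> t" "1/t + 1/r = 1"
    using p q(1) pq by (auto simp: t_def r_def max_def min_def)
  have rt: "(t - 1) * r = t"
  proof -
    have "r = t / (t - 1)" using conjugate_exponent(2)[OF tr(1,4)] .
    then show ?thesis using tr(1) by simp
  qed
  define N where "N j = lpn p sphere_measure (\<phi> j)" for j
  define S where "S = (\<Sum>j<J. N j powr t)"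
  have N0: "0 \<le> N j" for j by (simp add: N_def)
  have S0: "0 \<le> S" unfolding S_def by (intro sum_nonneg) simp
  obtain n0 where "lpn p sphere_measure (f n0) \<le> c" using frequently_ex[OF freq] by blast
  then have c0: "0 \<le> c" using lpn_nonneg order_trans by blast
  \<comment> \<open>The weight is chosen so that h j pairs with \<phi> j to N j^t and has norm N
    j^(t - 1), whose r-th power is again N j^t.\<close>
  define h where "h j \<omega> = complex_of_real (N j powr (t - p)) * (complex_of_real (norm (\<phi> j \<omega>) powr (p - 2)) * cnj (\<phi> j \<omega>))" for j \<omega>
  have hn: "norm (h j \<omega>) = N j powr (t - p) * norm (\<phi> j \<omega>) powr (p - 1)" for j \<omega>
    unfolding h_def norm_mult[of "complex_of_real (N j powr (t - p))"] norm_powr_cnj by simp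
  have hq: "norm (h j \<omega>) powr q = (N j powr (t - p)) powr q * norm (\<phi> j \<omega>) powr p" for j \<omega>
  proof -
    have "(p - 1) * q = p" unfolding q(2) using p by simp
    then show ?thesis unfolding hn powr_mult by (simp add: powr_powr)
  qed
  have hm: "h j \<in> borel_measurable sphere_measure" for j
  proof -
    have [measurable]: "\<phi> j \<in> borel_measurable sphere_measure" by (rule Lp_measurable[OF \<phi>])
    show ?thesis unfolding h_def[abs_def] by measurable
  qed
  have hL: "h j \<in> Lp q sphere_measure" for j
    by (rule LpI[OF hm]) (simp add: hq Lp_integrable[OF \<phi>])
  have hN: "lpn q sphere_measure (h j) = N j powr (t - 1)" for j
  proof -
    have "Ip q sphere_measure (h j) = (N j powr (t - p)) powr q * N j powr p"
      using p by (simp add: Ip_def hq N_def lpn_powr)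
    then have "lpn q sphere_measure (h j) = ((N j powr (t - p)) powr q) powr (1/q) * (N j powr p) powr (1/q)"
      unfolding lpn_def by (simp add: powr_mult)
    also have "\<dots> = N j powr (t - p) * N j powr (p * (1/q))" using q(1) by (simp add: powr_powr)
    also have "p * (1/q) = p - 1" unfolding q(2) using p by simp
    also have "N j powr (t - p) * N j powr (p - 1) = N j powr (t - 1)" by (simp flip: powr_add)
    finally show ?thesis .
  qed
  have \<phi>h: "(\<integral>\<omega>. \<phi> j \<omega> * h j \<omega> \<partial>sphere_measure) = complex_of_real (N j powr t)" for j
  proof -
    have "\<phi> j \<omega> * h j \<omega> = complex_of_real (N j powr (t - p) * norm (\<phi> j \<omega>) powr p)" for \<omega>
    proof (cases "\<phi> j \<omega> = 0")
      case False
      have "\<phi> j \<omega> * h j \<omega> = complex_of_real (N j powr (t - p)) * (complex_of_real (norm (\<phi> j \<omega>) powr (p - 2)) * (\<phi> j \<omega> * cnj (\<phi> j \<omega>)))"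
        by (simp add: h_def)
      also have "\<phi> j \<omega> * cnj (\<phi> j \<omega>) = complex_of_real ((norm (\<phi> j \<omega>))\<^sup>2)" by (rule complex_norm_square[symmetric])
      finally have "\<phi> j \<omega> * h j \<omega> = complex_of_real (N j powr (t - p) * (norm (\<phi> j \<omega>) powr (p - 2) * (norm (\<phi> j \<omega>))\<^sup>2))"
        by (simp only: of_real_mult)
      also have "norm (\<phi> j \<omega>) powr (p - 2) * (norm (\<phi> j \<omega>))\<^sup>2 = norm (\<phi> j \<omega>) powr p"
        using False by (simp add: powr_diff powr_numeral)
      finally show ?thesis .
    qed (use p in simp)
    then have "(\<integral>\<omega>. \<phi> j \<omega> * h j \<omega> \<partial>sphere_measure) = complex_of_real (N j powr (t - p) * Ip p sphere_measure (\<phi> j))"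
      by (simp add: Ip_def)
    also have "Ip p sphere_measure (\<phi> j) = N j powr p" using p by (simp add: N_def lpn_powr)
    also have "N j powr (t - p) * N j powr p = N j powr t" by (simp flip: powr_add)
    finally show ?thesis .
  qed
  \<comment> \<open>The pairing is bilinear, without conjugation, so the modulation by
    \<open>- x j n\<close> passes unchanged from f n to h j.\<close>
  define g where "g n \<omega> = (\<Sum>j<J. modulate (- x j n) (h j) \<omega>)" for n \<omega>
  have gL: "g n \<in> Lp q sphere_measure" for n
    unfolding g_def[abs_def] using q by (intro Lp_sum modulate_Lp hL) auto
  have "(\<lambda>n. \<Sum>j<J. \<integral>\<omega>. modulate (- x j n) (f n) \<omega> * h j \<omega> \<partial>sphere_measure) \<longlonglongrightarrow> (\<Sum>j<J. complex_of_real (N j powr t))"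
    unfolding \<phi>h[symmetric] by (intro tendsto_sum weak hL) auto
  moreover have "(\<Sum>j<J. \<integral>\<omega>. modulate (- x j n) (f n) \<omega> * h j \<omega> \<partial>sphere_measure) = (\<integral>\<omega>. f n \<omega> * g n \<omega> \<partial>sphere_measure)" for n
  proof -
    have "(\<Sum>j<J. \<integral>\<omega>. modulate (- x j n) (f n) \<omega> * h j \<omega> \<partial>sphere_measure)
       = (\<integral>\<omega>. (\<Sum>j<J. modulate (- x j n) (f n) \<omega> * h j \<omega>) \<partial>sphere_measure)"
      by (intro Bochner_Integration.integral_sum[symmetric] Holder(1)[OF p q(1) pq] modulate_Lp f hL)
    also have "\<dots> = (\<integral>\<omega>. f n \<omega> * g n \<omega> \<partial>sphere_measure)"
      by (intro Bochner_Integration.integral_cong refl) (simp add: g_def modulate_def sum_distrib_left mult_ac)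
    finally show ?thesis .
  qed
  ultimately have "(\<lambda>n. \<integral>\<omega>. f n \<omega> * g n \<omega> \<partial>sphere_measure) \<longlonglongrightarrow> complex_of_real S" by (simp add: S_def)
  then have lim: "(\<lambda>n. norm (\<integral>\<omega>. f n \<omega> * g n \<omega> \<partial>sphere_measure)) \<longlonglongrightarrow> S"
    using tendsto_norm S0 by fastforce
  have main: "S \<le> c * (S powr (1/r) + e) + e" if e: "0 < e" for e
  proof -
    have div': "filterlim (\<lambda>n. norm (- x j n - - x k n)) at_top sequentially" if "j < J" "k < J" "j \<noteq> k" for j k
      using div[OF that] by (simp add: norm_minus_commute)
    have "eventually (\<lambda>n. lpn q sphere_measure (g n) \<le> (\<Sum>j<J. lpn q sphere_measure (h j) powr r) powr (1/r) + e) sequentially"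
      unfolding g_def[abs_def] r_def by (rule modulated_sum_limit[OF q(1) qp e hL div'])
    moreover have "lpn q sphere_measure (h j) powr r = N j powr t" for j unfolding hN powr_powr rt ..
    ultimately have "eventually (\<lambda>n. lpn q sphere_measure (g n) \<le> S powr (1/r) + e) sequentially" by (simp add: S_def)
    moreover have "eventually (\<lambda>n. S - e < norm (\<integral>\<omega>. f n \<omega> * g n \<omega> \<partial>sphere_measure)) sequentially"
      by (rule order_tendstoD(1)[OF lim]) (use e in simp)
    ultimately have "eventually (\<lambda>n. lpn q sphere_measure (g n) \<le> S powr (1/r) + e \<and> S - e < norm (\<integral>\<omega>. f n \<omega> * g n \<omega> \<partial>sphere_measure)) sequentially"
      by (rule eventually_conj)
    from frequently_ex[OF frequently_eventually_frequently[OF freq this]] obtain n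
      where n: "lpn q sphere_measure (g n) \<le> S powr (1/r) + e" "S - e < norm (\<integral>\<omega>. f n \<omega> * g n \<omega> \<partial>sphere_measure)"
        "lpn p sphere_measure (f n) \<le> c" by blast
    have "norm (\<integral>\<omega>. f n \<omega> * g n \<omega> \<partial>sphere_measure) \<le> lpn p sphere_measure (f n) * lpn q sphere_measure (g n)"
      by (rule Holder(3)[OF p q(1) pq f gL])
    also have "\<dots> \<le> c * (S powr (1/r) + e)" using n c0 by (intro mult_mono) auto
    finally show ?thesis using n(2) by linarith
  qed
  have "S \<le> c * (S powr (1/r) + 0) + 0"
    by (rule le_limit_right[of S "\<lambda>e. c * (S powr (1/r) + e) + e", OF main]) simp_all
  then have le: "S \<le> c * S powr (1/r)" by simp
  have "S powr (1/t) \<le> c"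
  proof (cases "S = 0")
    case False
    then have pos: "0 < S" using S0 by simp
    have "S powr (1/t) = S powr (1 - 1/r)" using tr(4) by (intro arg_cong2[of _ _ _ _ "(powr)"]) auto
    also have "\<dots> = S / S powr (1/r)" using pos by (simp add: powr_diff)
    also have "\<dots> \<le> c" using le pos by (simp add: divide_le_eq)
    finally show ?thesis .
  qed (use c0 in simp)
  then show ?thesis by (simp add: S_def N_def t_def)
qed

end

section \<open>The profile decomposition\<close>

lemma lpn_leI: "0 < p \<Longrightarrow> 0 \<le> a \<Longrightarrow> Ip p M f \<le> a powr p \<Longrightarrow> lpn p M f \<le> a"
  by (simp add: lpn_le_iff)

lemma Ip_leI: "0 < p \<Longrightarrow> 0 \<le> a \<Longrightarrow> lpn p M f \<le> a \<Longrightarrow> Ip p M f \<le> a powr p"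
  by (simp add: lpn_le_iff)

text \<open>By decoupling, subtracting profiles does not increase the norm asymptotically; the
  margin a < b absorbs the o(1).\<close>

lemma eventually_lpn_remainder_le:
  fixes v :: "nat \<Rightarrow> 'a::euclidean_space \<Rightarrow> complex"
  assumes q: "0 < q" and v: "\<And>n. v n \<in> Lp q lborel" and bd: "eventually (\<lambda>n. lpn q lborel (v n) \<le> a) sequentially"
    and a: "0 \<le> a" "a < b"
    and VL: "\<And>j. j < J \<Longrightarrow> V j \<in> Lp q lborel" and V0: "\<And>j. j < J \<Longrightarrow> (V j \<longlongrightarrow> 0) at_infinity"
    and conv: "\<And>j y. j < J \<Longrightarrow> (\<lambda>n. v n (x j n + y)) \<longlonglongrightarrow> V j y"
    and div: "\<And>j k. j < J \<Longrightarrow> k < J \<Longrightarrow> j \<noteq> k \<Longrightarrow> filterlim (\<lambda>n. norm (x j n - x k n)) at_top sequentially"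
  shows "eventually (\<lambda>n. lpn q lborel (remainder v x V J n) \<le> b) sequentially"
proof -
  have bd': "eventually (\<lambda>n. Ip q lborel (v n) \<le> a powr q) sequentially"
    using bd by eventually_elim (rule Ip_leI[OF q a(1)])
  have "a powr q < b powr q" using a q by (intro powr_less_mono2) auto
  then have "eventually (\<lambda>n. Ip q lborel (v n) - (\<Sum>j<J. Ip q lborel (V j)) - Ip q lborel (remainder v x V J n) > a powr q - b powr q) sequentially"
    by (intro order_tendstoD(1)[OF decoupling[OF q v bd' VL V0 conv div]]) auto
  with bd' show ?thesis
  proof eventually_elim
    case (elim n)
    have "0 \<le> (\<Sum>j<J. Ip q lborel (V j))" by (intro sum_nonneg) simp
    then have "Ip q lborel (remainder v x V J n) \<le> b powr q" using elim by linarith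
    then show ?case using a by (intro lpn_leI[OF q]) auto
  qed
qed

text \<open>Real-valued core of the theorem, with the conjecture replaced by two extension
  estimates: at (p, q) for the sequence, at (p1, q1) for its truncations. Limits superior and
  inferior appear as \<open>eventually\<close> and \<open>frequently\<close>.\<close>

theorem profile_decomposition:
  fixes f :: "nat \<Rightarrow> 'a::euclidean_space \<Rightarrow> complex"
  assumes p: "1 < p" and pp: "1/p + 1/p' = 1" and p1: "1 < p1" and q: "1 \<le> q1" "q1 < q"
    and E: "\<And>g :: 'a \<Rightarrow> complex. g \<in> Lp p sphere_measure \<Longrightarrow>
      extension_op g \<in> Lp q lborel \<and> lpn q lborel (extension_op g) \<le> C * lpn p sphere_measure g"
    and C: "0 \<le> C"
    and E1: "\<And>g :: 'a \<Rightarrow> complex. g \<in> Lp p1 sphere_measure \<Longrightarrow>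
      extension_op g \<in> Lp q1 lborel \<and> lpn q1 lborel (extension_op g) \<le> C1 * lpn p1 sphere_measure g"
    and C1: "0 \<le> C1"
    and f: "\<And>n. f n \<in> Lp p sphere_measure" and K: "\<And>n. lpn p sphere_measure (f n) \<le> K"
    and trunc: "\<And>e. 0 < e \<Longrightarrow> \<exists>M::nat. eventually (\<lambda>n. lpn q lborel
      (extension_op (\<lambda>\<omega>. f n \<omega> * indicator {\<omega>. norm (f n \<omega>) > real M} \<omega>)) \<le> e) sequentially"
  obtains s :: "nat \<Rightarrow> nat" and x :: "nat \<Rightarrow> nat \<Rightarrow> 'a" and \<phi> :: "nat \<Rightarrow> 'a \<Rightarrow> complex"
  where "strict_mono s"
    "\<And>j k. j \<noteq> k \<Longrightarrow> filterlim (\<lambda>n. norm (x j n - x k n)) at_top sequentially"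
    "\<And>j. \<phi> j \<in> Lp p sphere_measure"
    "\<And>j h. h \<in> Lp p' sphere_measure \<Longrightarrow>
      (\<lambda>n. \<integral>\<omega>. modulate (- x j n) (f (s n)) \<omega> * h \<omega> \<partial>sphere_measure) \<longlonglongrightarrow> (\<integral>\<omega>. \<phi> j \<omega> * h \<omega> \<partial>sphere_measure)"
    "\<And>J c. frequently (\<lambda>n. lpn p sphere_measure (f (s n)) \<le> c) sequentially \<Longrightarrow>
      (\<Sum>j<J. lpn p sphere_measure (\<phi> j) powr max p p') powr (1 / max p p') \<le> c"
    "\<And>J e. 0 < e \<Longrightarrow> eventually (\<lambda>n. lpn p sphere_measure (\<lambda>\<omega>. \<Sum>j<J. modulate (x j n) (\<phi> j) \<omega>)
      \<le> (\<Sum>j<J. lpn p sphere_measure (\<phi> j) powr min p p') powr (1 / min p p') + e) sequentially"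
    "\<And>J. (\<lambda>n. Ip q lborel (extension_op (f (s n))) - (\<Sum>j<J. Ip q lborel (extension_op (\<phi> j)))
      - Ip q lborel (extension_op (\<lambda>\<omega>. f (s n) \<omega> - (\<Sum>j<J. modulate (x j n) (\<phi> j) \<omega>)))) \<longlonglongrightarrow> 0"
    "\<And>e. 0 < e \<Longrightarrow> \<exists>J0. \<forall>J\<ge>J0. eventually (\<lambda>n.
      lpn q lborel (extension_op (\<lambda>\<omega>. f (s n) \<omega> - (\<Sum>j<J. modulate (x j n) (\<phi> j) \<omega>))) \<le> e) sequentially"
proof -
  have p'1: "1 < p'" using conjugate_exponent[OF p pp] by simp
  have q0: "0 < q" "1 \<le> q" "0 < q1" using q by auto
  have p0: "0 \<le> p" "1 \<le> p" using p by auto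
  have int: "integrable sphere_measure g" if "g \<in> Lp p sphere_measure" for g :: "'a \<Rightarrow> complex"
    using finite_measure.Lp_imp_integrable[OF finite_measure_sphere that] p by simp
  define \<sigma> where "\<sigma> = measure sphere_measure (space (sphere_measure :: 'a measure))"
  define B where "B = K * \<sigma> powr (1 - 1/p)"
  have K0: "0 \<le> K" using K[of 0] lpn_nonneg order_trans by blast
  have B0: "0 \<le> B" using K0 by (simp add: B_def)
  have L1: "(\<integral>\<omega>. norm (g \<omega>) \<partial>sphere_measure) \<le> B" if "g \<in> Lp p sphere_measure" "lpn p sphere_measure g \<le> K" for g :: "'a \<Rightarrow> complex"
    unfolding B_def \<sigma>_def
    by (rule order_trans[OF finite_measure.L1_le_lpn[OF finite_measure_sphere p that(1)]]) (intro mult_right_mono that(2), simp)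
  have Esup: "norm (extension_op g y) \<le> B" if "g \<in> Lp p sphere_measure" "lpn p sphere_measure g \<le> K" for g :: "'a \<Rightarrow> complex" and y
    by (rule order_trans[OF norm_extension_op_le[OF int[OF that(1)]] L1[OF that]])
  \<comment> \<open>B + 1 instead of B, since \<open>profile_family\<close> wants a positive
    Lipschitz constant and K may be 0.\<close>
  have Elip: "norm (extension_op g y - extension_op g z) \<le> (B + 1) * norm (y - z)"
    if "g \<in> Lp p sphere_measure" "lpn p sphere_measure g \<le> K" for g :: "'a \<Rightarrow> complex" and y z
    by (rule order_trans[OF extension_op_Lipschitz[OF int[OF that(1)]]]) (use L1[OF that] in \<open>intro mult_right_mono, auto\<close>)
  have Evan: "(extension_op g \<longlongrightarrow> 0) at_infinity" if g: "g \<in> Lp p sphere_measure" for g :: "'a \<Rightarrow> complex"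
  proof (rule Lipschitz_Lp_vanishes[where L = "(\<integral>\<omega>. norm (g \<omega>) \<partial>sphere_measure) + 1"])
    show "extension_op g \<in> Lp q lborel" using E[OF g] by simp
    show "0 < (\<integral>\<omega>. norm (g \<omega>) \<partial>sphere_measure) + 1" by (intro add_nonneg_pos) auto
    show "norm (extension_op g y - extension_op g z) \<le> ((\<integral>\<omega>. norm (g \<omega>) \<partial>sphere_measure) + 1) * norm (y - z)" for y z
      by (rule order_trans[OF extension_op_Lipschitz[OF int[OF g]]]) (intro mult_right_mono, auto)
  qed (use q0 in simp)
  \<comment> \<open>Indicators of Borel sets lie in L^p, so the extension estimate itself supplies
    the Riemann-Lebesgue property.\<close>
  interpret rl: riemann_lebesgue "TYPE('a)"
    by (unfold_locales) (rule Evan[OF indicator_sphere_Lp[OF _ p0(1)]])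

  \<comment> \<open>The family fed into the selection: the sequence itself and its truncations at all levels.\<close>
  define F where "F i n \<omega> = (if i = 0 \<or> norm (f n \<omega>) \<le> real (i - 1) then f n \<omega> else 0)" for i n \<omega>
  have F0: "F 0 n = f n" for n by (simp add: F_def fun_eq_iff)
  have Fm: "F i n \<in> borel_measurable sphere_measure" for i n
  proof -
    have [measurable]: "f n \<in> borel_measurable sphere_measure" by (rule Lp_measurable[OF f])
    show ?thesis unfolding F_def[abs_def] by measurable
  qed
  have Fle: "norm (F i n \<omega>) \<le> norm (f n \<omega>)" for i n \<omega> by (simp add: F_def)
  have FL: "F i n \<in> Lp p sphere_measure" for i n by (rule Lp_mono[OF f Fm p0(1) Fle])
  have FK: "lpn p sphere_measure (F i n) \<le> K" for i n
    by (rule order_trans[OF lpn_mono[OF f Fm _ Fle] K]) (use p in simp)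
  define u where "u i n = extension_op (F i n)" for i n
  \<comment> \<open>Member Suc M is bounded by M, hence in L^p1, and gets the smaller exponent q1
    that \<open>remainder_vanishes\<close> requires; member 0 has only q.\<close>
  define Q where "Q i = (if i = 0 then q else q1)" for i :: nat
  define Cc where "Cc i = (if i = 0 then (C * K) powr q else (C1 * (real (i - 1) * \<sigma> powr (1/p1))) powr q1)" for i :: nat
  \<comment> \<open>Truncation does not increase the modulus, so all members share this bound;
    through it all limit profiles lie in L^q, whatever \<open>Q i\<close> is.\<close>
  have uLq: "u i n \<in> Lp q lborel" and uIq: "Ip q lborel (u i n) \<le> (C * K) powr q" for i n
  proof -
    show "u i n \<in> Lp q lborel" unfolding u_def using E[OF FL] by simp
    have "lpn q lborel (u i n) \<le> C * lpn p sphere_measure (F i n)" unfolding u_def using E[OF FL] by simp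
    also have "\<dots> \<le> C * K" by (intro mult_left_mono FK C)
    finally show "Ip q lborel (u i n) \<le> (C * K) powr q"
      using C K0 by (intro Ip_leI[OF q0(1)]) auto
  qed
  have uL: "u i n \<in> Lp (Q i) lborel \<and> Ip (Q i) lborel (u i n) \<le> Cc i" for i n
  proof (cases "i = 0")
    case True
    then show ?thesis using uLq[of i n] uIq[of i n] by (simp add: Q_def Cc_def)
  next
    case False
    have bd: "norm (F i n \<omega>) \<le> real (i - 1)" for \<omega> using False by (simp add: F_def)
    have F1: "F i n \<in> Lp p1 sphere_measure"
      by (rule finite_measure.Lp_bounded[OF finite_measure_sphere Fm bd]) (use p1 in simp)
    have "lpn p1 sphere_measure (F i n) \<le> real (i - 1) * \<sigma> powr (1/p1)" unfolding \<sigma>_def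
      by (rule finite_measure.lpn_bounded[OF finite_measure_sphere Fm bd]) (use p1 in auto)
    then have "C1 * lpn p1 sphere_measure (F i n) \<le> C1 * (real (i - 1) * \<sigma> powr (1/p1))" using C1 by (rule mult_left_mono)
    then have "lpn q1 lborel (u i n) \<le> C1 * (real (i - 1) * \<sigma> powr (1/p1))"
      using E1[OF F1] unfolding u_def by linarith
    then have "Ip q1 lborel (u i n) \<le> (C1 * (real (i - 1) * \<sigma> powr (1/p1))) powr q1"
      using C1 by (intro Ip_leI[OF q0(3)]) auto
    moreover have "u i n \<in> Lp q1 lborel" unfolding u_def using E1[OF F1] by simp
    ultimately show ?thesis using False by (simp add: Q_def Cc_def)
  qed
  interpret pf: profile_family u Q "\<lambda>_. B" Cc "\<lambda>_. B + 1"
  proof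
    show "0 < Q i" for i using q0 by (simp add: Q_def)
    show "u i n \<in> Lp (Q i) lborel" "Ip (Q i) lborel (u i n) \<le> Cc i" for i n using uL[of i n] by auto
    show "norm (u i n y) \<le> B" for i n y unfolding u_def by (rule Esup[OF FL FK])
    show "0 < B + 1" using B0 by simp
    show "norm (u i n y - u i n z) \<le> (B + 1) * norm (y - z)" for i n y z unfolding u_def by (rule Elip[OF FL FK])
  qed
  obtain s X U where s: "strict_mono s" and sel: "\<And>J. pf.selected J s X U" by (rule pf.selection) blast
  define Y where "Y j n = X j (s n)" for j n
  have conv: "(\<lambda>n. u i (s n) (Y j n + y)) \<longlonglongrightarrow> U i j y" for i j y
    using sel[of "Suc j"] unfolding pf.selected_def Y_def by blast
  have div: "filterlim (\<lambda>n. norm (Y j n - Y k n)) at_top sequentially" if "j \<noteq> k" for j k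
    unfolding Y_def by (rule pf.selected_diverge[OF sel[of "Suc (max j k)"]]) (use that in auto)
  have U0: "(U i j \<longlongrightarrow> 0) at_infinity" for i j
    by (rule pf.selected_limit(4)[OF sel[of "Suc j"]]) simp
  have ULq: "U i j \<in> Lp q lborel" for i j
  proof (rule Lp_Fatou(1)[OF q0(1)])
    show "(\<lambda>y. u i (s n) (Y j n + y)) \<in> Lp q lborel" for n by (rule Lp_translate[OF uLq])
    show "U i j \<in> borel_measurable lborel"
      using Lp_measurable[OF pf.selected_limit(3)[OF sel[of "Suc j"], of j i]] by simp
    show "eventually (\<lambda>n. Ip q lborel (\<lambda>y. u i (s n) (Y j n + y)) \<le> (C * K) powr q) sequentially"
      by (intro always_eventually allI) (simp add: Ip_translate uIq)
  qed (use conv in simp)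
  have "\<forall>j. \<exists>\<phi>. \<phi> \<in> Lp p sphere_measure \<and> (\<forall>h. h \<in> Lp p' sphere_measure \<longrightarrow>
      (\<lambda>n. \<integral>\<omega>. modulate (Y j n) (f (s n)) \<omega> * h \<omega> \<partial>sphere_measure) \<longlonglongrightarrow> (\<integral>\<omega>. \<phi> \<omega> * h \<omega> \<partial>sphere_measure))"
  proof
    fix j
    have c: "convergent (\<lambda>n. extension_op (modulate (Y j n) (f (s n))) y)" for y
      using conv[of 0 j y] by (intro convergentI[of _ "U 0 j y"]) (simp add: extension_op_modulate u_def F0 add.commute)
    have m: "modulate (Y j n) (f (s n)) \<in> Lp p sphere_measure" for n by (rule modulate_Lp[OF f])
    have k: "lpn p sphere_measure (modulate (Y j n) (f (s n))) \<le> K" for n by (simp add: K)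
    show "\<exists>\<phi>. \<phi> \<in> Lp p sphere_measure \<and> (\<forall>h. h \<in> Lp p' sphere_measure \<longrightarrow>
      (\<lambda>n. \<integral>\<omega>. modulate (Y j n) (f (s n)) \<omega> * h \<omega> \<partial>sphere_measure) \<longlonglongrightarrow> (\<integral>\<omega>. \<phi> \<omega> * h \<omega> \<partial>sphere_measure))"
    proof (rule weak_compactness[OF p pp m k c])
      fix \<phi> assume "\<phi> \<in> Lp p sphere_measure" "\<And>h. h \<in> Lp p' sphere_measure \<Longrightarrow>
        (\<lambda>n. \<integral>\<omega>. modulate (Y j n) (f (s n)) \<omega> * h \<omega> \<partial>sphere_measure) \<longlonglongrightarrow> (\<integral>\<omega>. \<phi> \<omega> * h \<omega> \<partial>sphere_measure)"
      then show ?thesis by (intro exI[of _ \<phi>]) simp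
    qed
  qed
  from choice[OF this] obtain \<phi> where \<phi>: "\<forall>j. \<phi> j \<in> Lp p sphere_measure \<and> (\<forall>h. h \<in> Lp p' sphere_measure \<longrightarrow>
      (\<lambda>n. \<integral>\<omega>. modulate (Y j n) (f (s n)) \<omega> * h \<omega> \<partial>sphere_measure) \<longlonglongrightarrow> (\<integral>\<omega>. \<phi> j \<omega> * h \<omega> \<partial>sphere_measure))" ..
  have \<phi>L: "\<phi> j \<in> Lp p sphere_measure" for j using \<phi> by simp
  have weak: "(\<lambda>n. \<integral>\<omega>. modulate (Y j n) (f (s n)) \<omega> * h \<omega> \<partial>sphere_measure) \<longlonglongrightarrow> (\<integral>\<omega>. \<phi> j \<omega> * h \<omega> \<partial>sphere_measure)"
    if "h \<in> Lp p' sphere_measure" for j h using \<phi> that by simp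
  \<comment> \<open>Both sides are the pointwise limit of the same extensions: the profiles on the
    extension side come from the weak limits.\<close>
  have E\<phi>: "extension_op (\<phi> j) = U 0 j" for j
  proof
    fix y
    have p'0: "0 \<le> p'" using p'1 by simp
    have "(\<lambda>n. extension_op (modulate (Y j n) (f (s n))) y) \<longlonglongrightarrow> extension_op (\<phi> j) y"
      by (rule extension_op_weak_limit[OF p'0 weak])
    moreover have "(\<lambda>n. extension_op (modulate (Y j n) (f (s n))) y) \<longlonglongrightarrow> U 0 j y"
      using conv[of 0 j y] by (simp add: extension_op_modulate u_def F0 add.commute)
    ultimately show "extension_op (\<phi> j) y = U 0 j y" by (rule LIMSEQ_unique)
  qed
  define x where "x j n = - Y j n" for j n
  have xY: "- x j n = Y j n" for j n by (simp add: x_def)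
  have xdiv: "filterlim (\<lambda>n. norm (x j n - x k n)) at_top sequentially" if "j \<noteq> k" for j k
    using div[OF that] by (simp add: x_def norm_minus_commute)
  define w where "w i J n = remainder (\<lambda>n. u i (s n)) Y (U i) J n" for i J n
  have Er: "extension_op (\<lambda>\<omega>. f (s n) \<omega> - (\<Sum>j<J. modulate (x j n) (\<phi> j) \<omega>)) = w 0 J n" for J n
  proof
    fix y
    have im: "integrable sphere_measure (modulate (x j n) (\<phi> j))" for j by (rule int[OF modulate_Lp[OF \<phi>L]])
    have "extension_op (\<lambda>\<omega>. f (s n) \<omega> - (\<Sum>j<J. modulate (x j n) (\<phi> j) \<omega>)) y
      = extension_op (f (s n)) y - extension_op (\<lambda>\<omega>. \<Sum>j<J. modulate (x j n) (\<phi> j) \<omega>) y"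
      by (rule extension_op_diff[OF int[OF f]]) (intro Bochner_Integration.integrable_sum im)
    also have "\<dots> = extension_op (f (s n)) y - (\<Sum>j<J. U 0 j (y - Y j n))"
    proof -
      have es: "extension_op (\<lambda>\<omega>. \<Sum>j<J. modulate (x j n) (\<phi> j) \<omega>) y = (\<Sum>j<J. extension_op (modulate (x j n) (\<phi> j)) y)"
        by (rule extension_op_sum[OF im])
      show ?thesis unfolding es by (simp add: extension_op_modulate E\<phi> x_def)
    qed
    finally show "extension_op (\<lambda>\<omega>. f (s n) \<omega> - (\<Sum>j<J. modulate (x j n) (\<phi> j) \<omega>)) y = w 0 J n y"
      by (simp add: w_def remainder_def u_def F0)
  qed
  have dec: "(\<lambda>n. Ip q lborel (u 0 (s n)) - (\<Sum>j<J. Ip q lborel (U 0 j)) - Ip q lborel (w 0 J n)) \<longlonglongrightarrow> 0" for J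
    unfolding w_def
    by (rule decoupling[OF q0(1) uLq always_eventually[OF allI[OF uIq]] ULq U0 conv div])
  have wq: "w i J n \<in> Lp q lborel" for i J n
    unfolding w_def by (rule remainder_Lp[OF uLq ULq]) (use q0 in simp)
  \<comment> \<open>The remainder of the sequence is that of its large part \<open>v\<close> plus
    that of the truncation at level M, with common centres Y. M is fixed first, by the hypothesis on
    large values, and bounds the former for every J; then J0 makes the latter small.\<close>
  have vanish: "\<exists>J0. \<forall>J\<ge>J0. eventually (\<lambda>n. lpn q lborel (w 0 J n) \<le> e) sequentially" if e: "0 < e" for e
  proof -
    have e4: "0 < e / 4" using e by simp
    obtain M :: nat where M: "eventually (\<lambda>n. lpn q lborel
      (extension_op (\<lambda>\<omega>. f n \<omega> * indicator {\<omega>. norm (f n \<omega>) > real M} \<omega>)) \<le> e / 4) sequentially"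
      using trunc[OF e4] by (rule exE)
    define v where "v n y = u 0 (s n) y - u (Suc M) (s n) y" for n y
    have vE: "v n = extension_op (\<lambda>\<omega>. f (s n) \<omega> * indicator {\<omega>. norm (f (s n) \<omega>) > real M} \<omega>)" for n
    proof
      fix y
      have "f (s n) \<omega> * indicator {\<omega>. norm (f (s n) \<omega>) > real M} \<omega> = F 0 (s n) \<omega> - F (Suc M) (s n) \<omega>" for \<omega>
        by (simp add: F_def indicator_def)
      then have "extension_op (\<lambda>\<omega>. f (s n) \<omega> * indicator {\<omega>. norm (f (s n) \<omega>) > real M} \<omega>) y
        = extension_op (\<lambda>\<omega>. F 0 (s n) \<omega> - F (Suc M) (s n) \<omega>) y" by simp
      also have "\<dots> = v n y" unfolding v_def u_def by (rule extension_op_diff[OF int[OF FL] int[OF FL]])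
      finally show "v n y = extension_op (\<lambda>\<omega>. f (s n) \<omega> * indicator {\<omega>. norm (f (s n) \<omega>) > real M} \<omega>) y" ..
    qed
    have vL: "v n \<in> Lp q lborel" for n
      unfolding v_def[abs_def] by (rule Lp_diff[OF uLq uLq]) (use q0 in simp)
    have vb: "eventually (\<lambda>n. lpn q lborel (v n) \<le> e / 4) sequentially"
      unfolding vE by (rule eventually_subseq[OF s M])
    define V where "V j y = U 0 j y - U (Suc M) j y" for j y
    have VL: "V j \<in> Lp q lborel" for j unfolding V_def[abs_def] by (rule Lp_diff[OF ULq ULq]) (use q0 in simp)
    have V0: "(V j \<longlongrightarrow> 0) at_infinity" for j
      unfolding V_def[abs_def] using tendsto_diff[OF U0[of 0 j] U0[of "Suc M" j]] by simp
    have vc: "(\<lambda>n. v n (Y j n + y)) \<longlonglongrightarrow> V j y" for j y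
      unfolding v_def V_def by (intro tendsto_diff conv)
    have vr: "eventually (\<lambda>n. lpn q lborel (remainder v Y V J n) \<le> e / 2) sequentially" for J
      by (rule eventually_lpn_remainder_le[OF q0(1) vL vb _ _ VL V0 vc div]) (use e in auto)
    have "Q (Suc M) < q" using q by (simp add: Q_def)
    moreover have "0 < (e / 2) powr q" using e by simp
    ultimately obtain J0 where J0: "\<forall>J\<ge>J0. eventually (\<lambda>n. Ip q lborel (remainder (\<lambda>n. u (Suc M) (s n)) (\<lambda>k n. X k (s n)) (U (Suc M)) J n) \<le> (e / 2) powr q) sequentially"
      using pf.remainder_vanishes[OF sel, of "Suc M" q "(e / 2) powr q"] by blast
    have "eventually (\<lambda>n. lpn q lborel (w 0 J n) \<le> e) sequentially" if J: "J0 \<le> J" for J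
    proof -
      have "eventually (\<lambda>n. Ip q lborel (w (Suc M) J n) \<le> (e / 2) powr q) sequentially"
        using J0 J unfolding w_def Y_def by blast
      with vr[of J] show ?thesis
      proof eventually_elim
        case (elim n)
        have wM: "lpn q lborel (w (Suc M) J n) \<le> e / 2" using elim(2) e by (intro lpn_leI[OF q0(1)]) auto
        have eq: "w 0 J n y = remainder v Y V J n y + w (Suc M) J n y" for y
          by (simp add: w_def remainder_def v_def V_def sum_subtractf)
        have "lpn q lborel (w 0 J n) \<le> lpn q lborel (remainder v Y V J n) + lpn q lborel (w (Suc M) J n)"
          unfolding eq[abs_def] using q0 by (intro lpn_triangle wq remainder_Lp vL VL) auto
        then show ?case using elim(1) wM by linarith
      qed
    qed
    then show ?thesis by blast
  qed
  show ?thesis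
  proof (rule that[of s x \<phi>])
    show "strict_mono s" by (rule s)
    show "filterlim (\<lambda>n. norm (x j n - x k n)) at_top sequentially" if "j \<noteq> k" for j k by (rule xdiv[OF that])
    show "\<phi> j \<in> Lp p sphere_measure" for j by (rule \<phi>L)
    show "(\<lambda>n. \<integral>\<omega>. modulate (- x j n) (f (s n)) \<omega> * h \<omega> \<partial>sphere_measure) \<longlonglongrightarrow> (\<integral>\<omega>. \<phi> j \<omega> * h \<omega> \<partial>sphere_measure)"
      if "h \<in> Lp p' sphere_measure" for j h unfolding xY by (rule weak[OF that])
    show "(\<Sum>j<J. lpn p sphere_measure (\<phi> j) powr max p p') powr (1 / max p p') \<le> c"
      if "frequently (\<lambda>n. lpn p sphere_measure (f (s n)) \<le> c) sequentially" for J c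
    proof (rule rl.weak_limits_sum_le[OF p pp f \<phi>L _ _ that])
      show "(\<lambda>n. \<integral>\<omega>. modulate (- x j n) (f (s n)) \<omega> * h \<omega> \<partial>sphere_measure) \<longlonglongrightarrow> (\<integral>\<omega>. \<phi> j \<omega> * h \<omega> \<partial>sphere_measure)"
        if "h \<in> Lp p' sphere_measure" for j h unfolding xY by (rule weak[OF that])
      show "filterlim (\<lambda>n. norm (x j n - x k n)) at_top sequentially" if "j \<noteq> k" for j k by (rule xdiv[OF that])
    qed
    show "eventually (\<lambda>n. lpn p sphere_measure (\<lambda>\<omega>. \<Sum>j<J. modulate (x j n) (\<phi> j) \<omega>)
      \<le> (\<Sum>j<J. lpn p sphere_measure (\<phi> j) powr min p p') powr (1 / min p p') + e) sequentially" if "0 < e" for J e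
      by (rule rl.modulated_sum_limit[OF p pp that \<phi>L xdiv])
    show "(\<lambda>n. Ip q lborel (extension_op (f (s n))) - (\<Sum>j<J. Ip q lborel (extension_op (\<phi> j)))
      - Ip q lborel (extension_op (\<lambda>\<omega>. f (s n) \<omega> - (\<Sum>j<J. modulate (x j n) (\<phi> j) \<omega>)))) \<longlonglongrightarrow> 0" for J
      unfolding Er E\<phi> using dec[of J] by (simp add: u_def F0)
    show "\<exists>J0. \<forall>J\<ge>J0. eventually (\<lambda>n.
      lpn q lborel (extension_op (\<lambda>\<omega>. f (s n) \<omega> - (\<Sum>j<J. modulate (x j n) (\<phi> j) \<omega>))) \<le> e) sequentially" if "0 < e" for e
      unfolding Er by (rule vanish[OF that])
  qed
qed

section \<open>Exponents near (p, q)\<close>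

lemma conj_exponent_real:
  fixes p :: real
  assumes "1 < p"
  shows "1/p + 1/conj_exponent p = 1" "conj_exponent p = p / (p - 1)" "1 < conj_exponent p"
proof -
  have "1 - inverse p = (p - 1) / p" using assms by (simp add: field_simps)
  then show eq: "conj_exponent p = p / (p - 1)" by (simp add: conj_exponent_def)
  show "1/p + 1/conj_exponent p = 1" unfolding eq using assms by (simp add: field_simps)
  show "1 < conj_exponent p" unfolding eq using assms by (simp add: field_simps)
qed

lemma conj_exponent_conj_exponent:
  fixes p :: real
  assumes "1 < p" shows "conj_exponent (conj_exponent p) = p"
  by (simp add: conj_exponent_def)

lemma conj_exponent_ennreal:
  assumes "1 < p"
  shows "conj_exponent (ennreal p) = ennreal (conj_exponent p)"
proof -
  have "inverse (ennreal p) = ennreal (inverse p)" using assms by (intro inverse_ennreal) simp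
  moreover have "1 - ennreal (inverse p) = ennreal (1 - inverse p)"
    using assms by (subst ennreal_1[symmetric], intro ennreal_minus) simp
  moreover have "inverse (ennreal (1 - inverse p)) = ennreal (inverse (1 - inverse p))"
    using assms by (intro inverse_ennreal) (simp add: inverse_less_1_iff)
  ultimately show ?thesis by (simp add: conj_exponent_def)
qed

text \<open>The other two alternatives in the definition of the conjecture contradict the conditions
  on q.\<close>

lemma extension_norm_finite:
  fixes d :: real
  assumes rc: "restriction_conjecture_at TYPE('a::euclidean_space) (ennreal p) (ennreal q)"
    and d: "d = real (DIM('a) - 1)" "0 < d" and p: "1 < p"
    and q: "2 * (d + 1) / d < q" "(d + 2) / d * conj_exponent p \<le> q"
  shows "extension_norm TYPE('a) (ennreal p) (ennreal q) < \<infinity>"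
proof -
  have "0 \<le> 2 * (d + 1) / d" using d by simp
  then have "\<not> ennreal q \<le> ennreal (2 * (d + 1) / d)" using q(1) by (simp add: ennreal_le_iff)
  moreover have "ennreal ((d + 2) / d) * conj_exponent (ennreal p) = ennreal ((d + 2) / d * conj_exponent p)"
    using d conj_exponent_real(3)[OF p] unfolding conj_exponent_ennreal[OF p] by (subst ennreal_mult) auto
  then have "\<not> ennreal q < ennreal ((d + 2) / d) * conj_exponent (ennreal p)"
    using q(2) by (simp add: not_less ennreal_leI)
  ultimately show ?thesis using rc unfolding restriction_conjecture_at_def Let_def d(1)[symmetric] by blast
qed

text \<open>Raising p lowers p', so the scaling condition becomes strict and admits an exponent
  below q; pairs of this kind converge to (p, q), so one of them lies in the neighborhood.\<close>

lemma neighborhood_exponents: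
  fixes d :: real
  assumes rc: "restriction_conjecture_near TYPE('a::euclidean_space) (ennreal p) (ennreal q)"
    and d: "d = real (DIM('a) - 1)" "0 < d" and p: "1 < p"
    and q: "2 * (d + 1) / d < q" "(d + 2) / d * conj_exponent p \<le> q"
  obtains p1 q1 where "1 < p1" "1 \<le> q1" "q1 < q"
    "extension_norm TYPE('a) (ennreal p) (ennreal q) < \<infinity>"
    "extension_norm TYPE('a) (ennreal p1) (ennreal q1) < \<infinity>"
proof -
  obtain U where U: "openin (top_of_set ({1..} \<times> {1..})) U" "(ennreal p, ennreal q) \<in> U"
    and UR: "\<forall>(a, b)\<in>U. restriction_conjecture_at TYPE('a) a b"
    using rc unfolding restriction_conjecture_near_def by (elim exE conjE)
  obtain V where V: "open V" "U = ({1..} \<times> {1..}) \<inter> V" using U(1) by (auto simp: openin_open)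
  define P where "P n = p + 1 / real (Suc n)" for n
  define c where "c n = (d + 2) / d * conj_exponent (P n)" for n
  \<comment> \<open>The first entry forces convergence to q, the second keeps R n on the admissible
    side of the scaling line; both are below q.\<close>
  define R where "R n = max (q - 1 / real (Suc n)) ((q + c n) / 2)" for n
  have P1: "1 < P n" "p < P n" for n
  proof -
    show "p < P n" by (simp add: P_def)
    then show "1 < P n" using p by linarith
  qed
  have cq: "c n < q" for n
  proof -
    have "P n / (P n - 1) < p / (p - 1)" 
    proof -
      have "P n * (p - 1) < p * (P n - 1)" using P1(2)[of n] by (simp add: algebra_simps)
      then show ?thesis using P1(1)[of n] p by (simp add: frac_less_eq pos_divide_less_eq pos_less_divide_eq mult.commute)
    qed
    then have "conj_exponent (P n) < conj_exponent p"
      using conj_exponent_real(2)[OF P1(1)[of n]] conj_exponent_real(2)[OF p] by simp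
    then have "c n < (d + 2) / d * conj_exponent p" unfolding c_def using d by (intro mult_strict_left_mono) auto
    then show ?thesis using q(2) by linarith
  qed
  have Rq: "R n < q" "c n \<le> R n" "q - 1 / real (Suc n) \<le> R n" for n
  proof -
    have h: "c n \<le> (q + c n) / 2" "(q + c n) / 2 < q" "0 < 1 / real (Suc n)" using cq[of n] by (simp_all add: field_simps)
    show "R n < q" unfolding R_def using h(2,3) by simp
    show "c n \<le> R n" unfolding R_def by (rule order_trans[OF h(1) max.cobounded2])
    show "q - 1 / real (Suc n) \<le> R n" unfolding R_def by (rule max.cobounded1)
  qed
  have z: "(\<lambda>n. 1 / real (Suc n)) \<longlonglongrightarrow> 0" by (rule LIMSEQ_Suc[OF lim_1_over_n])
  have "P \<longlonglongrightarrow> p + 0" unfolding P_def by (intro tendsto_add tendsto_const z)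
  then have Pl: "P \<longlonglongrightarrow> p" by simp
  have Rl: "R \<longlonglongrightarrow> q"
  proof (rule tendsto_sandwich)
    show "(\<lambda>n. q - 1 / real (Suc n)) \<longlonglongrightarrow> q" using tendsto_diff[OF tendsto_const z, of q] by simp
    show "eventually (\<lambda>n. R n \<le> q) sequentially" using Rq(1) by (simp add: less_imp_le)
  qed (use Rq(3) in auto)
  have "(\<lambda>n. (ennreal (P n), ennreal (R n))) \<longlonglongrightarrow> (ennreal p, ennreal q)"
    by (intro tendsto_Pair tendsto_ennrealI Pl Rl)
  moreover have inV: "(ennreal p, ennreal q) \<in> V" using U(2) V(2) by simp
  ultimately have e1: "eventually (\<lambda>n. (ennreal (P n), ennreal (R n)) \<in> V) sequentially"
    by (rule topological_tendstoD[OF _ V(1)])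
  have e2: "eventually (\<lambda>n. 2 * (d + 1) / d < R n) sequentially" by (rule order_tendstoD(1)[OF Rl q(1)])
  from eventually_happens'[OF sequentially_bot eventually_conj[OF e1 e2]]
  obtain n where n: "(ennreal (P n), ennreal (R n)) \<in> V" "2 * (d + 1) / d < R n" by blast
  have two: "1 \<le> 2 * (d + 1) / d" using d(2) by (simp add: field_simps)
  have R1: "1 \<le> R n" using n(2) two by linarith
  have "(1::ennreal) \<le> ennreal (P n)" "(1::ennreal) \<le> ennreal (R n)"
    using P1[of n] R1 by (simp_all add: ennreal_ge_1)
  then have "(ennreal (P n), ennreal (R n)) \<in> U" using n(1) V(2) by simp
  then have rc1: "restriction_conjecture_at TYPE('a) (ennreal (P n)) (ennreal (R n))" using UR by auto
  have rc0: "restriction_conjecture_at TYPE('a) (ennreal p) (ennreal q)" using UR U(2) by auto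
  show ?thesis
  proof (rule that[of "P n" "R n"])
    show "extension_norm TYPE('a) (ennreal p) (ennreal q) < \<infinity>" by (rule extension_norm_finite[OF rc0 d p q])
    show "extension_norm TYPE('a) (ennreal (P n)) (ennreal (R n)) < \<infinity>"
      by (rule extension_norm_finite[OF rc1 d P1(1) n(2)]) (use Rq(2)[of n] in \<open>simp add: c_def\<close>)
  qed (use P1 R1 Rq in auto)
qed

section \<open>Passage to the extended nonnegative reals\<close>

lemma ennreal_powr_mono: "x \<le> ennreal b \<Longrightarrow> 0 \<le> b \<Longrightarrow> 0 \<le> a \<Longrightarrow> ennreal_powr x a \<le> ennreal (b powr a)"
proof -
  assume x: "x \<le> ennreal b" and b: "0 \<le> b" and a: "0 \<le> a"
  obtain y where y: "x = ennreal y" "0 \<le> y" using x by (cases x) (auto simp: top_unique)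
  then have "y \<le> b" using x b by (simp add: ennreal_le_iff)
  then show ?thesis using y a by (simp add: ennreal_powr_ennreal ennreal_leI powr_mono2)
qed

lemma tendsto_zero_ennrealI:
  fixes X :: "nat \<Rightarrow> ennreal"
  assumes "\<And>e::real. 0 < e \<Longrightarrow> eventually (\<lambda>n. X n \<le> ennreal e) F"
  shows "(X \<longlongrightarrow> 0) F"
proof (rule order_tendstoI)
  fix a :: ennreal assume "0 < a"
  then obtain b where b: "0 < b" "b < a" using dense by blast
  then obtain r where r: "b = ennreal r" "0 \<le> r" by (cases b) auto
  then have "0 < r" using b(1) by (cases "r = 0") auto
  from assms[OF this] show "eventually (\<lambda>n. X n < a) F"
    by eventually_elim (use b r in \<open>auto intro: le_less_trans\<close>)
qed simp

theorem theorem3p3: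
  fixes d :: nat and p q :: real
    and f :: "nat \<Rightarrow> real ^ 'n \<Rightarrow> complex"
  assumes dim: "CARD('n) = d + 1" and d: "d \<ge> 1"
    and pq: "1 < p" "p < q"
    and q_ge: "q \<ge> (real d + 2) / real d * conj_exponent p"
    and q_gt: "q > 2 * (real d + 1) / real d"
    and conj: "restriction_conjecture_near TYPE(real ^ 'n) (ennreal p) (ennreal q)"
    and f_Lp: "\<And>n. f n \<in> Lspace (ennreal p) sphere_measure"
    and f_bdd: "(SUP n. Lnorm (ennreal p) sphere_measure (f n)) < \<infinity>"
    and f_trunc: "((\<lambda>M::real. limsup (\<lambda>n. Lnorm (ennreal q) lborel
        (extension_op (\<lambda>\<omega>. f n \<omega> * indicator {\<omega>. norm (f n \<omega>) > M} \<omega>)))) \<longlongrightarrow> 0) at_top"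
  shows "\<exists>(s :: nat \<Rightarrow> nat) (x :: nat \<Rightarrow> nat \<Rightarrow> real ^ 'n) (\<phi> :: nat \<Rightarrow> real ^ 'n \<Rightarrow> complex).
    let pt = max p (conj_exponent p);
        r = (\<lambda>J n \<omega>. f (s n) \<omega> - (\<Sum>j<J. modulate (x j n) (\<phi> j) \<omega>))
    in strict_mono s \<and>
      (\<forall>j k. j \<noteq> k \<longrightarrow> filterlim (\<lambda>n. norm (x j n - x k n)) at_top sequentially) \<and>
      (\<forall>j. weak_Llimit (ennreal p) sphere_measure (\<lambda>n. modulate (- x j n) (f (s n))) (\<phi> j)) \<and>
      ennreal_powr (\<Sum>j. ennreal_powr (Lnorm (ennreal p) sphere_measure (\<phi> j)) pt) (1 / pt)
        \<le> liminf (\<lambda>n. Lnorm (ennreal p) sphere_measure (f (s n))) \<and>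
      (\<forall>J. limsup (\<lambda>n. Lnorm (ennreal p) sphere_measure
              (\<lambda>\<omega>. \<Sum>j<J. modulate (x j n) (\<phi> j) \<omega>))
        \<le> ennreal_powr (\<Sum>j<J. ennreal_powr (Lnorm (ennreal p) sphere_measure (\<phi> j))
              (conj_exponent pt)) (1 / conj_exponent pt)) \<and>
      (\<forall>J. (\<lambda>n. enn2ereal (ennreal_powr (Lnorm (ennreal q) lborel (extension_op (f (s n)))) q)
              - (\<Sum>j<J. enn2ereal (ennreal_powr (Lnorm (ennreal q) lborel (extension_op (\<phi> j))) q))
              - enn2ereal (ennreal_powr (Lnorm (ennreal q) lborel (extension_op (r J n))) q))
        \<longlonglongrightarrow> 0) \<and>
      (\<lambda>J. limsup (\<lambda>n. Lnorm (ennreal q) lborel (extension_op (r J n)))) \<longlonglongrightarrow> 0"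
proof -
  define p' where "p' = conj_exponent p"
  have pp: "1/p + 1/p' = 1" and p'1: "1 < p'" unfolding p'_def using conj_exponent_real[OF pq(1)] by auto
  have p0: "0 < p" and q0: "0 < q" using pq by auto
  define pt where "pt = max p p'"
  have pt: "1 < pt" "conj_exponent pt = min p p'"
  proof -
    show "1 < pt" using pq by (simp add: pt_def)
    have "conj_exponent p' = p" unfolding p'_def by (rule conj_exponent_conj_exponent[OF pq(1)])
    then show "conj_exponent pt = min p p'" by (auto simp: pt_def max_def min_def p'_def)
  qed
  have dd: "real d = real (DIM(real ^ 'n) - 1)" "0 < real d" using dim d by auto
  obtain p1 q1 where p1: "1 < p1" and q1: "1 \<le> q1" "q1 < q"
    and N0: "extension_norm TYPE(real ^ 'n) (ennreal p) (ennreal q) < \<infinity>"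
    and N1: "extension_norm TYPE(real ^ 'n) (ennreal p1) (ennreal q1) < \<infinity>"
    by (rule neighborhood_exponents[OF conj dd pq(1) q_gt q_ge])
  have q1': "1 \<le> q" using q1 by simp
  from extension_bound[OF pq(1) q1' N0] obtain C where C: "0 \<le> C"
    and E: "\<forall>g\<in>Lp p (sphere_measure :: (real ^ 'n) measure). extension_op g \<in> Lp q lborel \<and>
      lpn q lborel (extension_op g) \<le> C * lpn p sphere_measure g" by (elim exE conjE)
  from extension_bound[OF p1 q1(1) N1] obtain C1 where C1: "0 \<le> C1"
    and E1: "\<forall>g\<in>Lp p1 (sphere_measure :: (real ^ 'n) measure). extension_op g \<in> Lp q1 lborel \<and>
      lpn q1 lborel (extension_op g) \<le> C1 * lpn p1 sphere_measure g" by (elim exE conjE)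
  have fL: "f n \<in> Lp p sphere_measure" for n using f_Lp[of n] unfolding Lspace_eq_Lp[OF p0] .
  define K where "K = enn2real (SUP n. Lnorm (ennreal p) sphere_measure (f n))"
  have fK: "lpn p sphere_measure (f n) \<le> K" for n
  proof -
    have "Lnorm (ennreal p) sphere_measure (f n) \<le> (SUP n. Lnorm (ennreal p) sphere_measure (f n))" by (rule SUP_upper) simp
    also have "\<dots> = ennreal K" unfolding K_def using f_bdd by (simp add: less_top)
    finally have "ennreal (lpn p sphere_measure (f n)) \<le> ennreal K" unfolding Lnorm_eq_lpn[OF p0 fL] .
    moreover have "0 \<le> K" by (simp add: K_def)
    ultimately show ?thesis by (simp add: ennreal_le_iff)
  qed
  \<comment> \<open>The hypothesis has real levels; natural ones are chosen to match the countable
    family of truncations.\<close>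
  have trunc: "\<exists>M::nat. eventually (\<lambda>n. lpn q lborel
      (extension_op (\<lambda>\<omega>. f n \<omega> * indicator {\<omega>. norm (f n \<omega>) > real M} \<omega>)) \<le> e) sequentially" if e: "0 < e" for e
  proof -
    have "eventually (\<lambda>M::real. limsup (\<lambda>n. Lnorm (ennreal q) lborel
        (extension_op (\<lambda>\<omega>. f n \<omega> * indicator {\<omega>. norm (f n \<omega>) > M} \<omega>))) < ennreal e) at_top"
      by (rule order_tendstoD(2)[OF f_trunc]) (use e in simp)
    then have "eventually (\<lambda>m::nat. limsup (\<lambda>n. Lnorm (ennreal q) lborel
        (extension_op (\<lambda>\<omega>. f n \<omega> * indicator {\<omega>. norm (f n \<omega>) > real m} \<omega>))) < ennreal e) sequentially"
      by (rule eventually_compose_filterlim[OF _ filterlim_real_sequentially])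
    from eventually_happens'[OF sequentially_bot this] obtain M :: nat where M: "limsup (\<lambda>n. Lnorm (ennreal q) lborel
        (extension_op (\<lambda>\<omega>. f n \<omega> * indicator {\<omega>. norm (f n \<omega>) > real M} \<omega>))) < ennreal e" by (rule exE)
    have "eventually (\<lambda>n. lpn q lborel
      (extension_op (\<lambda>\<omega>. f n \<omega> * indicator {\<omega>. norm (f n \<omega>) > real M} \<omega>)) \<le> e) sequentially"
      using Limsup_lessD[OF M]
    proof eventually_elim
      case (elim n)
      define g where "g \<omega> = f n \<omega> * indicator {\<omega>. norm (f n \<omega>) > real M} \<omega>" for \<omega>
      have [measurable]: "f n \<in> borel_measurable sphere_measure" by (rule Lp_measurable[OF fL])
      have "g = (\<lambda>\<omega>. if norm (f n \<omega>) > real M then f n \<omega> else 0)" by (auto simp: g_def fun_eq_iff)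
      then have "g \<in> borel_measurable sphere_measure" by simp
      then have gL: "g \<in> Lp p sphere_measure"
        by (rule Lp_mono[OF fL[of n]]) (use p0 in \<open>auto simp: g_def norm_mult indicator_def\<close>)
      have EgL: "extension_op g \<in> Lp q lborel" using E gL by simp
      have "ennreal (lpn q lborel (extension_op g)) < ennreal e"
        using elim unfolding g_def[abs_def, symmetric] Lnorm_eq_lpn[OF q0 EgL] .
      then have "lpn q lborel (extension_op g) < e" by (simp add: ennreal_less_iff)
      then show ?case unfolding g_def[abs_def] by simp
    qed
    then show ?thesis by (rule exI)
  qed
  show ?thesis
  proof (rule profile_decomposition[OF pq(1) pp p1 q1 _ C _ C1 fL fK trunc])
    show "extension_op g \<in> Lp q lborel \<and> lpn q lborel (extension_op g) \<le> C * lpn p sphere_measure g"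
      if "g \<in> Lp p sphere_measure" for g :: "real ^ 'n \<Rightarrow> complex" using E that by simp
    show "extension_op g \<in> Lp q1 lborel \<and> lpn q1 lborel (extension_op g) \<le> C1 * lpn p1 sphere_measure g"
      if "g \<in> Lp p1 sphere_measure" for g :: "real ^ 'n \<Rightarrow> complex" using E1 that by simp
  next
    fix s :: "nat \<Rightarrow> nat" and x :: "nat \<Rightarrow> nat \<Rightarrow> real ^ 'n" and \<phi> :: "nat \<Rightarrow> real ^ 'n \<Rightarrow> complex"
    assume s: "strict_mono s"
      and div: "\<And>j k. j \<noteq> k \<Longrightarrow> filterlim (\<lambda>n. norm (x j n - x k n)) at_top sequentially"
      and \<phi>L: "\<And>j. \<phi> j \<in> Lp p sphere_measure"
      and weak: "\<And>j h. h \<in> Lp p' sphere_measure \<Longrightarrow>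
        (\<lambda>n. \<integral>\<omega>. modulate (- x j n) (f (s n)) \<omega> * h \<omega> \<partial>sphere_measure) \<longlonglongrightarrow> (\<integral>\<omega>. \<phi> j \<omega> * h \<omega> \<partial>sphere_measure)"
      and sum_le: "\<And>J c. frequently (\<lambda>n. lpn p sphere_measure (f (s n)) \<le> c) sequentially \<Longrightarrow>
        (\<Sum>j<J. lpn p sphere_measure (\<phi> j) powr max p p') powr (1 / max p p') \<le> c"
      and mod_le: "\<And>J e. 0 < e \<Longrightarrow> eventually (\<lambda>n. lpn p sphere_measure (\<lambda>\<omega>. \<Sum>j<J. modulate (x j n) (\<phi> j) \<omega>)
        \<le> (\<Sum>j<J. lpn p sphere_measure (\<phi> j) powr min p p') powr (1 / min p p') + e) sequentially"
      and dec: "\<And>J. (\<lambda>n. Ip q lborel (extension_op (f (s n))) - (\<Sum>j<J. Ip q lborel (extension_op (\<phi> j)))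
        - Ip q lborel (extension_op (\<lambda>\<omega>. f (s n) \<omega> - (\<Sum>j<J. modulate (x j n) (\<phi> j) \<omega>)))) \<longlonglongrightarrow> 0"
      and van: "\<And>e. 0 < e \<Longrightarrow> \<exists>J0. \<forall>J\<ge>J0. eventually (\<lambda>n.
        lpn q lborel (extension_op (\<lambda>\<omega>. f (s n) \<omega> - (\<Sum>j<J. modulate (x j n) (\<phi> j) \<omega>))) \<le> e) sequentially"
    define r where "r J n \<omega> = f (s n) \<omega> - (\<Sum>j<J. modulate (x j n) (\<phi> j) \<omega>)" for J n \<omega>
    define N where "N j = lpn p sphere_measure (\<phi> j)" for j
    have N0: "0 \<le> N j" for j by (simp add: N_def)
    have LN: "Lnorm (ennreal p) sphere_measure (\<phi> j) = ennreal (N j)" for j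
      unfolding N_def by (rule Lnorm_eq_lpn[OF p0 \<phi>L])
    have mL: "(\<lambda>\<omega>. \<Sum>j<J. modulate (x j n) (\<phi> j) \<omega>) \<in> Lp p sphere_measure" for J n
      using p0 by (intro Lp_sum modulate_Lp \<phi>L) simp
    have rL: "r J n \<in> Lp p sphere_measure" for J n
      unfolding r_def[abs_def] using p0 by (intro Lp_diff fL mL) simp
    have EL: "extension_op g \<in> Lp q lborel" if "g \<in> Lp p sphere_measure" for g :: "real ^ 'n \<Rightarrow> complex"
      using E that by simp
    have LE: "enn2ereal (ennreal_powr (Lnorm (ennreal q) lborel (extension_op g)) q) = ereal (Ip q lborel (extension_op g))"
      if "g \<in> Lp p sphere_measure" for g :: "real ^ 'n \<Rightarrow> complex"
      unfolding Lnorm_eq_lpn[OF q0 EL[OF that]] ennreal_powr_ennreal[OF lpn_nonneg] lpn_powr[OF q0]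
      by (rule enn2ereal_ennreal) simp
    have c_weak: "weak_Llimit (ennreal p) sphere_measure (\<lambda>n. modulate (- x j n) (f (s n))) (\<phi> j)" for j
      by (rule weak_LlimitI[OF pq(1) pp modulate_Lp[OF fL] \<phi>L weak])
    have c_sum: "ennreal_powr (\<Sum>j. ennreal_powr (Lnorm (ennreal p) sphere_measure (\<phi> j)) pt) (1 / pt)
        \<le> liminf (\<lambda>n. Lnorm (ennreal p) sphere_measure (f (s n)))"
    proof (rule dense_ge)
      \<comment> \<open>A finite z above the liminf dominates the norms infinitely often, so it
        bounds all partial sums and hence the series.\<close>
      fix z assume z: "liminf (\<lambda>n. Lnorm (ennreal p) sphere_measure (f (s n))) < z"
      show "ennreal_powr (\<Sum>j. ennreal_powr (Lnorm (ennreal p) sphere_measure (\<phi> j)) pt) (1 / pt) \<le> z"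
      proof (cases z)
        case (real c)
        have "frequently (\<lambda>n. lpn p sphere_measure (f (s n)) \<le> c) sequentially"
        proof (rule ccontr)
          assume "\<not> frequently (\<lambda>n. lpn p sphere_measure (f (s n)) \<le> c) sequentially"
          then have "eventually (\<lambda>n. c \<le> lpn p sphere_measure (f (s n))) sequentially"
            unfolding not_frequently by eventually_elim simp
          then have "eventually (\<lambda>n. z \<le> Lnorm (ennreal p) sphere_measure (f (s n))) sequentially"
            by eventually_elim (simp add: Lnorm_eq_lpn[OF p0 fL] real(2) ennreal_leI)
          then have "z \<le> liminf (\<lambda>n. Lnorm (ennreal p) sphere_measure (f (s n)))" by (rule Liminf_bounded)
          then show False using z by simp
        qed
        then have le: "(\<Sum>j<J. N j powr pt) powr (1 / pt) \<le> c" for J unfolding N_def pt_def by (rule sum_le)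
        have part: "(\<Sum>j<J. N j powr pt) \<le> c powr pt" for J
        proof -
          have "((\<Sum>j<J. N j powr pt) powr (1 / pt)) powr pt \<le> c powr pt"
            using pt(1) by (intro powr_mono2 le) auto
          then show ?thesis using pt(1) by (simp add: powr_powr sum_nonneg)
        qed
        have "(\<Sum>j. ennreal_powr (ennreal (N j)) pt) \<le> ennreal (c powr pt)"
        proof (rule suminf_le_const)
          show "(\<Sum>j<J. ennreal_powr (ennreal (N j)) pt) \<le> ennreal (c powr pt)" for J
            using part[of J] by (simp add: ennreal_powr_ennreal[OF N0] ennreal_leI)
        qed simp
        then have "ennreal_powr (\<Sum>j. ennreal_powr (ennreal (N j)) pt) (1 / pt) \<le> ennreal ((c powr pt) powr (1 / pt))"
          using pt(1) by (intro ennreal_powr_mono) auto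
        also have "(c powr pt) powr (1 / pt) = c" using real(1) pt(1) by (simp add: powr_powr)
        finally show ?thesis by (simp add: LN real(2))
      qed simp
    qed
    have c_mod: "limsup (\<lambda>n. Lnorm (ennreal p) sphere_measure (\<lambda>\<omega>. \<Sum>j<J. modulate (x j n) (\<phi> j) \<omega>))
        \<le> ennreal_powr (\<Sum>j<J. ennreal_powr (Lnorm (ennreal p) sphere_measure (\<phi> j))
              (conj_exponent pt)) (1 / conj_exponent pt)" for J
    proof -
      define A where "A = (\<Sum>j<J. N j powr min p p') powr (1 / min p p')"
      have rhs: "ennreal_powr (\<Sum>j<J. ennreal_powr (Lnorm (ennreal p) sphere_measure (\<phi> j)) (conj_exponent pt)) (1 / conj_exponent pt) = ennreal A"
        unfolding pt(2) A_def LN by (simp add: ennreal_powr_ennreal N0 sum_nonneg)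
      show ?thesis unfolding rhs
      proof (rule ennreal_le_epsilon)
        fix e :: real assume e: "0 < e"
        have "eventually (\<lambda>n. Lnorm (ennreal p) sphere_measure (\<lambda>\<omega>. \<Sum>j<J. modulate (x j n) (\<phi> j) \<omega>) \<le> ennreal (A + e)) sequentially"
          using mod_le[OF e, of J]
          by eventually_elim (simp add: Lnorm_eq_lpn[OF p0 mL] A_def N_def ennreal_leI del: ennreal_plus)
        then have "limsup (\<lambda>n. Lnorm (ennreal p) sphere_measure (\<lambda>\<omega>. \<Sum>j<J. modulate (x j n) (\<phi> j) \<omega>)) \<le> ennreal (A + e)"
          by (rule Limsup_bounded)
        also have "ennreal (A + e) = ennreal A + ennreal e" using e by (intro ennreal_plus) (auto simp: A_def)
        finally show "limsup (\<lambda>n. Lnorm (ennreal p) sphere_measure (\<lambda>\<omega>. \<Sum>j<J. modulate (x j n) (\<phi> j) \<omega>)) \<le> ennreal A + ennreal e" .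
      qed
    qed
    have c_dec: "(\<lambda>n. enn2ereal (ennreal_powr (Lnorm (ennreal q) lborel (extension_op (f (s n)))) q)
              - (\<Sum>j<J. enn2ereal (ennreal_powr (Lnorm (ennreal q) lborel (extension_op (\<phi> j))) q))
              - enn2ereal (ennreal_powr (Lnorm (ennreal q) lborel (extension_op (r J n))) q))
        \<longlonglongrightarrow> 0" for J
    proof -
      \<comment> \<open>All terms are finite by the extension estimate, so the differences of
        extended reals are differences of real numbers.\<close>
      have "(\<lambda>n. ereal (Ip q lborel (extension_op (f (s n))) - (\<Sum>j<J. Ip q lborel (extension_op (\<phi> j)))
        - Ip q lborel (extension_op (r J n)))) \<longlonglongrightarrow> ereal 0"
        unfolding r_def[abs_def] by (intro tendsto_ereal dec)
      then show ?thesis by (simp add: LE[OF fL] LE[OF \<phi>L] LE[OF rL] zero_ereal_def)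
    qed
    have c_van: "(\<lambda>J. limsup (\<lambda>n. Lnorm (ennreal q) lborel (extension_op (r J n)))) \<longlonglongrightarrow> 0"
    proof (rule tendsto_zero_ennrealI)
      fix e :: real assume e: "0 < e"
      obtain J0 where J0: "\<forall>J\<ge>J0. eventually (\<lambda>n. lpn q lborel (extension_op (r J n)) \<le> e) sequentially"
        using van[OF e] unfolding r_def[abs_def] by (rule exE)
      have "limsup (\<lambda>n. Lnorm (ennreal q) lborel (extension_op (r J n))) \<le> ennreal e" if J: "J0 \<le> J" for J
      proof (rule Limsup_bounded)
        have "eventually (\<lambda>n. lpn q lborel (extension_op (r J n)) \<le> e) sequentially" using J0 J by simp
        then show "eventually (\<lambda>n. Lnorm (ennreal q) lborel (extension_op (r J n)) \<le> ennreal e) sequentially"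
          by eventually_elim (simp add: Lnorm_eq_lpn[OF q0 EL[OF rL]] ennreal_leI)
      qed
      then show "eventually (\<lambda>J. limsup (\<lambda>n. Lnorm (ennreal q) lborel (extension_op (r J n))) \<le> ennreal e) sequentially"
        unfolding eventually_sequentially by (intro exI[of _ J0]) simp
    qed
    show ?thesis
      unfolding Let_def p'_def[symmetric] pt_def[symmetric]
      by (intro exI[of _ s] exI[of _ x] exI[of _ \<phi>] conjI allI impI s div c_weak c_sum c_mod
          c_dec[unfolded r_def[abs_def]] c_van[unfolded r_def[abs_def]])
  qed
qed

end
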